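(* There is an absolute constant $L$ such that for every $\varepsilon>0$ there exists $v>0$ (large enough, depending only on $\varepsilon$) such that the following holds. For every integer $N\ge 1$ and every probability distribution $Q$ on the set of probability measures on the unit sphere $S=\{z\in\mathbb{R}^N:|z|=1\}$ there exists a (non-random) measurable function $g:S\to\mathbb{R}$ such that $$\sup_{z\in S}|g(z)|\le L\,v\sqrt N\qquad\text{and}\qquad \int \nu_g^{\otimes 2}\bigl\{(z^1,z^2)\in S^2: z^1\cdot z^2\le-\varepsilon\bigr\}\,dQ(\nu)\le\varepsilon .$$
   Context: For a (Borel) probability measure $\nu$ on $S$ and a measurable $g:S\to\mathbb{R}$ with $\int e^{g}\,d\nu<\infty$, the probability measure $\nu_g$ on $S$ is defined by the density $$\frac{d\nu_g}{d\nu}(z)=\frac{e^{g(z)}}{\int e^{g(z')}\,d\nu(z')},$$ and $\nu_g^{\otimes2}$ is the product of $\nu_g$ with itself. $z^1\cdot z^2$ is the usual scalar product on $\mathbb{R}^N$. The set of Borel probability measures on $S$ is equipped with its usual $\sigma$-algebra (the Borel $\sigma$-algebra of the weak topology). *)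

theory Defs
  imports "HOL-Probability.Probability"
begin

definition borel_of :: "'a topology \<Rightarrow> 'a measure" where
  "borel_of X = sigma (topspace X) {U. openin X U}"

lemma space_borel_of: "space (borel_of X) = topspace X"
  unfolding borel_of_def by (rule space_measure_of) (auto dest: openin_subset)

lemma sets_borel_of: "sets (borel_of X) = sigma_sets (topspace X) {U. openin X U}"
  unfolding borel_of_def by (rule sets_measure_of) (auto dest: openin_subset)

definition borel_prob_measures :: "'a topology \<Rightarrow> 'a measure set" where
  "borel_prob_measures X = {\<nu>. prob_space \<nu> \<and> sets \<nu> = sets (borel_of X)}"

text \<open>The coarsest topology on the Borel probability measures that makes
  \<open>\<nu> \<mapsto> \<integral> f d\<nu>\<close> continuous for every bounded continuous real function \<open>f\<close>.\<close>

definition weak_topology :: "'a topology \<Rightarrow> 'a measure topology" where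
  "weak_topology X = topology_generated_by
     {{\<nu> \<in> borel_prob_measures X. (\<integral>z. f z \<partial>\<nu>) \<in> U} | f U.
        continuous_map X euclideanreal f \<and> bounded (f ` topspace X) \<and> open U}"

lemma topspace_weak_topology: "topspace (weak_topology X) = borel_prob_measures X"
proof -
  have "borel_prob_measures X =
      {\<nu> \<in> borel_prob_measures X. (\<integral>z. (\<lambda>_. 0::real) z \<partial>\<nu>) \<in> UNIV}"
    by simp
  moreover have "continuous_map X euclideanreal (\<lambda>_. 0) \<and>
      bounded ((\<lambda>_. 0::real) ` topspace X) \<and> open (UNIV :: real set)"
    by (auto simp: bounded_iff)
  ultimately have "borel_prob_measures X \<in>
      {{\<nu> \<in> borel_prob_measures X. (\<integral>z. f z \<partial>\<nu>) \<in> U} | f U.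
        continuous_map X euclideanreal f \<and> bounded (f ` topspace X) \<and> open U}"
    by blast
  then show ?thesis
    unfolding weak_topology_def topology_generated_by_topspace by blast
qed

text \<open>As in \<^const>\<open>Euclidean_space\<close>, a point of \<open>\<real>\<^sup>N\<close> is a function on the naturals that
  vanishes from \<open>N\<close> on, so that \<open>N\<close> can be quantified inside a formula.  The library's
  \<^const>\<open>nsphere\<close> is indexed by the dimension of the sphere, hence \<open>N - 1\<close>; this is the
  unit sphere of \<open>\<real>\<^sup>N\<close> only for \<open>N \<ge> 1\<close>.\<close>

abbreviation unit_sphere :: "nat \<Rightarrow> (nat \<Rightarrow> real) topology" where
  "unit_sphere N \<equiv> nsphere (N - 1)"

definition scalar_prod :: "nat \<Rightarrow> (nat \<Rightarrow> real) \<Rightarrow> (nat \<Rightarrow> real) \<Rightarrow> real" where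
  "scalar_prod N x y = (\<Sum>i<N. x i * y i)"

lemma topspace_unit_sphere:
  assumes "N \<ge> 1"
  shows "topspace (unit_sphere N) = {z. (\<forall>i\<ge>N. z i = 0) \<and> scalar_prod N z z = 1}"
proof -
  obtain n where N: "N = Suc n"
    using assms by (cases N) auto
  show ?thesis
    unfolding N scalar_prod_def nsphere_def
    by (auto simp: topspace_Euclidean_space power2_eq_square lessThan_Suc_atMost)
qed

definition tilted :: "('a \<Rightarrow> real) \<Rightarrow> 'a measure \<Rightarrow> 'a measure" where
  "tilted g \<nu> = density \<nu> (\<lambda>z. ennreal (exp (g z) / (\<integral>z'. exp (g z') \<partial>\<nu>)))"

definition negative_overlap :: "nat \<Rightarrow> real \<Rightarrow> ((nat \<Rightarrow> real) \<times> (nat \<Rightarrow> real)) set" where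
  "negative_overlap N \<epsilon> =
     {(z1, z2). z1 \<in> topspace (unit_sphere N) \<and> z2 \<in> topspace (unit_sphere N) \<and>
                scalar_prod N z1 z2 \<le> - \<epsilon>}"

lemma coordinate_measurable_sphere: "(\<lambda>z. z i) \<in> borel_measurable (borel_of (nsphere n))"
proof (rule borel_measurableI)
  fix U :: "real set"
  assume "open U"
  have "continuous_map (nsphere n) euclideanreal (\<lambda>z. z i)"
    unfolding nsphere_def Euclidean_space_def
    by (intro continuous_map_from_subtopology continuous_map_product_projection) auto
  then have "openin (nsphere n) {z \<in> topspace (nsphere n). z i \<in> U}"
    using \<open>open U\<close> by (simp add: continuous_map_def)
  moreover have "(\<lambda>z. z i) -` U \<inter> space (borel_of (nsphere n)) =
      {z \<in> topspace (nsphere n). z i \<in> U}"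
    by (auto simp: space_borel_of)
  ultimately show "(\<lambda>z. z i) -` U \<inter> space (borel_of (nsphere n)) \<in> sets (borel_of (nsphere n))"
    by (simp add: sets_borel_of sigma_sets.Basic)
qed

lemma negative_overlap_measurable:
  assumes "sets \<nu> = sets (borel_of (unit_sphere N))"
  shows "negative_overlap N \<epsilon> \<in> sets (tilted g \<nu> \<Otimes>\<^sub>M tilted g \<nu>)"
proof -
  let ?B = "borel_of (unit_sphere N)"
  note [measurable] = coordinate_measurable_sphere
  have "{w \<in> space (?B \<Otimes>\<^sub>M ?B). scalar_prod N (fst w) (snd w) \<le> - \<epsilon>} \<in> sets (?B \<Otimes>\<^sub>M ?B)"
    unfolding scalar_prod_def by measurable
  moreover have "{w \<in> space (?B \<Otimes>\<^sub>M ?B). scalar_prod N (fst w) (snd w) \<le> - \<epsilon>} = negative_overlap N \<epsilon>"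
    by (auto simp: negative_overlap_def space_pair_measure space_borel_of)
  moreover have "sets (tilted g \<nu> \<Otimes>\<^sub>M tilted g \<nu>) = sets (?B \<Otimes>\<^sub>M ?B)"
    by (intro sets_pair_measure_cong) (simp_all add: tilted_def assms)
  ultimately show ?thesis
    by simp
qed

end

theory Submission
  imports Defs
begin

text \<open>
  The function \<open>g\<close> is drawn at random from a law that does not depend on \<open>Q\<close>.  It then suffices to
  show, for every single measure \<open>\<nu>\<close>, that the mean over \<open>g\<close> of
  \<open>\<nu>\<^sub>g\<^sup>\<otimes>\<^sup>2{z\<^sup>1 \<cdot> z\<^sup>2 \<le> -\<epsilon>}\<close> is at most \<open>\<epsilon>\<close>: integrating over \<open>Q\<close>, some value of \<open>g\<close> does at
  least as well as the mean.  Composing \<open>g\<close> with a rounding of the coordinates to a fine grid turns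
  \<open>\<nu>\<close> into a probability vector on a finite set \<open>X\<close>, so that all averages are finite sums.

  The law of \<open>g\<close> is built from random fields \<open>\<sigma> : X \<rightarrow> {-1,1}\<close> of mean zero.  The basic one has a
  covariance \<open>K\<close> that is at most \<open>-\<delta>\<close>, with \<open>\<delta>\<close> depending on \<open>\<epsilon>\<close> only, at every pair of points of
  scalar product at most \<open>-\<epsilon>/2\<close> (\<open>overlap_sign_field\<close>).  The product of \<open>j\<close> independent copies has
  covariance \<open>K\<^sup>j\<close>.  With independent copies \<open>\<sigma>\<^sub>j\<^sub>,\<^sub>r\<close> of these products put
  \<open>g = \<eta> (\<Sum>j\<le>d. u\<^sub>j (\<Sum>r<k. \<sigma>\<^sub>j\<^sub>,\<^sub>r))\<close>, where the \<open>u\<^sub>j\<close> are independent uniform integers in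
  \<open>[m, 2m)\<close>.  The parameters \<open>d, k, m, \<eta>\<close> depend on \<open>\<epsilon>\<close> only, and therefore so does the bound on
  \<open>\<bar>g\<bar>\<close>; since signs are bounded, no supremum of a random process over the sphere has to be estimated.

  Write \<open>\<langle>\<cdot>\<rangle>\<close> for the average over independent points (replicas) \<open>z\<^sub>1, z\<^sub>2, \<dots>\<close> with law \<open>\<nu>\<^sub>g\<close>, and
  \<open>H\<^sub>j = \<eta> (\<Sum>r<k. \<sigma>\<^sub>j\<^sub>,\<^sub>r)\<close>.  Because every single sign enters with a small coefficient,
  \<open>E\<langle>f H\<^sub>j(z\<^sub>l)\<rangle>\<close> can be computed by integration by parts for each function \<open>f\<close> of \<open>n\<close> replicas
  (\<open>approximate_integration_by_parts\<close>).  On the other hand, the free energy is convex in \<open>u\<^sub>j\<close> and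
  has small variance, so for most \<open>u\<^sub>j\<close> the variable \<open>H\<^sub>j\<close> is nearly constant on its natural scale
  (\<open>block_concentration\<close>), which decouples it from \<open>f\<close>.  Comparing the two gives the
  Ghirlanda-Guerra identities
  \<open>n E\<langle>f K\<^sup>j(z\<^sub>l, z\<^sub>n\<^sub>+\<^sub>1)\<rangle> \<approx> E\<langle>f\<rangle> E\<langle>K\<^sup>j(z\<^sub>1, z\<^sub>2)\<rangle> + (\<Sum>k\<noteq>l. E\<langle>f K\<^sup>j(z\<^sub>l, z\<^sub>k)\<rangle>)\<close>,
  and by the Weierstrass theorem the same with a continuous function of \<open>K\<close> in place of \<open>K\<^sup>j\<close>.

  Talagrand's argument finishes the proof.  Let \<open>\<pi>\<close> be the probability that \<open>K(z\<^sub>1, z\<^sub>2) \<le> -\<delta>\<close> and let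
  \<open>f\<close> indicate that \<open>n\<close> replicas have pairwise negative covariances.  By the identities for a function
  that vanishes on the negative values present in \<open>f\<close>, the mean number of replicas to which a new one
  is not negatively correlated is, given \<open>f\<close>, at most about \<open>1 - \<pi>\<close>.  Hence the probability that \<open>n + 1\<close> replicas
  are pairwise negative is, up to errors, at least \<open>\<pi>\<close> times that for \<open>n\<close> replicas, and so at least \<open>\<pi>\<^sup>n\<close>.
  But a covariance matrix is positive semidefinite, so more than about \<open>1 + 2/\<delta>\<close> points cannot have
  all their covariances below \<open>-\<delta>/2\<close>.  Thus \<open>\<pi>\<close> is small
  (\<open>negative_pairs_rare\<close>, \<open>negative_pairs_rarely_survive\<close>).
\<close>

section \<open>Means over finitely supported laws and over replicas\<close>

abbreviation expect :: "'w pmf \<Rightarrow> ('w \<Rightarrow> 'b::{banach, second_countable_topology}) \<Rightarrow> 'b"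
  where "expect D f \<equiv> measure_pmf.expectation D f"

lemma expect_mono:
  fixes f g :: "'w \<Rightarrow> real"
  assumes "finite (set_pmf D)" "\<And>w. w \<in> set_pmf D \<Longrightarrow> f w \<le> g w"
  shows "expect D f \<le> expect D g"
  using assms by (intro integral_mono_AE) (auto intro: integrable_measure_pmf_finite AE_pmfI)

lemma expect_abs_le:
  fixes f g :: "'w \<Rightarrow> real"
  assumes "finite (set_pmf D)" "\<And>w. w \<in> set_pmf D \<Longrightarrow> \<bar>f w\<bar> \<le> g w"
  shows "\<bar>expect D f\<bar> \<le> expect D g"
proof -
  have "\<bar>expect D f\<bar> \<le> expect D (\<lambda>w. \<bar>f w\<bar>)"
    by (rule integral_abs_bound)
  also have "\<dots> \<le> expect D g"
    using assms by (intro expect_mono) auto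
  finally show ?thesis .
qed

lemma expect_abs_le_const:
  fixes f :: "'w \<Rightarrow> real"
  assumes "finite (set_pmf D)" "\<And>w. w \<in> set_pmf D \<Longrightarrow> \<bar>f w\<bar> \<le> c"
  shows "\<bar>expect D f\<bar> \<le> c"
  using expect_abs_le[of D f "\<lambda>_. c"] assms by simp

lemma expect_add:
  fixes f g :: "'w \<Rightarrow> 'b::{banach, second_countable_topology}"
  assumes "finite (set_pmf D)"
  shows "expect D (\<lambda>w. f w + g w) = expect D f + expect D g"
  using assms by (intro Bochner_Integration.integral_add integrable_measure_pmf_finite)

lemma expect_diff:
  fixes f g :: "'w \<Rightarrow> 'b::{banach, second_countable_topology}"
  assumes "finite (set_pmf D)"
  shows "expect D (\<lambda>w. f w - g w) = expect D f - expect D g"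
  using assms by (intro Bochner_Integration.integral_diff integrable_measure_pmf_finite)

lemma expect_sum:
  fixes f :: "'i \<Rightarrow> 'w \<Rightarrow> 'b::{banach, second_countable_topology}"
  assumes "finite (set_pmf D)"
  shows "expect D (\<lambda>w. \<Sum>i\<in>I. f i w) = (\<Sum>i\<in>I. expect D (f i))"
  using assms by (intro Bochner_Integration.integral_sum integrable_measure_pmf_finite)

lemma expect_pair:
  fixes f :: "'w \<times> 'v \<Rightarrow> 'b::{banach, second_countable_topology}"
  assumes "finite (set_pmf A)" "finite (set_pmf B)"
  shows "expect (pair_pmf A B) f = expect B (\<lambda>b. expect A (\<lambda>a. f (a, b)))"
proof -
  have "expect (pair_pmf A B) f =
      (\<Sum>w\<in>set_pmf A \<times> set_pmf B. pmf (pair_pmf A B) w *\<^sub>R f w)"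
    using assms by (intro integral_measure_pmf) auto
  also have "\<dots> = (\<Sum>a\<in>set_pmf A. \<Sum>b\<in>set_pmf B. pmf B b *\<^sub>R (pmf A a *\<^sub>R f (a, b)))"
    unfolding sum.cartesian_product
    by (intro sum.cong) (auto simp: pmf_pair mult.commute)
  also have "\<dots> = (\<Sum>b\<in>set_pmf B. pmf B b *\<^sub>R (\<Sum>a\<in>set_pmf A. pmf A a *\<^sub>R f (a, b)))"
    by (subst sum.swap) (simp add: scaleR_sum_right)
  also have "\<dots> = (\<Sum>b\<in>set_pmf B. pmf B b *\<^sub>R expect A (\<lambda>a. f (a, b)))"
    using assms by (intro sum.cong refl arg_cong2[where f = scaleR] integral_measure_pmf[symmetric]) auto
  also have "\<dots> = expect B (\<lambda>b. expect A (\<lambda>a. f (a, b)))"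
    using assms by (intro integral_measure_pmf[symmetric]) auto
  finally show ?thesis .
qed

lemma finite_set_Pi_pmf:
  assumes "finite I" "\<And>i. i \<in> I \<Longrightarrow> finite (set_pmf (D i))"
  shows "finite (set_pmf (Pi_pmf I d D))"
  using assms by (simp add: set_Pi_pmf) (intro finite_PiE_dflt, auto)

lemma expect_Pi_insert:
  fixes f :: "('i \<Rightarrow> 'w) \<Rightarrow> 'b::{banach, second_countable_topology}"
  assumes "finite I" "i \<notin> I" "finite (set_pmf (D i))" "\<And>j. j \<in> I \<Longrightarrow> finite (set_pmf (D j))"
  shows "expect (Pi_pmf (insert i I) d D) f = expect (Pi_pmf I d D) (\<lambda>w. expect (D i) (\<lambda>a. f (w(i := a))))"
proof -
  have "expect (Pi_pmf (insert i I) d D) f =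
      expect (pair_pmf (D i) (Pi_pmf I d D)) (\<lambda>(a, w). f (w(i := a)))"
    using assms by (simp add: Pi_pmf_insert case_prod_unfold)
  also have "\<dots> = expect (Pi_pmf I d D) (\<lambda>w. expect (D i) (\<lambda>a. f (w(i := a))))"
    using assms by (subst expect_pair) (auto intro: finite_set_Pi_pmf)
  finally show ?thesis .
qed

text \<open>
  Replacing one coordinate by a fresh independent copy does not change the joint law.  This is how
  a single random sign is isolated from the rest of the disorder.
\<close>
lemma expect_Pi_resample:
  fixes f :: "('i \<Rightarrow> 'w) \<Rightarrow> 'b::{banach, second_countable_topology}"
  assumes "finite I" "i \<in> I" "\<And>j. j \<in> I \<Longrightarrow> finite (set_pmf (D j))"
  shows "expect (Pi_pmf I d D) f = expect (Pi_pmf I d D) (\<lambda>w. expect (D i) (\<lambda>a. f (w(i := a))))"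
proof -
  define I' where "I' = I - {i}"
  have I: "I = insert i I'" "i \<notin> I'" "finite I'"
    using assms by (auto simp: I'_def)
  have ins: "expect (Pi_pmf I d D) h = expect (Pi_pmf I' d D) (\<lambda>w. expect (D i) (\<lambda>a. h (w(i := a))))"
    for h :: "('i \<Rightarrow> 'w) \<Rightarrow> 'b"
    unfolding I(1) using I assms by (intro expect_Pi_insert) auto
  show ?thesis
    by (subst (1 2) ins) simp
qed

lemma expect_Pi_prod:
  fixes f :: "'i \<Rightarrow> 'w \<Rightarrow> 'b::{real_normed_field, banach, second_countable_topology}"
  assumes "finite I" "\<And>i. i \<in> I \<Longrightarrow> finite (set_pmf (D i))"
  shows "expect (Pi_pmf I d D) (\<lambda>w. \<Prod>i\<in>I. f i (w i)) = (\<Prod>i\<in>I. expect (D i) (f i))"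
  using assms
proof (induction I rule: finite_induct)
  case (insert i I)
  have upd: "(\<Prod>j\<in>I. f j ((w(i := a)) j)) = (\<Prod>j\<in>I. f j (w j))" for w a
    using insert by (intro prod.cong) auto
  have "expect (Pi_pmf (insert i I) d D) (\<lambda>w. \<Prod>i\<in>insert i I. f i (w i)) =
      expect (Pi_pmf I d D) (\<lambda>w. expect (D i) (\<lambda>a. f i a * (\<Prod>j\<in>I. f j (w j))))"
    using insert upd by (subst expect_Pi_insert) (auto simp del: fun_upd_apply simp: fun_upd_same)
  also have "\<dots> = expect (D i) (f i) * expect (Pi_pmf I d D) (\<lambda>w. \<Prod>j\<in>I. f j (w j))"
    by simp
  finally show ?case
    using insert by simp
qed simp

definition prob_vector :: "'a set \<Rightarrow> ('a \<Rightarrow> real) \<Rightarrow> bool" where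
  "prob_vector X p \<longleftrightarrow> finite X \<and> (\<forall>x\<in>X. 0 \<le> p x) \<and> sum p X = 1"

lemma prob_vectorD:
  assumes "prob_vector X p"
  shows "finite X" "\<And>x. x \<in> X \<Longrightarrow> 0 \<le> p x" "sum p X = 1"
  using assms by (auto simp: prob_vector_def)

lemma prob_vector_mean_le:
  assumes "prob_vector X p" "\<And>x. x \<in> X \<Longrightarrow> h x \<le> c"
  shows "(\<Sum>x\<in>X. p x * h x) \<le> c"
proof -
  have "(\<Sum>x\<in>X. p x * h x) \<le> (\<Sum>x\<in>X. p x * c)"
    using assms by (intro sum_mono mult_left_mono) (auto simp: prob_vector_def)
  then show ?thesis
    using assms by (simp add: prob_vector_def flip: sum_distrib_right)
qed

lemma prob_vector_mean_ge:
  assumes "prob_vector X p" "\<And>x. x \<in> X \<Longrightarrow> c \<le> h x"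
  shows "c \<le> (\<Sum>x\<in>X. p x * h x)"
  using prob_vector_mean_le[OF assms(1), of "\<lambda>x. - h x" "- c"] assms(2)
  by (simp add: sum_negf)

lemma prob_vector_mean_abs_le:
  assumes "prob_vector X p" "\<And>x. x \<in> X \<Longrightarrow> \<bar>h x\<bar> \<le> c"
  shows "\<bar>\<Sum>x\<in>X. p x * h x\<bar> \<le> c"
proof -
  have "(\<Sum>x\<in>X. p x * h x) \<le> c" "- c \<le> (\<Sum>x\<in>X. p x * h x)"
    using assms by (fastforce intro: prob_vector_mean_le prob_vector_mean_ge)+
  then show ?thesis by linarith
qed

definition tilt :: "'a set \<Rightarrow> ('a \<Rightarrow> real) \<Rightarrow> ('a \<Rightarrow> real) \<Rightarrow> 'a \<Rightarrow> real" where
  "tilt X p h x = p x * exp (h x) / (\<Sum>y\<in>X. p y * exp (h y))"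

lemma partition_pos:
  assumes "prob_vector X p"
  shows "0 < (\<Sum>y\<in>X. p y * exp (h y))"
proof -
  obtain x where x: "x \<in> X" "p x \<noteq> 0"
    using assms unfolding prob_vector_def by (metis sum.neutral zero_neq_one)
  then have "0 < p x"
    using assms by (auto simp: prob_vector_def order.strict_iff_order)
  with x show ?thesis
    using assms by (intro sum_pos2[of X x]) (auto simp: prob_vector_def)
qed

lemma prob_vector_tilt:
  assumes "prob_vector X p"
  shows "prob_vector X (tilt X p h)"
  using partition_pos[OF assms, of h] assms
  by (auto simp: prob_vector_def tilt_def simp flip: sum_divide_distrib)

lemma tilt_mean:
  "(\<Sum>x\<in>X. tilt X p h x * f x) = (\<Sum>x\<in>X. p x * exp (h x) * f x) / (\<Sum>y\<in>X. p y * exp (h y))"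
  by (simp add: tilt_def sum_divide_distrib)

lemma tilt_tilt:
  assumes "prob_vector X p"
  shows "tilt X (tilt X p g) h = tilt X p (\<lambda>x. g x + h x)"
proof
  fix x
  have Z: "(\<Sum>y\<in>X. p y * exp (g y)) > 0"
    using partition_pos[OF assms] .
  have "(\<Sum>y\<in>X. tilt X p g y * exp (h y)) = (\<Sum>y\<in>X. p y * exp (g y + h y)) / (\<Sum>y\<in>X. p y * exp (g y))"
    unfolding tilt_mean by (simp add: exp_add mult.assoc)
  then show "tilt X (tilt X p g) h x = tilt X p (\<lambda>x. g x + h x) x"
    using Z by (simp add: tilt_def exp_add)
qed

text \<open>
  The average over \<open>n\<close> independent points with law \<open>p\<close>.  The points are a function on \<open>{..<n}\<close>, so that
  the next replica is added by a function update at \<open>n\<close>.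
\<close>
definition replica_avg :: "'a set \<Rightarrow> ('a \<Rightarrow> real) \<Rightarrow> nat \<Rightarrow> ((nat \<Rightarrow> 'a) \<Rightarrow> real) \<Rightarrow> real" where
  "replica_avg X p n f = (\<Sum>z\<in>PiE {..<n} (\<lambda>_. X). (\<Prod>l<n. p (z l)) * f z)"

lemma replica_avg_prod:
  assumes "finite X"
  shows "replica_avg X p n (\<lambda>z. \<Prod>l<n. h l (z l)) = (\<Prod>l<n. \<Sum>x\<in>X. p x * h l x)"
  using assms by (simp add: replica_avg_def prod_sum_PiE flip: prod.distrib)

lemma prob_vector_replicas:
  fixes n :: nat
  assumes "prob_vector X p"
  shows "prob_vector (PiE {..<n} (\<lambda>_. X)) (\<lambda>z. \<Prod>l<n. p (z l))"
proof -
  have "(\<Sum>z\<in>PiE {..<n} (\<lambda>_. X). \<Prod>l<n. p (z l)) = 1"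
    using replica_avg_prod[of X p n "\<lambda>_ _. 1"] assms by (simp add: replica_avg_def prob_vector_def)
  then show ?thesis
    using assms by (auto simp: prob_vector_def intro!: finite_PiE prod_nonneg)
qed

lemma replica_avg_const:
  assumes "prob_vector X p"
  shows "replica_avg X p n (\<lambda>_. c) = c"
  using prob_vector_replicas[OF assms, of n]
  by (simp add: replica_avg_def prob_vector_def flip: sum_distrib_right)

lemma replica_avg_marginal:
  assumes "prob_vector X p" "l < n"
  shows "replica_avg X p n (\<lambda>z. h (z l)) = (\<Sum>x\<in>X. p x * h x)"
proof -
  have "replica_avg X p n (\<lambda>z. h (z l)) = replica_avg X p n (\<lambda>z. \<Prod>k<n. if k = l then h (z k) else 1)"
    using assms by (intro arg_cong[where f = "replica_avg X p n"] ext) (simp add: prod.delta)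
  also have "\<dots> = (\<Prod>k<n. \<Sum>x\<in>X. p x * (if k = l then h x else 1))"
    using assms by (subst replica_avg_prod) (auto simp: prob_vector_def)
  also have "\<dots> = (\<Prod>k<n. if k = l then (\<Sum>x\<in>X. p x * h x) else 1)"
    using assms by (intro prod.cong) (auto simp: prob_vector_def)
  also have "\<dots> = (\<Sum>x\<in>X. p x * h x)"
    using assms by (simp add: prod.delta)
  finally show ?thesis .
qed

lemma replica_avg_mono:
  assumes "prob_vector X p" "\<And>z. z \<in> PiE {..<n} (\<lambda>_. X) \<Longrightarrow> f z \<le> g z"
  shows "replica_avg X p n f \<le> replica_avg X p n g"
  unfolding replica_avg_def using assms prob_vectorD(2)[OF prob_vector_replicas[OF assms(1)]]
  by (intro sum_mono mult_left_mono) auto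

lemma replica_avg_cong:
  assumes "\<And>z. z \<in> PiE {..<n} (\<lambda>_. X) \<Longrightarrow> f z = g z"
  shows "replica_avg X p n f = replica_avg X p n g"
  unfolding replica_avg_def using assms by (intro sum.cong) auto

lemma replica_avg_add: "replica_avg X p n (\<lambda>z. f z + g z) = replica_avg X p n f + replica_avg X p n g"
  by (simp add: replica_avg_def distrib_left sum.distrib)

lemma replica_avg_diff: "replica_avg X p n (\<lambda>z. f z - g z) = replica_avg X p n f - replica_avg X p n g"
  by (simp add: replica_avg_def right_diff_distrib sum_subtractf)

lemma replica_avg_cmult: "replica_avg X p n (\<lambda>z. c * f z) = c * replica_avg X p n f"
  by (simp add: replica_avg_def sum_distrib_left algebra_simps)

lemma replica_avg_sum: "replica_avg X p n (\<lambda>z. \<Sum>i\<in>I. f i z) = (\<Sum>i\<in>I. replica_avg X p n (f i))"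
  by (simp add: replica_avg_def sum_distrib_left) (rule sum.swap)

lemma replica_avg_abs_le:
  assumes "prob_vector X p" "\<And>z. z \<in> PiE {..<n} (\<lambda>_. X) \<Longrightarrow> \<bar>f z\<bar> \<le> c"
  shows "\<bar>replica_avg X p n f\<bar> \<le> c"
  unfolding replica_avg_def
  by (intro prob_vector_mean_abs_le prob_vector_replicas assms)

lemma replica_avg_abs:
  assumes "prob_vector X p"
  shows "\<bar>replica_avg X p n f\<bar> \<le> replica_avg X p n (\<lambda>z. \<bar>f z\<bar>)"
proof -
  have "replica_avg X p n f \<le> replica_avg X p n (\<lambda>z. \<bar>f z\<bar>)"
    by (intro replica_avg_mono assms) auto
  moreover have "replica_avg X p n (\<lambda>z. - 1 * f z) \<le> replica_avg X p n (\<lambda>z. \<bar>f z\<bar>)"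
    by (intro replica_avg_mono assms) auto
  ultimately show ?thesis
    unfolding replica_avg_cmult by linarith
qed

lemma replica_avg_Suc:
  "replica_avg X p (Suc n) f = replica_avg X p n (\<lambda>z. \<Sum>y\<in>X. p y * f (z(n := y)))"
proof -
  have "replica_avg X p (Suc n) f =
      (\<Sum>(y, z)\<in>X \<times> PiE {..<n} (\<lambda>_. X). (\<Prod>l<Suc n. p ((z(n := y)) l)) * f (z(n := y)))"
    unfolding replica_avg_def lessThan_Suc PiE_insert_eq
    by (subst sum.reindex[OF inj_combinator]) (auto simp: case_prod_unfold)
  also have "\<dots> = (\<Sum>(y, z)\<in>X \<times> PiE {..<n} (\<lambda>_. X). (\<Prod>l<n. p (z l)) * (p y * f (z(n := y))))"
  proof -
    have "(\<Prod>l<Suc n. p ((z(n := y)) l)) = (\<Prod>l<n. p (z l)) * p y" for z y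
      by simp
    then show ?thesis
      by (simp only: mult.assoc)
  qed
  also have "\<dots> = replica_avg X p n (\<lambda>z. \<Sum>y\<in>X. p y * f (z(n := y)))"
    unfolding replica_avg_def sum_distrib_left
    by (subst sum.cartesian_product[symmetric], subst sum.swap) simp
  finally show ?thesis .
qed

text \<open>
  Averages under a tilted law become averages under the original one with a product density, which can
  be expanded while the law of the replicas stays fixed.
\<close>
lemma replica_avg_tilt:
  "replica_avg X (tilt X p h) n f =
    replica_avg X p n (\<lambda>z. (\<Prod>l<n. exp (h (z l)) / (\<Sum>y\<in>X. p y * exp (h y))) * f z)"
  unfolding replica_avg_def tilt_def
  by (intro sum.cong refl) (simp add: prod.distrib prod_dividef)

section \<open>Random signs and approximate integration by parts\<close>

definition bool_sign :: "bool \<Rightarrow> real" where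
  "bool_sign b = (if b then 1 else - 1)"

lemma abs_bool_sign [simp]: "\<bar>bool_sign b\<bar> = 1"
  by (simp add: bool_sign_def)

lemma bool_sign_square [simp]: "bool_sign b * bool_sign b = 1"
  by (simp add: bool_sign_def)

lemma abs_exp_minus_linear_le:
  fixes u :: real
  assumes "\<bar>u\<bar> \<le> 1"
  shows "\<bar>exp u - (1 + u)\<bar> \<le> u\<^sup>2"
proof -
  have "exp u \<le> 1 + u + u\<^sup>2"
  proof (cases "u \<ge> 0")
    case True
    then show ?thesis
      using exp_bound[of u] assms by simp
  next
    case False
    define v where "v = - u"
    have v: "0 \<le> v" "v \<le> 1"
      using False assms by (auto simp: v_def)
    have pos: "0 \<le> 1 - v + v\<^sup>2"
      using v by simp
    have "1 \<le> 1 + v ^ 3"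
      using v by simp
    also have "\<dots> = (1 - v + v\<^sup>2) * (1 + v)"
      by (simp add: algebra_simps power2_eq_square power3_eq_cube)
    also have "\<dots> \<le> (1 - v + v\<^sup>2) * exp v"
      using pos by (intro mult_left_mono exp_ge_add_one_self)
    finally have "exp (- v) \<le> 1 - v + v\<^sup>2"
      by (simp add: exp_minus divide_simps)
    then show ?thesis
      by (simp add: v_def)
  qed
  moreover have "1 + u \<le> exp u"
    by (rule exp_ge_add_one_self)
  ultimately show ?thesis
    by linarith
qed

text \<open>
  Since \<open>1 + u \<le> exp u \<le> 1 + u + u\<^sup>2\<close> for \<open>\<bar>u\<bar> \<le> 1\<close>, the partition function of a weak field lies
  between \<open>1 + t m\<close> and \<open>1 + t m + t\<^sup>2\<close>, where \<open>m\<close> is the mean of the field.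
\<close>
lemma log_partition_expand:
  fixes p :: "'a \<Rightarrow> real"
  assumes p: "prob_vector X p" and s: "\<forall>x\<in>X. \<bar>s x\<bar> \<le> 1" and t: "0 \<le> t" "t \<le> 1/2"
  defines "Z \<equiv> \<Sum>x\<in>X. p x * exp (t * s x)" and "m \<equiv> \<Sum>x\<in>X. p x * s x"
  shows "1 + t * m \<le> Z" "Z \<le> 1 + t * m + t\<^sup>2" "\<bar>ln Z - t * m\<bar> \<le> 2 * t\<^sup>2" "\<bar>ln Z\<bar> \<le> t"
proof -
  have ts: "\<bar>t * s x\<bar> \<le> t" if "x \<in> X" for x
    using s that t by (simp add: abs_mult mult_left_le)
  have sq: "(t * s x)\<^sup>2 \<le> t\<^sup>2" if "x \<in> X" for x
    using power_mono[OF ts[OF that], of 2] by simp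
  have 1: "(\<Sum>x\<in>X. p x * (exp (t * s x) - t * s x)) = Z - t * m"
    by (simp add: Z_def m_def right_diff_distrib sum_subtractf sum_distrib_left mult_ac)
  have "exp (t * s x) - t * s x \<le> 1 + t\<^sup>2" if "x \<in> X" for x
    using abs_exp_minus_linear_le[of "t * s x"] ts[OF that] sq[OF that] t by linarith
  then have "Z - t * m \<le> 1 + t\<^sup>2"
    unfolding 1[symmetric] by (intro prob_vector_mean_le p)
  then show le: "Z \<le> 1 + t * m + t\<^sup>2"
    by simp
  have "1 \<le> Z - t * m"
    unfolding 1[symmetric] using exp_ge_add_one_self
    by (intro prob_vector_mean_ge p) (smt (verit))
  then show ge: "1 + t * m \<le> Z"
    by simp
  have "\<bar>m\<bar> \<le> 1"
    unfolding m_def using s by (intro prob_vector_mean_abs_le p) blast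
  then have tm: "\<bar>t * m\<bar> \<le> t"
    using t by (simp add: abs_mult mult_left_le)
  have Zpos: "0 < Z"
    using partition_pos[OF p] by (simp add: Z_def)
  have "ln Z \<le> Z - 1"
    using Zpos ln_le_minus_one by blast
  moreover have "ln (1 + t * m) \<le> ln Z"
    using ge tm t Zpos by (subst ln_le_cancel_iff) linarith+
  moreover have "\<bar>ln (1 + t * m) - t * m\<bar> \<le> 2 * (t * m)\<^sup>2"
    using tm t by (intro abs_ln_one_plus_x_minus_x_bound) linarith
  moreover have "(t * m)\<^sup>2 \<le> t\<^sup>2"
    using power_mono[OF tm, of 2] by simp
  ultimately show "\<bar>ln Z - t * m\<bar> \<le> 2 * t\<^sup>2"
    using le zero_le_power2[of t] by linarith
  have "Z \<le> exp t"
    unfolding Z_def using ts by (intro prob_vector_mean_le p) (fastforce simp: abs_le_iff)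
  moreover have "exp (- t) \<le> Z"
    unfolding Z_def using ts by (intro prob_vector_mean_ge p) (fastforce simp: abs_le_iff)
  ultimately show "\<bar>ln Z\<bar> \<le> t"
    using Zpos by (smt (verit, best) ln_exp ln_le_cancel_iff exp_gt_zero)
qed

text \<open>
  The density of \<open>n\<close> replicas after tilting by a weak field is the exponential of a sum of \<open>n\<close> terms of
  size at most \<open>2 t\<close>; the linear part of that sum is the first order term.
\<close>
lemma replica_density_expand:
  fixes p :: "'a \<Rightarrow> real"
  assumes p: "prob_vector X p" and s: "\<forall>x\<in>X. \<bar>s x\<bar> \<le> 1"
    and t: "0 \<le> t" "2 * real n * t \<le> 1" and n: "n \<ge> 1"
    and z: "z \<in> PiE {..<n} (\<lambda>_. X)"
  defines "R \<equiv> (\<Prod>l<n. exp (t * s (z l)) / (\<Sum>y\<in>X. p y * exp (t * s y)))"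
    and "m \<equiv> \<Sum>x\<in>X. p x * s x"
  shows "\<bar>R - (1 + t * ((\<Sum>l<n. s (z l)) - n * m))\<bar> \<le> 6 * (real n)\<^sup>2 * t\<^sup>2"
    and "\<bar>R - 1\<bar> \<le> 4 * n * t"
proof -
  define Z where "Z = (\<Sum>y\<in>X. p y * exp (t * s y))"
  define S where "S = (\<Sum>l<n. s (z l))"
  define u where "u = t * S - n * ln Z"
  have t2: "t \<le> 1/2"
  proof -
    have "2 * t * 1 \<le> 2 * t * real n"
      using t n by (intro mult_left_mono) auto
    then show ?thesis using t by (simp add: mult_ac)
  qed
  note Z = log_partition_expand[OF p s t(1) t2, folded Z_def m_def]
  have Zpos: "0 < Z"
    using partition_pos[OF p] by (simp add: Z_def)
  have "R = exp (t * S) / Z ^ n"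
    by (simp add: R_def S_def Z_def prod_dividef sum_distrib_left flip: exp_sum)
  also have "\<dots> = exp u"
    using Zpos by (simp add: u_def exp_diff exp_of_nat_mult)
  finally have R: "R = exp u" .
  have "\<bar>S\<bar> \<le> (\<Sum>l<n. 1)"
    unfolding S_def using z s by (intro order.trans[OF sum_abs] sum_mono) auto
  then have "\<bar>t * S\<bar> \<le> t * n"
    using t by (simp add: abs_mult mult_left_mono)
  moreover have lnZ: "\<bar>n * ln Z\<bar> \<le> n * t"
    using Z(4) by (simp add: abs_mult mult_left_mono)
  ultimately have u: "\<bar>u\<bar> \<le> 2 * n * t"
    unfolding u_def by (simp add: algebra_simps abs_le_iff)
  then have u2: "u\<^sup>2 \<le> 4 * (real n)\<^sup>2 * t\<^sup>2"
    using power_mono[OF u, of 2] by (simp add: power_mult_distrib)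
  have eu: "\<bar>exp u - (1 + u)\<bar> \<le> u\<^sup>2"
    using u t by (intro abs_exp_minus_linear_le) linarith
  have "\<bar>n * ln Z - n * (t * m)\<bar> \<le> n * (2 * t\<^sup>2)"
    using Z(3) by (simp add: abs_mult mult_left_mono flip: right_diff_distrib)
  also have "\<dots> \<le> (real n)\<^sup>2 * (2 * t\<^sup>2)"
    using n by (intro mult_right_mono) (auto simp: power2_eq_square)
  finally have "\<bar>u - t * (S - n * m)\<bar> \<le> 2 * (real n)\<^sup>2 * t\<^sup>2"
    by (simp add: u_def algebra_simps abs_minus_commute)
  then show "\<bar>R - (1 + t * ((\<Sum>l<n. s (z l)) - n * m))\<bar> \<le> 6 * (real n)\<^sup>2 * t\<^sup>2"
    using eu u2 by (simp only: R flip: S_def)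
  have "\<bar>u\<bar> * \<bar>u\<bar> \<le> \<bar>u\<bar> * 1"
    using u t by (intro mult_left_mono) linarith+
  then have "u\<^sup>2 \<le> \<bar>u\<bar>"
    by (simp add: power2_eq_square)
  then show "\<bar>R - 1\<bar> \<le> 4 * n * t"
    using eu u unfolding R by linarith
qed

text \<open>
  The first order response of \<open>n\<close> replicas to a weak field of covariance \<open>C\<close>, paired with the value of
  the field at replica \<open>l\<close>: the field correlates with itself at the \<open>n\<close> replicas, and the normalisation
  of the tilted law contributes \<open>n\<close> times the covariance with a new replica.
\<close>
definition overlap_response ::
  "'a set \<Rightarrow> ('a \<Rightarrow> 'a \<Rightarrow> real) \<Rightarrow> ('a \<Rightarrow> real) \<Rightarrow> nat \<Rightarrow> nat \<Rightarrow> (nat \<Rightarrow> 'a) \<Rightarrow> real" where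
  "overlap_response X C p n l z =
    (\<Sum>k<n. C (z l) (z k)) - n * (\<Sum>y\<in>X. p y * C (z l) y)"

definition sign_field :: "'a set \<Rightarrow> ('a \<Rightarrow> 'a \<Rightarrow> real) \<Rightarrow> ('a \<Rightarrow> bool) pmf \<Rightarrow> bool" where
  "sign_field X C D \<longleftrightarrow> finite (set_pmf D) \<and>
    (\<forall>x\<in>X. expect D (\<lambda>s. bool_sign (s x)) = 0) \<and>
    (\<forall>x\<in>X. \<forall>y\<in>X. expect D (\<lambda>s. bool_sign (s x) * bool_sign (s y)) = C x y)"

lemma sign_field_kernel_bound:
  assumes "sign_field X C D" "x \<in> X" "y \<in> X"
  shows "\<bar>C x y\<bar> \<le> 1"
proof -
  have "\<bar>expect D (\<lambda>s. bool_sign (s x) * bool_sign (s y))\<bar> \<le> 1"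
    using assms by (intro expect_abs_le_const) (auto simp: sign_field_def abs_mult)
  then show ?thesis
    using assms by (simp add: sign_field_def)
qed

lemma sign_field_diagonal:
  assumes "sign_field X C D" "x \<in> X"
  shows "C x x = 1"
  using assms by (auto simp: sign_field_def simp del: bool_sign_square dest!: bspec) simp

lemma overlap_response_bound:
  assumes D: "sign_field X C D" and p: "prob_vector X p" and z: "z \<in> PiE {..<n} (\<lambda>_. X)" and l: "l < n"
  shows "\<bar>overlap_response X C p n l z\<bar> \<le> 2 * n"
proof -
  have zl: "z k \<in> X" if "k < n" for k
    using z that by auto
  have "\<bar>\<Sum>k<n. C (z l) (z k)\<bar> \<le> (\<Sum>k<n. 1)"
    using zl l sign_field_kernel_bound[OF D] by (intro order.trans[OF sum_abs] sum_mono) auto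
  moreover have "\<bar>\<Sum>y\<in>X. p y * C (z l) y\<bar> \<le> 1"
    using zl l by (intro prob_vector_mean_abs_le p sign_field_kernel_bound[OF D])
  then have "\<bar>n * (\<Sum>y\<in>X. p y * C (z l) y)\<bar> \<le> n * 1"
    using mult_left_mono[of _ 1 "real n"] by (simp add: abs_mult)
  ultimately show ?thesis
    unfolding overlap_response_def by simp
qed

text \<open>
  The analogue for random signs of Gaussian integration by parts.  The zeroth order of the expansion in
  \<open>t\<close> vanishes because the field has mean zero, and in the first order only the covariances survive.
  The response is evaluated under the tilted law \<open>q s\<close>, as the applications require; moving it there
  from \<open>p\<close> costs another factor \<open>t\<close>.
\<close>
theorem approximate_integration_by_parts:
  assumes D: "sign_field X C D" and p: "prob_vector X p"
    and t: "0 \<le> t" "2 * real n * t \<le> 1" and l: "l < n"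
    and f: "\<And>z. z \<in> PiE {..<n} (\<lambda>_. X) \<Longrightarrow> \<bar>f z\<bar> \<le> 1"
  defines "q \<equiv> \<lambda>s. tilt X p (\<lambda>x. t * bool_sign (s x))"
  shows "\<bar>expect D (\<lambda>s. replica_avg X (q s) n (\<lambda>z. f z * bool_sign (s (z l))))
      - t * expect D (\<lambda>s. replica_avg X (q s) n (\<lambda>z. f z * overlap_response X C (q s) n l z))\<bar>
    \<le> 18 * (real n)\<^sup>2 * t\<^sup>2"
proof -
  let ?P = "PiE {..<n} (\<lambda>_. X)"
  define R where "R s z = (\<Prod>k<n. exp (t * bool_sign (s (z k))) / (\<Sum>y\<in>X. p y * exp (t * bool_sign (s y))))"
    for s :: "'a \<Rightarrow> bool" and z
  define m where "m s = (\<Sum>x\<in>X. p x * bool_sign (s x))" for s :: "'a \<Rightarrow> bool"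
  define G where "G = overlap_response X C p n l"
  define lin where "lin s z = bool_sign (s (z l)) * (1 + t * ((\<Sum>k<n. bool_sign (s (z k))) - n * m s)) - t * G z"
    for s :: "'a \<Rightarrow> bool" and z
  define diff where "diff s z = R s z * bool_sign (s (z l)) - t * (R s z * overlap_response X C (q s) n l z)"
    for s :: "'a \<Rightarrow> bool" and z
  have n: "n \<ge> 1" using l by simp
  have finD: "finite (set_pmf D)"
    using D by (simp add: sign_field_def)
  have q: "prob_vector X (q s)" for s
    unfolding q_def by (rule prob_vector_tilt[OF p])
  have zX: "z k \<in> X" if "z \<in> ?P" "k < n" for z k
    using that by auto
  \<comment> \<open>The mean of the field is zero, and its covariances are those in the response.\<close>
  have lin0: "expect D (\<lambda>s. lin s z) = 0" if z: "z \<in> ?P" for z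
  proof -
    have mean0: "expect D (\<lambda>s. bool_sign (s x)) = 0" if "x \<in> X" for x
      using D that by (simp add: sign_field_def)
    have cov: "expect D (\<lambda>s. bool_sign (s x) * bool_sign (s y)) = C x y" if "x \<in> X" "y \<in> X" for x y
      using D that by (simp add: sign_field_def)
    have "lin s z = bool_sign (s (z l)) + t * ((\<Sum>k<n. bool_sign (s (z l)) * bool_sign (s (z k)))
        - n * (\<Sum>y\<in>X. p y * (bool_sign (s (z l)) * bool_sign (s y)))) - t * G z" for s
      by (simp add: lin_def m_def sum_distrib_left algebra_simps)
    then have "expect D (\<lambda>s. lin s z) = expect D (\<lambda>s. bool_sign (s (z l))) +
        t * ((\<Sum>k<n. expect D (\<lambda>s. bool_sign (s (z l)) * bool_sign (s (z k))))
        - n * (\<Sum>y\<in>X. p y * expect D (\<lambda>s. bool_sign (s (z l)) * bool_sign (s y)))) - t * G z"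
      by (simp add: expect_add expect_diff expect_sum finD)
    also have "\<dots> = 0"
      using z l by (simp add: mean0 cov zX G_def overlap_response_def)
    finally show ?thesis .
  qed
  have q_close: "\<bar>(\<Sum>y\<in>X. q s y * h y) - (\<Sum>y\<in>X. p y * h y)\<bar> \<le> 4 * t"
    if h: "\<And>y. y \<in> X \<Longrightarrow> \<bar>h y\<bar> \<le> 1" for s h
  proof -
    define r where "r y = exp (t * bool_sign (s y)) / (\<Sum>y\<in>X. p y * exp (t * bool_sign (s y)))" for y
    have r: "\<bar>r y - 1\<bar> \<le> 4 * t" if "y \<in> X" for y
    proof -
      have "2 * t * 1 \<le> 2 * t * real n"
        using t n by (intro mult_left_mono) auto
      then have "2 * t \<le> 1" using t by (simp add: mult_ac)
      moreover have "(\<lambda>k\<in>{..<1::nat}. y) \<in> PiE {..<1} (\<lambda>_. X)"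
        using that by auto
      ultimately show ?thesis
        using replica_density_expand(2)[OF p, of "\<lambda>x. bool_sign (s x)" t 1 "\<lambda>k\<in>{..<1}. y"] t
        by (simp add: r_def)
    qed
    have "(\<Sum>y\<in>X. q s y * h y) - (\<Sum>y\<in>X. p y * h y) = (\<Sum>y\<in>X. p y * ((r y - 1) * h y))"
      by (simp add: q_def tilt_def r_def algebra_simps sum_subtractf sum_divide_distrib)
    also have "\<bar>\<dots>\<bar> \<le> 4 * t"
    proof (intro prob_vector_mean_abs_le p)
      fix y assume "y \<in> X"
      then have "\<bar>r y - 1\<bar> * \<bar>h y\<bar> \<le> (4 * t) * 1"
        using r h t by (intro mult_mono) auto
      then show "\<bar>(r y - 1) * h y\<bar> \<le> 4 * t"
        by (simp add: abs_mult)
    qed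
    finally show ?thesis .
  qed
  have diff_lin: "\<bar>diff s z - lin s z\<bar> \<le> 18 * (real n)\<^sup>2 * t\<^sup>2" if z: "z \<in> ?P" for s z
  proof -
    define Gq where "Gq = overlap_response X C (q s) n l z"
    note expand = replica_density_expand[OF p _ t n z, of "\<lambda>x. bool_sign (s x)", simplified,
        folded R_def m_def]
    have Gq: "\<bar>Gq\<bar> \<le> 2 * n"
      unfolding Gq_def by (rule overlap_response_bound[OF D q z l])
    have "\<bar>Gq - G z\<bar> = real n * \<bar>(\<Sum>y\<in>X. q s y * C (z l) y) - (\<Sum>y\<in>X. p y * C (z l) y)\<bar>"
      by (simp add: Gq_def G_def overlap_response_def abs_mult abs_minus_commute flip: right_diff_distrib)
    also have "\<dots> \<le> real n * (4 * t)"
      using z l zX by (intro mult_left_mono q_close sign_field_kernel_bound[OF D]) auto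
    finally have GG: "\<bar>Gq - G z\<bar> \<le> 4 * n * t" by simp
    have "\<bar>(R s z - 1) * Gq\<bar> \<le> (4 * n * t) * (2 * n)"
      unfolding abs_mult using expand(2) Gq t by (intro mult_mono) auto
    moreover have "4 * n * t \<le> 4 * (real n)\<^sup>2 * t"
      using n t by (intro mult_right_mono) (auto simp: power2_eq_square)
    moreover have "(4 * n * t) * (2 * n) = 8 * (real n)\<^sup>2 * t"
      by (simp add: power2_eq_square)
    moreover have "R s z * Gq - G z = (R s z - 1) * Gq + (Gq - G z)"
      by (simp add: algebra_simps)
    ultimately have "\<bar>R s z * Gq - G z\<bar> \<le> 12 * (real n)\<^sup>2 * t"
      using GG by linarith
    then have 1: "\<bar>t * (R s z * Gq - G z)\<bar> \<le> t * (12 * (real n)\<^sup>2 * t)"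
      using t unfolding abs_mult by (intro mult_mono) auto
    have 2: "\<bar>bool_sign (s (z l)) * (R s z - (1 + t * ((\<Sum>k<n. bool_sign (s (z k))) - n * m s)))\<bar>
        \<le> 6 * (real n)\<^sup>2 * t\<^sup>2"
      using expand(1) by (simp add: abs_mult)
    have "diff s z - lin s z =
        bool_sign (s (z l)) * (R s z - (1 + t * ((\<Sum>k<n. bool_sign (s (z k))) - n * m s)))
        - t * (R s z * Gq - G z)"
      by (simp add: diff_def lin_def Gq_def algebra_simps)
    moreover have "t * (12 * (real n)\<^sup>2 * t) = 12 * (real n)\<^sup>2 * t\<^sup>2"
      by (simp add: power2_eq_square)
    ultimately show ?thesis
      using 1 2 by linarith
  qed
  have diff_avg: "\<bar>expect D (\<lambda>s. diff s z)\<bar> \<le> 18 * (real n)\<^sup>2 * t\<^sup>2" if z: "z \<in> ?P" for z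
  proof -
    have "\<bar>expect D (\<lambda>s. diff s z - lin s z)\<bar> \<le> 18 * (real n)\<^sup>2 * t\<^sup>2"
      using diff_lin[OF z] by (intro expect_abs_le_const finD)
    then show ?thesis
      by (simp add: expect_diff finD lin0[OF z])
  qed
  have "expect D (\<lambda>s. replica_avg X (q s) n (\<lambda>z. f z * bool_sign (s (z l))))
      - t * expect D (\<lambda>s. replica_avg X (q s) n (\<lambda>z. f z * overlap_response X C (q s) n l z))
    = expect D (\<lambda>s. replica_avg X p n (\<lambda>z. f z * diff s z))"
    unfolding q_def replica_avg_tilt R_def[symmetric]
    unfolding diff_def q_def
    by (simp add: finD mult_ac right_diff_distrib replica_avg_diff
        flip: expect_diff integral_mult_right_zero replica_avg_cmult)
  also have "\<dots> = replica_avg X p n (\<lambda>z. f z * expect D (\<lambda>s. diff s z))"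
    unfolding replica_avg_def by (simp add: expect_sum finD)
  also have "\<bar>\<dots>\<bar> \<le> 18 * (real n)\<^sup>2 * t\<^sup>2"
  proof (intro replica_avg_abs_le p)
    fix z assume z: "z \<in> ?P"
    have "\<bar>f z\<bar> * \<bar>expect D (\<lambda>s. diff s z)\<bar> \<le> 1 * (18 * (real n)\<^sup>2 * t\<^sup>2)"
      using f[OF z] diff_avg[OF z] by (intro mult_mono) auto
    then show "\<bar>f z * expect D (\<lambda>s. diff s z)\<bar> \<le> 18 * (real n)\<^sup>2 * t\<^sup>2"
      by (simp add: abs_mult)
  qed
  finally show ?thesis .
qed

section \<open>Fluctuations of the free energy\<close>

lemma expect_square_le:
  fixes f :: "'w \<Rightarrow> real"
  assumes "finite (set_pmf D)"
  shows "(expect D f)\<^sup>2 \<le> expect D (\<lambda>w. (f w)\<^sup>2)"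
proof -
  define m where "m = expect D f"
  have "0 \<le> expect D (\<lambda>w. (f w - m)\<^sup>2)"
    by (rule Bochner_Integration.integral_nonneg) simp
  also have "\<dots> = expect D (\<lambda>w. (f w)\<^sup>2 - 2 * m * f w + m\<^sup>2)"
    by (simp add: power2_eq_square algebra_simps)
  also have "\<dots> = expect D (\<lambda>w. (f w)\<^sup>2) - m\<^sup>2"
    by (simp add: expect_add expect_diff assms power2_eq_square flip: m_def)
  finally show ?thesis
    by (simp add: m_def)
qed

text \<open>
  The Efron-Stein inequality in its bounded difference form: the deviation of \<open>f\<close> from its average over
  the coordinate \<open>i\<close> is at most \<open>c i\<close> and is orthogonal to that average, so that the coordinates can be
  averaged out one at a time.
\<close>
lemma expect_Pi_variance_le:
  fixes f :: "('i \<Rightarrow> 'w) \<Rightarrow> real"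
  assumes "finite I" "\<And>i. i \<in> I \<Longrightarrow> finite (set_pmf (D i))"
    and "\<And>i w a b. i \<in> I \<Longrightarrow> \<bar>f (w(i := a)) - f (w(i := b))\<bar> \<le> c i"
  shows "expect (Pi_pmf I d D) (\<lambda>w. (f w - expect (Pi_pmf I d D) f)\<^sup>2) \<le> (\<Sum>i\<in>I. (c i)\<^sup>2)"
  using assms
proof (induction I arbitrary: f rule: finite_induct)
  case empty
  then show ?case by simp
next
  case (insert i I)
  define P where "P = Pi_pmf I d D"
  define g where "g w = expect (D i) (\<lambda>a. f (w(i := a)))" for w
  define m where "m = expect (Pi_pmf (insert i I) d D) f"
  have fin: "finite (set_pmf (D i))" "finite (set_pmf P)"
    using insert by (auto simp: P_def intro!: finite_set_Pi_pmf)
  have ins: "expect (Pi_pmf (insert i I) d D) h = expect P (\<lambda>w. expect (D i) (\<lambda>a. h (w(i := a))))"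
    for h :: "('i \<Rightarrow> 'w) \<Rightarrow> real"
    unfolding P_def using insert by (intro expect_Pi_insert) auto
  have m: "m = expect P g"
    by (simp add: m_def g_def[abs_def] ins)
  have "expect P (\<lambda>w. (g w - expect P g)\<^sup>2) \<le> (\<Sum>j\<in>I. (c j)\<^sup>2)"
    unfolding P_def
  proof (rule insert.IH)
    fix j w a b assume j: "j \<in> I"
    then have tw: "w(j := x, i := y) = w(i := y, j := x)" for x y :: 'w
      using insert.hyps by (intro fun_upd_twist) auto
    have "\<bar>expect (D i) (\<lambda>y. f (w(j := a, i := y)) - f (w(j := b, i := y)))\<bar> \<le> c j"
      unfolding tw using j by (intro expect_abs_le_const fin insert.prems(2)) simp
    then show "\<bar>g (w(j := a)) - g (w(j := b))\<bar> \<le> c j"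
      by (simp add: g_def expect_diff fin)
  qed (use insert.prems in auto)
  moreover have "expect (D i) (\<lambda>a. (f (w(i := a)) - m)\<^sup>2) \<le> (c i)\<^sup>2 + (g w - m)\<^sup>2" for w
  proof -
    have dev: "(f (w(i := a)) - g w)\<^sup>2 \<le> (c i)\<^sup>2" for a
    proof -
      have "\<bar>expect (D i) (\<lambda>b. f (w(i := a)) - f (w(i := b)))\<bar> \<le> c i"
        by (intro expect_abs_le_const fin insert.prems(2)) simp
      then have "\<bar>f (w(i := a)) - g w\<bar> \<le> c i"
        by (simp add: expect_diff fin g_def)
      from power_mono[OF this, of 2] show ?thesis by simp
    qed
    \<comment> \<open>The cross term vanishes because \<open>g w\<close> is the mean of \<open>f\<close> over coordinate \<open>i\<close>.\<close>
    have "expect (D i) (\<lambda>a. (f (w(i := a)) - m)\<^sup>2) =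
        expect (D i) (\<lambda>a. (f (w(i := a)) - g w)\<^sup>2 + (2 * (g w - m) * (f (w(i := a)) - g w) + (g w - m)\<^sup>2))"
      by (intro Bochner_Integration.integral_cong) (auto simp: power2_eq_square algebra_simps)
    also have "\<dots> = expect (D i) (\<lambda>a. (f (w(i := a)) - g w)\<^sup>2) +
        (2 * (g w - m) * (expect (D i) (\<lambda>a. f (w(i := a))) - g w) + (g w - m)\<^sup>2)"
      by (simp add: expect_add expect_diff fin)
    also have "\<dots> \<le> (c i)\<^sup>2 + (g w - m)\<^sup>2"
      using expect_mono[OF fin(1), of "\<lambda>a. (f (w(i := a)) - g w)\<^sup>2" "\<lambda>_. (c i)\<^sup>2"] dev
      by (simp flip: g_def)
    finally show ?thesis .
  qed
  then have "expect P (\<lambda>w. expect (D i) (\<lambda>a. (f (w(i := a)) - m)\<^sup>2)) \<le> expect P (\<lambda>w. (c i)\<^sup>2 + (g w - m)\<^sup>2)"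
    by (intro expect_mono fin) auto
  ultimately have "expect P (\<lambda>w. expect (D i) (\<lambda>a. (f (w(i := a)) - m)\<^sup>2)) \<le> (c i)\<^sup>2 + (\<Sum>j\<in>I. (c j)\<^sup>2)"
    by (simp add: expect_add fin flip: m)
  then show ?case
    unfolding m_def[symmetric] unfolding ins using insert.hyps by simp
qed

text \<open>
  Here \<open>A\<close> and \<open>B\<close> are the increments of the logarithm of the partition function when the energy \<open>h\<close> is
  added once more or taken away once.  By definition of \<open>A\<close> the mean of \<open>exp (h - A)\<close> is \<open>1\<close>, which
  bounds the part of \<open>h\<close> above \<open>A\<close>; likewise \<open>B\<close> controls the part below \<open>B\<close>.  The gap \<open>A - B\<close> is
  a second difference of a convex function and is small for most strengths.
\<close>
lemma mean_abs_dev_le_slopes: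
  fixes p h :: "'a \<Rightarrow> real"
  assumes p: "prob_vector X p"
  defines "A \<equiv> ln (\<Sum>x\<in>X. p x * exp (h x))" and "B \<equiv> - ln (\<Sum>x\<in>X. p x * exp (- h x))"
  shows "(\<Sum>x\<in>X. p x * \<bar>h x - A\<bar>) \<le> 2 + (A - B)" and "B \<le> A"
proof -
  have expA: "(\<Sum>x\<in>X. p x * exp (h x - A)) = 1"
    using partition_pos[OF p, of h]
    by (simp add: A_def exp_diff flip: sum_divide_distrib)
  have expB: "(\<Sum>x\<in>X. p x * exp (B - h x)) = 1"
  proof -
    define Z where "Z = (\<Sum>x\<in>X. p x * exp (- h x))"
    have Z: "0 < Z"
      unfolding Z_def by (rule partition_pos[OF p])
    have "exp (B - h x) = exp (- h x) / Z" for x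
    proof -
      have "B = - ln Z"
        by (simp add: B_def Z_def)
      then have "B - h x = - h x - ln Z"
        by simp
      then show ?thesis
        using Z by (simp only: exp_diff[of "- h x" "ln Z"] exp_ln)
    qed
    then have "(\<Sum>x\<in>X. p x * exp (B - h x)) = Z / Z"
      by (simp only: Z_def times_divide_eq_right flip: sum_divide_distrib)
    then show ?thesis
      using Z by simp
  qed
  have "2 + (B - A) \<le> (\<Sum>x\<in>X. p x * (exp (h x - A) + exp (B - h x)))"
  proof (intro prob_vector_mean_ge p)
    fix x assume "x \<in> X"
    show "2 + (B - A) \<le> exp (h x - A) + exp (B - h x)"
      using exp_ge_add_one_self[of "h x - A"] exp_ge_add_one_self[of "B - h x"] by linarith
  qed
  then show BA: "B \<le> A"
    using expA expB by (simp add: distrib_left sum.distrib)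
  have "(\<Sum>x\<in>X. p x * \<bar>h x - A\<bar>) \<le> (\<Sum>x\<in>X. p x * (exp (h x - A) + exp (B - h x) + (A - B)))"
  proof (intro sum_mono mult_left_mono)
    fix x assume "x \<in> X"
    have "1 + (h x - A) \<le> exp (h x - A)" "1 + (B - h x) \<le> exp (B - h x)"
      by (rule exp_ge_add_one_self)+
    moreover have "0 < exp (h x - A)" "0 < exp (B - h x)"
      by simp_all
    ultimately show "\<bar>h x - A\<bar> \<le> exp (h x - A) + exp (B - h x) + (A - B)"
      using BA by linarith
  qed (use p in \<open>auto simp: prob_vector_def\<close>)
  also have "\<dots> = 2 + (A - B)"
    using expA expB p
    by (simp add: distrib_left sum.distrib prob_vector_def flip: sum_distrib_right)
  finally show "(\<Sum>x\<in>X. p x * \<bar>h x - A\<bar>) \<le> 2 + (A - B)" .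
qed

text \<open>
  Independent sign fields indexed by \<open>I\<close> act on the points of \<open>X\<close> with coefficients \<open>t\<close>; the reference
  weights \<open>\<mu>\<close> are tilted by the resulting random energy.
\<close>
locale disorder =
  fixes X :: "'a set" and \<mu> :: "'a \<Rightarrow> real" and I :: "'i set"
    and D :: "'i \<Rightarrow> ('a \<Rightarrow> bool) pmf" and C :: "'i \<Rightarrow> 'a \<Rightarrow> 'a \<Rightarrow> real"
  assumes prob_\<mu>: "prob_vector X \<mu>" and finite_I: "finite I"
    and field: "\<And>i. i \<in> I \<Longrightarrow> sign_field X (C i) (D i)"
begin

definition law :: "('i \<Rightarrow> 'a \<Rightarrow> bool) pmf" where
  "law = Pi_pmf I (\<lambda>_. True) D"

definition energy :: "('i \<Rightarrow> real) \<Rightarrow> ('i \<Rightarrow> 'a \<Rightarrow> bool) \<Rightarrow> 'a \<Rightarrow> real" where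
  "energy t w x = (\<Sum>i\<in>I. t i * bool_sign (w i x))"

definition free_energy :: "('i \<Rightarrow> real) \<Rightarrow> ('i \<Rightarrow> 'a \<Rightarrow> bool) \<Rightarrow> real" where
  "free_energy t w = ln (\<Sum>x\<in>X. \<mu> x * exp (energy t w x))"

definition gibbs :: "('i \<Rightarrow> real) \<Rightarrow> ('i \<Rightarrow> 'a \<Rightarrow> bool) \<Rightarrow> 'a \<Rightarrow> real" where
  "gibbs t w = tilt X \<mu> (energy t w)"

lemma finite_D: "i \<in> I \<Longrightarrow> finite (set_pmf (D i))"
  using field by (simp add: sign_field_def)

lemma finite_law: "finite (set_pmf law)"
  unfolding law_def using finite_I finite_D by (rule finite_set_Pi_pmf)

lemma prob_gibbs: "prob_vector X (gibbs t w)"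
  unfolding gibbs_def using prob_\<mu> by (rule prob_vector_tilt)

lemma expect_resample:
  fixes f :: "('i \<Rightarrow> 'a \<Rightarrow> bool) \<Rightarrow> real"
  assumes "i \<in> I"
  shows "expect law f = expect law (\<lambda>w. expect (D i) (\<lambda>s. f (w(i := s))))"
  unfolding law_def using finite_I assms finite_D by (rule expect_Pi_resample)

lemma energy_upd:
  assumes "i \<in> I"
  shows "energy t (w(i := s)) x = energy (t(i := 0)) w x + t i * bool_sign (s x)"
proof -
  have "(\<Sum>j\<in>I - {i}. t j * bool_sign ((w(i := s)) j x)) =
      (\<Sum>j\<in>I - {i}. (t(i := 0)) j * bool_sign (w j x))"
    by (intro sum.cong) auto
  then show ?thesis
    using assms finite_I by (simp add: energy_def sum.remove[of I i])
qed

lemma gibbs_upd: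
  assumes "i \<in> I"
  shows "gibbs t (w(i := s)) = tilt X (gibbs (t(i := 0)) w) (\<lambda>x. t i * bool_sign (s x))"
  unfolding gibbs_def tilt_tilt[OF prob_\<mu>] energy_upd[OF assms, abs_def] ..

lemma ln_mean_exp_gibbs:
  "ln (\<Sum>x\<in>X. gibbs t w x * exp (h x)) =
    ln (\<Sum>x\<in>X. \<mu> x * exp (energy t w x + h x)) - free_energy t w"
  using partition_pos[OF prob_\<mu>, of "energy t w"] partition_pos[OF prob_\<mu>, of "\<lambda>x. energy t w x + h x"]
  unfolding gibbs_def tilt_mean free_energy_def
  by (simp add: ln_div mult.assoc flip: exp_add)

lemma free_energy_upd:
  assumes "i \<in> I"
  shows "free_energy t (w(i := s)) = free_energy (t(i := 0)) w +
    ln (\<Sum>x\<in>X. gibbs (t(i := 0)) w x * exp (t i * bool_sign (s x)))"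
  unfolding ln_mean_exp_gibbs free_energy_def[of t] energy_upd[OF assms] by simp

text \<open>
  Changing a single field moves the free energy by at most twice its coefficient, whatever the
  reference weights are.
\<close>
lemma free_energy_fluctuation:
  assumes t: "\<And>i. i \<in> I \<Longrightarrow> 0 \<le> t i \<and> t i \<le> 1/2"
  shows "expect law (\<lambda>w. \<bar>free_energy t w - expect law (free_energy t)\<bar>) \<le> sqrt (\<Sum>i\<in>I. (2 * t i)\<^sup>2)"
proof -
  have "\<bar>free_energy t (w(i := a)) - free_energy t (w(i := b))\<bar> \<le> 2 * t i" if i: "i \<in> I" for i w a b
  proof -
    have "\<bar>ln (\<Sum>x\<in>X. gibbs (t(i := 0)) w x * exp (t i * bool_sign (s x)))\<bar> \<le> t i" for s
      using t[OF i] by (intro log_partition_expand(4) prob_gibbs) auto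
    from this[of a] this[of b] show ?thesis
      unfolding free_energy_upd[OF i] by linarith
  qed
  then have "expect law (\<lambda>w. (free_energy t w - expect law (free_energy t))\<^sup>2) \<le> (\<Sum>i\<in>I. (2 * t i)\<^sup>2)"
    unfolding law_def using finite_I finite_D by (intro expect_Pi_variance_le)
  moreover have "(expect law (\<lambda>w. \<bar>free_energy t w - expect law (free_energy t)\<bar>))\<^sup>2
      \<le> expect law (\<lambda>w. (free_energy t w - expect law (free_energy t))\<^sup>2)"
    using expect_square_le[OF finite_law, of "\<lambda>w. \<bar>free_energy t w - expect law (free_energy t)\<bar>"] by simp
  ultimately show ?thesis
    by (intro real_le_rsqrt) linarith
qed

lemma system_integration_by_parts:
  assumes i: "i \<in> I" and t: "0 \<le> t i" "2 * real n * t i \<le> 1" and l: "l < n"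
    and f: "\<And>z. z \<in> PiE {..<n} (\<lambda>_. X) \<Longrightarrow> \<bar>f z\<bar> \<le> 1"
  shows "\<bar>expect law (\<lambda>w. replica_avg X (gibbs t w) n (\<lambda>z. f z * bool_sign (w i (z l))))
      - t i * expect law (\<lambda>w. replica_avg X (gibbs t w) n (\<lambda>z. f z * overlap_response X (C i) (gibbs t w) n l z))\<bar>
    \<le> 18 * (real n)\<^sup>2 * (t i)\<^sup>2"
proof -
  have "\<bar>expect law (\<lambda>w. expect (D i) (\<lambda>s. replica_avg X (gibbs t (w(i := s))) n (\<lambda>z. f z * bool_sign ((w(i := s)) i (z l))))
      - t i * expect (D i) (\<lambda>s. replica_avg X (gibbs t (w(i := s))) n
        (\<lambda>z. f z * overlap_response X (C i) (gibbs t (w(i := s))) n l z)))\<bar> \<le> 18 * (real n)\<^sup>2 * (t i)\<^sup>2"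
    unfolding gibbs_upd[OF i] fun_upd_same
    by (intro expect_abs_le_const finite_law approximate_integration_by_parts field i prob_gibbs t l f)
  then show ?thesis
    by (subst (1 2) expect_resample[OF i]) (simp only: expect_diff finite_law integral_mult_right_zero)
qed

text \<open>
  A field of mean zero changes the mean free energy only at second order in its coefficient.
\<close>
lemma switch_on:
  assumes i: "i \<in> I" and t: "0 \<le> t i" "t i \<le> 1/2"
  shows "\<bar>expect law (free_energy t) - expect law (free_energy (t(i := 0)))\<bar> \<le> 2 * (t i)\<^sup>2"
proof -
  let ?p = "\<lambda>w. gibbs (t(i := 0)) w"
  define L where "L w s = ln (\<Sum>x\<in>X. ?p w x * exp (t i * bool_sign (s x)))" for w s
  define m where "m w s = (\<Sum>x\<in>X. ?p w x * bool_sign (s x))" for w s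
  have fin: "finite (set_pmf (D i))"
    by (rule finite_D[OF i])
  have m0: "expect (D i) (m w) = 0" for w
    using field[OF i] by (simp add: m_def[abs_def] expect_sum fin sign_field_def)
  have "\<bar>expect (D i) (L w)\<bar> \<le> 2 * (t i)\<^sup>2" for w
  proof -
    have "\<bar>expect (D i) (\<lambda>s. L w s - t i * m w s)\<bar> \<le> 2 * (t i)\<^sup>2"
      unfolding L_def m_def using t
      by (intro expect_abs_le_const fin log_partition_expand(3) prob_gibbs) auto
    then show ?thesis
      by (simp add: expect_diff fin m0)
  qed
  then have "\<bar>expect law (\<lambda>w. expect (D i) (L w))\<bar> \<le> 2 * (t i)\<^sup>2"
    by (rule expect_abs_le_const[OF finite_law])
  moreover have "expect law (free_energy t) = expect law (free_energy (t(i := 0))) + expect law (\<lambda>w. expect (D i) (L w))"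
    by (subst expect_resample[OF i], subst free_energy_upd[OF i])
      (simp add: expect_add fin finite_law flip: L_def)
  ultimately show ?thesis
    by simp
qed

lemma switch_on_block:
  assumes B: "finite B" "B \<subseteq> I" and t: "\<And>i. i \<in> B \<Longrightarrow> 0 \<le> t i \<and> t i \<le> 1/2"
  shows "\<bar>expect law (free_energy t) - expect law (free_energy (\<lambda>i. if i \<in> B then 0 else t i))\<bar> \<le> 2 * (\<Sum>i\<in>B. (t i)\<^sup>2)"
  using B t
proof (induction B rule: finite_induct)
  case (insert i B)
  define t' where "t' = (\<lambda>j. if j \<in> B then 0 else t j)"
  have "t'(i := 0) = (\<lambda>j. if j \<in> insert i B then 0 else t j)"
    by (auto simp: t'_def)
  moreover have "t' i = t i"
    using insert by (simp add: t'_def)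
  moreover have "\<bar>expect law (free_energy t') - expect law (free_energy (t'(i := 0)))\<bar> \<le> 2 * (t' i)\<^sup>2"
    using insert by (intro switch_on) (auto simp: t'_def)
  moreover have "\<bar>expect law (free_energy t) - expect law (free_energy t')\<bar> \<le> 2 * (\<Sum>i\<in>B. (t i)\<^sup>2)"
    unfolding t'_def using insert by auto
  ultimately show ?case
    using insert by simp
qed simp

end

section \<open>Ghirlanda-Guerra identities\<close>

definition pair_avg :: "'a set \<Rightarrow> ('a \<Rightarrow> real) \<Rightarrow> ('a \<Rightarrow> 'a \<Rightarrow> real) \<Rightarrow> real" where
  "pair_avg X p K = (\<Sum>x\<in>X. p x * (\<Sum>y\<in>X. p y * K x y))"

text \<open>
  The covariances of replica \<open>l\<close> with \<open>n\<close> new replicas, minus those with the other replicas already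
  present.  In a system satisfying the Ghirlanda-Guerra identities its average is the mean
  covariance of two replicas, even after weighting with a function of the replicas.
\<close>
definition excess_overlap ::
  "'a set \<Rightarrow> ('a \<Rightarrow> real) \<Rightarrow> nat \<Rightarrow> nat \<Rightarrow> ('a \<Rightarrow> 'a \<Rightarrow> real) \<Rightarrow> (nat \<Rightarrow> 'a) \<Rightarrow> real" where
  "excess_overlap X p n l K z = n * (\<Sum>y\<in>X. p y * K (z l) y) - (\<Sum>k\<in>{..<n} - {l}. K (z l) (z k))"

context disorder
begin

definition block_energy :: "'i set \<Rightarrow> real \<Rightarrow> ('i \<Rightarrow> 'a \<Rightarrow> bool) \<Rightarrow> 'a \<Rightarrow> real" where
  "block_energy B \<eta> w x = \<eta> * (\<Sum>i\<in>B. bool_sign (w i x))"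

text \<open>
  The fields indexed by \<open>B\<close> share the coefficient \<open>\<eta> u\<close>, and \<open>a u\<close> is the slope of the mean free energy in
  the integer \<open>u\<close>.  For a given realisation of the fields, the slopes of the free energy at \<open>u\<close> and at
  \<open>u - 1\<close> confine the block energy; the small variance of the free energy lets the mean slope replace the
  random one.  Summed over \<open>u\<close>, the gaps between successive slopes telescope, and by convexity the extreme
  slopes are controlled by the total change of the mean free energy over longer intervals.
\<close>
lemma block_concentration:
  fixes t0 :: "'i \<Rightarrow> real" and \<eta> V :: real and m :: nat
  assumes B: "B \<subseteq> I" and m: "m \<ge> 1" and \<eta>: "0 \<le> \<eta>" "\<eta> * (3 * real m) \<le> 1/2"
    and t0: "\<And>i. i \<in> I \<Longrightarrow> 0 \<le> t0 i \<and> t0 i \<le> 1/2"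
  defines "t \<equiv> \<lambda>u::nat. \<lambda>i. if i \<in> B then \<eta> * u else t0 i"
    and "S \<equiv> card B * \<eta>\<^sup>2"
  assumes V: "\<And>u. u \<le> 2 * m \<Longrightarrow> (\<Sum>i\<in>I. (2 * t u i)\<^sup>2) \<le> V"
  defines "a \<equiv> \<lambda>u. expect law (free_energy (t (Suc u))) - expect law (free_energy (t u))"
  shows "(\<Sum>u\<in>{m..<2*m}. expect law (\<lambda>w. \<Sum>x\<in>X. gibbs (t u) w x * \<bar>block_energy B \<eta> w x - a u\<bar>))
    \<le> m * (2 + 2 * sqrt V + 28 * S)"
proof -
  define F where "F u w = free_energy (t u) w" for u w
  define b where "b u = expect law (F u)" for u
  define h where "h = block_energy B \<eta>"
  define \<Delta> where "\<Delta> u = expect law (\<lambda>w. \<Sum>x\<in>X. gibbs (t u) w x * \<bar>h w x - a u\<bar>)" for u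
  have finB: "finite B"
    using B finite_I finite_subset by blast
  have a: "a u = b (Suc u) - b u" for u
    by (simp add: a_def b_def F_def[abs_def])
  have energy_t: "energy (t u) w x = energy (t 0) w x + u * h w x" for u w x
  proof -
    have "t u i = t 0 i + (if i \<in> B then \<eta> * u else 0)" for i
      by (simp add: t_def)
    then have "energy (t u) w x = energy (t 0) w x + (\<Sum>i\<in>I. if i \<in> B then \<eta> * u * bool_sign (w i x) else 0)"
      unfolding energy_def by (subst sum.distrib[symmetric], intro sum.cong) (auto simp: algebra_simps)
    also have "(\<Sum>i\<in>I. if i \<in> B then \<eta> * u * bool_sign (w i x) else 0) = (\<Sum>i\<in>B. \<eta> * u * bool_sign (w i x))"
      using B finite_I by (simp add: sum.inter_restrict[symmetric] Int_absorb1)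
    also have "\<dots> = u * h w x"
      by (simp add: h_def block_energy_def sum_distrib_left mult_ac)
    finally show ?thesis .
  qed
  have slope_up: "ln (\<Sum>x\<in>X. gibbs (t u) w x * exp (h w x)) = F (Suc u) w - F u w" for u w
    unfolding ln_mean_exp_gibbs F_def
    by (simp add: free_energy_def energy_t[of "Suc u"] energy_t[of u] algebra_simps)
  have slope_down: "- ln (\<Sum>x\<in>X. gibbs (t (Suc u)) w x * exp (- h w x)) = F (Suc u) w - F u w" for u w
    unfolding ln_mean_exp_gibbs F_def
    by (simp add: free_energy_def energy_t[of "Suc u"] energy_t[of u] algebra_simps)
  have slopes:
    "(\<Sum>x\<in>X. gibbs (t (Suc u)) w x * \<bar>h w x - (F (Suc (Suc u)) w - F (Suc u) w)\<bar>)
      \<le> 2 + ((F (Suc (Suc u)) w - F (Suc u) w) - (F (Suc u) w - F u w))"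
    "F (Suc u) w - F u w \<le> F (Suc (Suc u)) w - F (Suc u) w" for u w
    using mean_abs_dev_le_slopes[OF prob_gibbs[of "t (Suc u)" w], of "h w"]
    unfolding slope_up slope_down by auto
  have a_mono: "a u \<le> a (Suc u)" for u
  proof -
    have "expect law (\<lambda>w. F (Suc u) w - F u w) \<le> expect law (\<lambda>w. F (Suc (Suc u)) w - F (Suc u) w)"
      by (intro expect_mono finite_law slopes(2))
    then show ?thesis
      by (simp add: a b_def expect_diff finite_law)
  qed
  then have a_incseq: "a u \<le> a u'" if "u \<le> u'" for u u'
    using that by (rule lift_Suc_mono_le)
  have tb: "0 \<le> t u i \<and> t u i \<le> 1/2" if "u \<le> 3 * m" "i \<in> I" for u i
  proof -
    have "\<eta> * u \<le> \<eta> * (3 * m)"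
      using \<eta> that by (intro mult_left_mono) auto
    then show ?thesis
      using t0 \<eta> that by (auto simp: t_def)
  qed
  have fluct: "expect law (\<lambda>w. \<bar>F u w - b u\<bar>) \<le> sqrt V" if u: "u \<le> 2 * m" for u
  proof -
    have "expect law (\<lambda>w. \<bar>F u w - b u\<bar>) \<le> sqrt (\<Sum>i\<in>I. (2 * t u i)\<^sup>2)"
      unfolding F_def[abs_def] b_def using tb u by (intro free_energy_fluctuation) auto
    also have "\<dots> \<le> sqrt V"
      using V[OF u] by simp
    finally show ?thesis .
  qed
  have \<Delta>: "\<Delta> (Suc u) \<le> 2 + 2 * sqrt V + (a (Suc u) - a u)" if u: "Suc (Suc u) \<le> 2 * m" for u
  proof -
    have "\<Delta> (Suc u) \<le> expect law (\<lambda>w. 2 + ((F (Suc (Suc u)) w - F (Suc u) w) - (F (Suc u) w - F u w))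
        + (\<bar>F (Suc (Suc u)) w - b (Suc (Suc u))\<bar> + \<bar>F (Suc u) w - b (Suc u)\<bar>))"
      unfolding \<Delta>_def
    proof (intro expect_mono finite_law)
      fix w
      let ?p = "gibbs (t (Suc u)) w" and ?A = "F (Suc (Suc u)) w - F (Suc u) w"
      have "(\<Sum>x\<in>X. ?p x * \<bar>h w x - a (Suc u)\<bar>) \<le> (\<Sum>x\<in>X. ?p x * (\<bar>h w x - ?A\<bar> + \<bar>?A - a (Suc u)\<bar>))"
        using prob_vectorD[OF prob_gibbs[of "t (Suc u)" w]] by (intro sum_mono mult_left_mono) auto
      also have "\<dots> = (\<Sum>x\<in>X. ?p x * \<bar>h w x - ?A\<bar>) + \<bar>?A - a (Suc u)\<bar>"
        using prob_vectorD[OF prob_gibbs[of "t (Suc u)" w]]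
        by (simp add: distrib_left sum.distrib flip: sum_distrib_right)
      also have "\<dots> \<le> (2 + (?A - (F (Suc u) w - F u w)))
          + (\<bar>F (Suc (Suc u)) w - b (Suc (Suc u))\<bar> + \<bar>F (Suc u) w - b (Suc u)\<bar>)"
        by (intro add_mono slopes(1)) (simp add: a)
      finally show "(\<Sum>x\<in>X. ?p x * \<bar>h w x - a (Suc u)\<bar>) \<le> 2 + (?A - (F (Suc u) w - F u w))
          + (\<bar>F (Suc (Suc u)) w - b (Suc (Suc u))\<bar> + \<bar>F (Suc u) w - b (Suc u)\<bar>)" .
    qed
    also have "\<dots> = 2 + (a (Suc u) - a u)
        + (expect law (\<lambda>w. \<bar>F (Suc (Suc u)) w - b (Suc (Suc u))\<bar>) + expect law (\<lambda>w. \<bar>F (Suc u) w - b (Suc u)\<bar>))"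
      by (simp add: expect_add expect_diff finite_law a flip: b_def)
    also have "\<dots> \<le> 2 + (a (Suc u) - a u) + (sqrt V + sqrt V)"
      using u by (intro add_mono fluct) auto
    finally show ?thesis by simp
  qed
  have b0: "\<bar>b u - b 0\<bar> \<le> 2 * S * (real u)\<^sup>2" if u: "u \<le> 3 * m" for u
  proof -
    have "\<bar>expect law (free_energy (t u)) - expect law (free_energy (\<lambda>i. if i \<in> B then 0 else t u i))\<bar>
        \<le> 2 * (\<Sum>i\<in>B. (t u i)\<^sup>2)"
      using tb[OF u] B by (intro switch_on_block finB) auto
    also have "(\<Sum>i\<in>B. (t u i)\<^sup>2) = S * (real u)\<^sup>2"
      by (simp add: t_def S_def power_mult_distrib)
    also have "(\<lambda>i. if i \<in> B then 0 else t u i) = t 0"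
      by (auto simp: t_def)
    finally show ?thesis
      by (simp add: b_def F_def[abs_def])
  qed
  \<comment> \<open>A slope is compared with the average slope over a whole interval of length \<open>m\<close> beyond it.\<close>
  have top: "m * a (2 * m - 1) \<le> 26 * S * (real m)\<^sup>2"
  proof -
    have "m * a (2 * m - 1) = (\<Sum>u\<in>{2*m..<3*m}. a (2 * m - 1))"
      by simp
    also have "\<dots> \<le> (\<Sum>u\<in>{2*m..<3*m}. a u)"
      by (intro sum_mono a_incseq) auto
    also have "\<dots> = b (3 * m) - b (2 * m)"
      unfolding a by (intro sum_Suc_diff') simp
    also have "\<dots> \<le> 2 * S * (real (3 * m))\<^sup>2 + 2 * S * (real (2 * m))\<^sup>2"
      using b0[of "3 * m"] b0[of "2 * m"] by linarith
    finally show ?thesis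
      by (simp add: power2_eq_square)
  qed
  have bot: "- (2 * S * (real m)\<^sup>2) \<le> m * a (m - 1)"
  proof -
    have "- (2 * S * (real m)\<^sup>2) \<le> b m - b 0"
      using b0[of m] by linarith
    also have "\<dots> = (\<Sum>u\<in>{0..<m}. a u)"
      unfolding a by (intro sum_Suc_diff'[symmetric]) simp
    also have "\<dots> \<le> (\<Sum>u\<in>{0..<m}. a (m - 1))"
      by (intro sum_mono a_incseq) auto
    finally show ?thesis by simp
  qed
  have "m * (a (2 * m - 1) - a (m - 1)) \<le> m * (28 * S * m)"
    using top bot by (simp add: algebra_simps power2_eq_square)
  then have tele: "a (2 * m - 1) - a (m - 1) \<le> 28 * S * m"
    using m by (subst (asm) mult_le_cancel_left_pos) auto
  have "(\<Sum>u\<in>{m..<2*m}. \<Delta> u) = (\<Sum>u\<in>{m-1..<2*m-1}. \<Delta> (Suc u))"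
    using m sum.shift_bounds_Suc_ivl[of \<Delta> "m - 1" "2 * m - 1"] by simp
  also have "\<dots> \<le> (\<Sum>u\<in>{m-1..<2*m-1}. (2 + 2 * sqrt V) + (a (Suc u) - a u))"
    by (intro sum_mono \<Delta>) auto
  also have "\<dots> = m * (2 + 2 * sqrt V) + (a (2 * m - 1) - a (m - 1))"
    using m by (simp add: sum.distrib sum_Suc_diff' del: sum_subtractf)
  also have "\<dots> \<le> m * (2 + 2 * sqrt V + 28 * S)"
    using tele by (simp add: algebra_simps)
  finally show ?thesis
    by (simp add: \<Delta>_def h_def)
qed

text \<open>
  Two evaluations of the average of \<open>f\<close> times the block energy at replica \<open>l\<close> are compared.  If the block
  energy is within \<open>\<Delta>\<close> of a constant on average, it factors out of the average up to \<open>\<Delta>\<close>; integration by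
  parts, applied to \<open>f\<close> and to the constant function \<open>1\<close>, evaluates it in terms of covariances.  The
  diagonal covariance \<open>1\<close> contributes equally to both sides and cancels.
\<close>
lemma ghirlanda_guerra:
  fixes t :: "'i \<Rightarrow> real" and \<eta> u a :: real and n l :: nat
  assumes B: "B \<subseteq> I" "B \<noteq> {}" and \<eta>: "0 < \<eta>" and u: "0 < u"
    and t: "\<And>i. i \<in> B \<Longrightarrow> t i = \<eta> * u" and C: "\<And>i. i \<in> B \<Longrightarrow> C i = K"
    and small: "2 * real n * (\<eta> * u) \<le> 1" and l: "l < n"
    and f: "\<And>z. z \<in> PiE {..<n} (\<lambda>_. X) \<Longrightarrow> \<bar>f z\<bar> \<le> 1"
  defines "\<Delta> \<equiv> expect law (\<lambda>w. \<Sum>x\<in>X. gibbs t w x * \<bar>block_energy B \<eta> w x - a\<bar>)"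
  shows "\<bar>expect law (\<lambda>w. replica_avg X (gibbs t w) n (\<lambda>z. f z * excess_overlap X (gibbs t w) n l K z))
      - expect law (\<lambda>w. replica_avg X (gibbs t w) n f) * expect law (\<lambda>w. pair_avg X (gibbs t w) K)\<bar>
    \<le> 2 * \<Delta> / (card B * \<eta>\<^sup>2 * u) + 36 * (real n)\<^sup>2 * (\<eta> * u)"
proof -
  define S where "S = card B * \<eta>\<^sup>2"
  define h where "h = block_energy B \<eta>"
  define p where "p = gibbs t"
  have finB: "finite B"
    using B finite_I finite_subset by blast
  then have S: "0 < S"
    using B \<eta> by (simp add: S_def card_gt_0_iff)
  have p: "prob_vector X (p w)" for w
    by (simp add: p_def prob_gibbs)
  have avg_h: "\<bar>expect law (\<lambda>w. replica_avg X (p w) k (\<lambda>z. g z * h w (z j)))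
      - S * u * expect law (\<lambda>w. replica_avg X (p w) k (\<lambda>z. g z * overlap_response X K (p w) k j z))\<bar>
      \<le> S * u * (18 * (real k)\<^sup>2 * (\<eta> * u))"
    if g: "\<And>z. z \<in> PiE {..<k} (\<lambda>_. X) \<Longrightarrow> \<bar>g z\<bar> \<le> 1" and j: "j < k" and k: "k \<le> n" for k j g
  proof -
    define R where "R = expect law (\<lambda>w. replica_avg X (p w) k (\<lambda>z. g z * overlap_response X K (p w) k j z))"
    define Q where "Q i = expect law (\<lambda>w. replica_avg X (p w) k (\<lambda>z. g z * bool_sign (w i (z j))))" for i
    have ibp: "\<bar>Q i - \<eta> * u * R\<bar> \<le> 18 * (real k)\<^sup>2 * (\<eta> * u)\<^sup>2" if i: "i \<in> B" for i
    proof -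
      have "2 * real k * (\<eta> * u) \<le> 2 * real n * (\<eta> * u)"
        using k \<eta> u by (intro mult_right_mono) auto
      then have "2 * real k * t i \<le> 1"
        unfolding t[OF i] using small by linarith
      moreover have "0 \<le> t i"
        using t[OF i] \<eta> u by simp
      ultimately show ?thesis
        using system_integration_by_parts[of i t k j g] B i j g
        by (auto simp: Q_def R_def p_def t C)
    qed
    have "expect law (\<lambda>w. replica_avg X (p w) k (\<lambda>z. g z * h w (z j))) = \<eta> * (\<Sum>i\<in>B. Q i)"
    proof -
      have "replica_avg X (p w) k (\<lambda>z. g z * h w (z j)) =
          \<eta> * (\<Sum>i\<in>B. replica_avg X (p w) k (\<lambda>z. g z * bool_sign (w i (z j))))" for w
        by (simp add: h_def block_energy_def sum_distrib_left mult.left_commute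
            flip: replica_avg_sum replica_avg_cmult)
      then show ?thesis
        by (simp add: Q_def expect_sum finite_law)
    qed
    moreover have "S * u * R = \<eta> * (\<Sum>i\<in>B. \<eta> * u * R)"
      by (simp add: S_def power2_eq_square)
    ultimately have "expect law (\<lambda>w. replica_avg X (p w) k (\<lambda>z. g z * h w (z j))) - S * u * R
        = \<eta> * (\<Sum>i\<in>B. Q i - \<eta> * u * R)"
      by (simp only: sum_subtractf right_diff_distrib)
    then have "\<bar>expect law (\<lambda>w. replica_avg X (p w) k (\<lambda>z. g z * h w (z j))) - S * u * R\<bar>
        = \<eta> * \<bar>\<Sum>i\<in>B. Q i - \<eta> * u * R\<bar>"
      using \<eta> by (simp only: abs_mult abs_of_pos)
    also have "\<dots> \<le> \<eta> * (\<Sum>i\<in>B. 18 * (real k)\<^sup>2 * (\<eta> * u)\<^sup>2)"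
      using \<eta> ibp by (intro mult_left_mono order.trans[OF sum_abs] sum_mono) auto
    also have "\<dots> = S * u * (18 * (real k)\<^sup>2 * (\<eta> * u))"
      by (simp add: S_def power2_eq_square)
    finally show ?thesis
      by (simp add: R_def)
  qed
  define E where "E g = expect law (\<lambda>w. replica_avg X (p w) n (g w))" for g
  define f0 where "f0 = E (\<lambda>w z. f z)"
  define fh where "fh = E (\<lambda>w z. f z * h w (z l))"
  define h0 where "h0 = expect law (\<lambda>w. \<Sum>x\<in>X. p w x * h w x)"
  define c0 where "c0 = expect law (\<lambda>w. pair_avg X (p w) K)"
  define fx where "fx = E (\<lambda>w z. f z * excess_overlap X (p w) n l K z)"
  have E_const: "E (\<lambda>w z. c) = c" for c
    by (simp add: E_def replica_avg_const[OF p])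
  have f0: "\<bar>f0\<bar> \<le> 1"
    unfolding f0_def E_def by (intro expect_abs_le_const finite_law replica_avg_abs_le p f)
  have fh: "\<bar>fh - a * f0\<bar> \<le> \<Delta>"
  proof -
    have "fh - a * f0 = E (\<lambda>w z. f z * (h w (z l) - a))"
      by (simp add: fh_def f0_def E_def replica_avg_diff replica_avg_cmult right_diff_distrib
          expect_diff finite_law mult.commute[of _ a])
    also have "\<bar>\<dots>\<bar> \<le> \<Delta>"
      unfolding E_def \<Delta>_def h_def[symmetric] p_def[symmetric]
    proof (intro expect_abs_le finite_law)
      fix w
      have "\<bar>replica_avg X (p w) n (\<lambda>z. f z * (h w (z l) - a))\<bar>
          \<le> replica_avg X (p w) n (\<lambda>z. \<bar>f z * (h w (z l) - a)\<bar>)"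
        by (rule replica_avg_abs[OF p])
      also have "\<dots> \<le> replica_avg X (p w) n (\<lambda>z. \<bar>h w (z l) - a\<bar>)"
      proof (intro replica_avg_mono p)
        fix z assume z: "z \<in> PiE {..<n} (\<lambda>_. X)"
        have "\<bar>f z\<bar> * \<bar>h w (z l) - a\<bar> \<le> 1 * \<bar>h w (z l) - a\<bar>"
          using f[OF z] by (intro mult_right_mono) auto
        then show "\<bar>f z * (h w (z l) - a)\<bar> \<le> \<bar>h w (z l) - a\<bar>"
          by (simp add: abs_mult)
      qed
      also have "\<dots> = (\<Sum>x\<in>X. p w x * \<bar>h w x - a\<bar>)"
        using replica_avg_marginal[OF p l, of w "\<lambda>x. \<bar>h w x - a\<bar>"] .
      finally show "\<bar>replica_avg X (p w) n (\<lambda>z. f z * (h w (z l) - a))\<bar> \<le> (\<Sum>x\<in>X. p w x * \<bar>h w x - a\<bar>)" .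
    qed
    finally show ?thesis .
  qed
  have h0: "\<bar>h0 - a\<bar> \<le> \<Delta>"
  proof -
    have "h0 - a = expect law (\<lambda>w. \<Sum>x\<in>X. p w x * (h w x - a))"
      using prob_vectorD(3)[OF p]
      by (simp add: h0_def right_diff_distrib sum_subtractf expect_diff finite_law flip: sum_distrib_right)
    also have "\<bar>\<dots>\<bar> \<le> \<Delta>"
      unfolding \<Delta>_def h_def[symmetric] p_def[symmetric]
      using prob_vectorD(2)[OF p]
      by (intro expect_abs_le finite_law order.trans[OF sum_abs] sum_mono) (auto simp: abs_mult)
    finally show ?thesis .
  qed
  have resp: "overlap_response X K (p w) n l z = 1 - excess_overlap X (p w) n l K z"
    if z: "z \<in> PiE {..<n} (\<lambda>_. X)" for w z
  proof -
    obtain i where "i \<in> B" using B by auto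
    then have "K (z l) (z l) = 1"
      using sign_field_diagonal[OF field[of i], of "z l"] B C z l by auto
    then show ?thesis
      using l by (simp add: overlap_response_def excess_overlap_def sum.remove[of "{..<n}" l])
  qed
  have 1: "\<bar>fh - S * u * (f0 - fx)\<bar> \<le> S * u * (18 * (real n)\<^sup>2 * (\<eta> * u))"
  proof -
    have "expect law (\<lambda>w. replica_avg X (p w) n (\<lambda>z. f z * overlap_response X K (p w) n l z)) =
        expect law (\<lambda>w. replica_avg X (p w) n (\<lambda>z. f z - f z * excess_overlap X (p w) n l K z))"
      by (intro Bochner_Integration.integral_cong refl replica_avg_cong) (simp add: resp right_diff_distrib)
    also have "\<dots> = f0 - fx"
      by (simp add: f0_def fx_def E_def replica_avg_diff expect_diff finite_law)
    finally show ?thesis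
      using avg_h[of n f l] f l by (simp add: fh_def E_def)
  qed
  have 2: "\<bar>h0 - S * u * (1 - c0)\<bar> \<le> S * u * (18 * (real n)\<^sup>2 * (\<eta> * u))"
  proof -
    obtain i where i: "i \<in> B" using B by auto
    have diag: "K x x = 1" if "x \<in> X" for x
      using sign_field_diagonal[OF field[of i] that] B C i by auto
    have marg: "replica_avg X (p w) 1 (\<lambda>z. g (z 0)) = (\<Sum>x\<in>X. p w x * g x)" for w g
      by (rule replica_avg_marginal[OF p]) simp
    have "replica_avg X (p w) 1 (\<lambda>z. overlap_response X K (p w) 1 0 z) = 1 - pair_avg X (p w) K" for w
    proof -
      have "replica_avg X (p w) 1 (\<lambda>z. overlap_response X K (p w) 1 0 z) =
          (\<Sum>x\<in>X. p w x * (K x x - (\<Sum>y\<in>X. p w y * K x y)))"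
        using marg[of w "\<lambda>x. K x x - (\<Sum>y\<in>X. p w y * K x y)"]
        by (simp add: overlap_response_def)
      also have "\<dots> = 1 - pair_avg X (p w) K"
        using diag prob_vectorD(3)[OF p]
        by (simp add: pair_avg_def right_diff_distrib sum_subtractf)
      finally show ?thesis .
    qed
    then have "\<bar>h0 - S * u * (1 - c0)\<bar> \<le> S * u * (18 * (\<eta> * u))"
      using avg_h[of 1 "\<lambda>_. 1" 0] l marg[of _ "h _"]
      by (simp add: h0_def c0_def expect_diff finite_law)
    also have "\<dots> \<le> S * u * (18 * (real n)\<^sup>2 * (\<eta> * u))"
    proof (intro mult_left_mono mult_right_mono)
      show "18 \<le> 18 * (real n)\<^sup>2"
        using l one_le_power[of "real n" 2] by simp
    qed (use S u \<eta> in auto)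
    finally show ?thesis .
  qed
  \<comment> \<open>The diagonal contributions \<open>f0\<close> and \<open>f0 * 1\<close> cancel here.\<close>
  have "S * u * (fx - f0 * c0) = (fh - S * u * (f0 - fx)) - (fh - a * f0)
      + f0 * (h0 - a) - f0 * (h0 - S * u * (1 - c0))"
    by (simp add: algebra_simps)
  moreover have "\<bar>f0 * (h0 - a)\<bar> \<le> 1 * \<Delta>"
    unfolding abs_mult using f0 h0 by (intro mult_mono) auto
  moreover have "\<bar>f0 * (h0 - S * u * (1 - c0))\<bar> \<le> 1 * (S * u * (18 * (real n)\<^sup>2 * (\<eta> * u)))"
    unfolding abs_mult using f0 2 by (intro mult_mono) auto
  ultimately have "\<bar>S * u * (fx - f0 * c0)\<bar> \<le> 2 * \<Delta> + S * u * (36 * (real n)\<^sup>2 * (\<eta> * u))"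
    using 1 fh by linarith
  then have "\<bar>fx - f0 * c0\<bar> * (S * u) \<le> 2 * \<Delta> + S * u * (36 * (real n)\<^sup>2 * (\<eta> * u))"
    using S u by (simp add: abs_mult mult_ac)
  then have "\<bar>fx - f0 * c0\<bar> \<le> (2 * \<Delta> + S * u * (36 * (real n)\<^sup>2 * (\<eta> * u))) / (S * u)"
    using S u by (simp add: pos_le_divide_eq)
  also have "\<dots> = 2 * \<Delta> / (S * u) + 36 * (real n)\<^sup>2 * (\<eta> * u)"
    using S u by (simp add: add_divide_distrib)
  finally show ?thesis
    by (simp add: fx_def f0_def c0_def E_def p_def S_def)
qed

end

section \<open>Growing sets of replicas with negative overlaps\<close>

lemma sign_field_symmetric:
  assumes "sign_field X C D" "x \<in> X" "y \<in> X"
  shows "C x y = C y x"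
proof -
  have "C x y = expect D (\<lambda>s. bool_sign (s x) * bool_sign (s y))"
    using assms by (simp add: sign_field_def)
  also have "\<dots> = expect D (\<lambda>s. bool_sign (s y) * bool_sign (s x))"
    by (simp add: mult.commute)
  also have "\<dots> = C y x"
    using assms by (simp add: sign_field_def)
  finally show ?thesis .
qed

lemma pair_avg_mono:
  assumes "prob_vector X p" "\<And>x y. x \<in> X \<Longrightarrow> y \<in> X \<Longrightarrow> K x y \<le> L x y"
  shows "pair_avg X p K \<le> pair_avg X p L"
  unfolding pair_avg_def using assms
  by (intro sum_mono mult_left_mono) (auto simp: prob_vector_def)

lemma pair_avg_const:
  assumes "prob_vector X p"
  shows "pair_avg X p (\<lambda>_ _. c) = c"
  using assms by (simp add: pair_avg_def prob_vector_def flip: sum_distrib_right)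

lemma pair_avg_add: "pair_avg X p (\<lambda>x y. K x y + L x y) = pair_avg X p K + pair_avg X p L"
  by (simp add: pair_avg_def distrib_left sum.distrib)

lemma pair_avg_diff: "pair_avg X p (\<lambda>x y. K x y - L x y) = pair_avg X p K - pair_avg X p L"
  by (simp add: pair_avg_def right_diff_distrib sum_subtractf)

lemma pair_avg_sum:
  "pair_avg X p (\<lambda>x y. \<Sum>j\<in>J. b j * K j x y) = (\<Sum>j\<in>J. b j * pair_avg X p (K j))"
proof -
  have "pair_avg X p (\<lambda>x y. \<Sum>j\<in>J. b j * K j x y) =
      (\<Sum>x\<in>X. \<Sum>y\<in>X. \<Sum>j\<in>J. b j * (p x * (p y * K j x y)))"
    by (simp add: pair_avg_def sum_distrib_left mult_ac)
  also have "\<dots> = (\<Sum>x\<in>X. \<Sum>j\<in>J. \<Sum>y\<in>X. b j * (p x * (p y * K j x y)))"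
    by (intro sum.cong refl sum.swap)
  also have "\<dots> = (\<Sum>j\<in>J. \<Sum>x\<in>X. \<Sum>y\<in>X. b j * (p x * (p y * K j x y)))"
    by (rule sum.swap)
  finally show ?thesis
    by (simp add: pair_avg_def sum_distrib_left)
qed

lemma excess_overlap_sum:
  "excess_overlap X p n l (\<lambda>x y. \<Sum>j\<in>J. b j * K j x y) z = (\<Sum>j\<in>J. b j * excess_overlap X p n l (K j) z)"
proof -
  have "(\<Sum>y\<in>X. p y * (\<Sum>j\<in>J. b j * K j (z l) y)) = (\<Sum>j\<in>J. b j * (\<Sum>y\<in>X. p y * K j (z l) y))"
    unfolding sum_distrib_left by (subst sum.swap) (simp add: mult_ac)
  moreover have "(\<Sum>k\<in>{..<n} - {l}. \<Sum>j\<in>J. b j * K j (z l) (z k)) =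
      (\<Sum>j\<in>J. b j * (\<Sum>k\<in>{..<n} - {l}. K j (z l) (z k)))"
    unfolding sum_distrib_left by (rule sum.swap)
  ultimately show ?thesis
    by (simp add: excess_overlap_def right_diff_distrib sum_subtractf sum_distrib_left mult_ac)
qed

text \<open>
  The threshold \<open>\<delta> n\<close> varies with the number of replicas, which leaves room between consecutive thresholds
  for a continuous cut-off.
\<close>
definition mutually_negative :: "('a \<Rightarrow> 'a \<Rightarrow> real) \<Rightarrow> (nat \<Rightarrow> real) \<Rightarrow> nat \<Rightarrow> (nat \<Rightarrow> 'a) \<Rightarrow> bool" where
  "mutually_negative K \<delta> n z \<longleftrightarrow> (\<forall>k<n. \<forall>l<n. k \<noteq> l \<longrightarrow> K (z k) (z l) \<le> - \<delta> n)"

text \<open>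
  The sum of all entries of the covariance matrix of \<open>n\<close> points is the second moment of a sum of signs,
  hence nonnegative, whereas each of its rows would have a negative sum.
\<close>
lemma mutually_negative_impossible:
  assumes D: "sign_field X K D" and z: "\<And>k. k < n \<Longrightarrow> z k \<in> X" and n: "real (n - 1) * \<delta> n > 1"
  shows "\<not> mutually_negative K \<delta> n z"
proof
  assume A: "mutually_negative K \<delta> n z"
  have n1: "n \<ge> 1"
    using n by (cases n) auto
  have fin: "finite (set_pmf D)"
    using D by (simp add: sign_field_def)
  have row: "(\<Sum>l<n. K (z k) (z l)) \<le> 1 - real (n - 1) * \<delta> n" if k: "k < n" for k
  proof -
    have "(\<Sum>l<n. K (z k) (z l)) = K (z k) (z k) + (\<Sum>l\<in>{..<n} - {k}. K (z k) (z l))"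
      using k by (intro sum.remove) auto
    also have "\<dots> \<le> 1 + (\<Sum>l\<in>{..<n} - {k}. - \<delta> n)"
      using A k sign_field_diagonal[OF D z[OF k]]
      by (intro add_mono sum_mono) (auto simp: mutually_negative_def)
    finally show ?thesis
      using k by simp
  qed
  have "0 \<le> expect D (\<lambda>s. (\<Sum>k<n. bool_sign (s (z k)))\<^sup>2)"
    by (rule Bochner_Integration.integral_nonneg) simp
  also have "\<dots> = (\<Sum>k<n. \<Sum>l<n. expect D (\<lambda>s. bool_sign (s (z k)) * bool_sign (s (z l))))"
    by (simp add: power2_eq_square sum_product expect_sum fin)
  also have "\<dots> = (\<Sum>k<n. \<Sum>l<n. K (z k) (z l))"
    using D z by (intro sum.cong) (auto simp: sign_field_def)
  also have "\<dots> \<le> (\<Sum>k<n. 1 - real (n - 1) * \<delta> n)"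
    using row by (intro sum_mono) auto
  also have "\<dots> = n * (1 - real (n - 1) * \<delta> n)"
    by (simp only: sum_constant card_lessThan)
  also have "\<dots> < 0"
    using n n1 by (intro mult_pos_neg) auto
  finally show False by simp
qed

context disorder
begin

text \<open>
  The identities are linear in the covariance.  The constant term of a polynomial needs no field: for the
  constant covariance \<open>1\<close> the excess \<open>n - (n - 1)\<close> is identically \<open>1\<close>.
\<close>
lemma polynomial_ghirlanda_guerra:
  fixes K :: "'a \<Rightarrow> 'a \<Rightarrow> real" and b e :: "nat \<Rightarrow> real" and d n l :: nat
  assumes l: "l < n"
    and gg: "\<And>j. j \<in> {1..d} \<Longrightarrow>
      \<bar>expect law (\<lambda>w. replica_avg X (gibbs t w) n (\<lambda>z. f z * excess_overlap X (gibbs t w) n l (\<lambda>x y. K x y ^ j) z))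
      - expect law (\<lambda>w. replica_avg X (gibbs t w) n f) * expect law (\<lambda>w. pair_avg X (gibbs t w) (\<lambda>x y. K x y ^ j))\<bar> \<le> e j"
  shows "\<bar>expect law (\<lambda>w. replica_avg X (gibbs t w) n
        (\<lambda>z. f z * excess_overlap X (gibbs t w) n l (\<lambda>x y. \<Sum>j\<le>d. b j * K x y ^ j) z))
      - expect law (\<lambda>w. replica_avg X (gibbs t w) n f)
        * expect law (\<lambda>w. pair_avg X (gibbs t w) (\<lambda>x y. \<Sum>j\<le>d. b j * K x y ^ j))\<bar>
    \<le> (\<Sum>j\<in>{1..d}. \<bar>b j\<bar> * e j)"
proof -
  define T where "T j =
      expect law (\<lambda>w. replica_avg X (gibbs t w) n (\<lambda>z. f z * excess_overlap X (gibbs t w) n l (\<lambda>x y. K x y ^ j) z))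
      - expect law (\<lambda>w. replica_avg X (gibbs t w) n f) * expect law (\<lambda>w. pair_avg X (gibbs t w) (\<lambda>x y. K x y ^ j))" for j
  have "T 0 = 0"
  proof -
    have "excess_overlap X (gibbs t w) n l (\<lambda>x y. K x y ^ 0) z = 1" for w z
      using l prob_vectorD(3)[OF prob_gibbs[of t w]] by (simp add: excess_overlap_def of_nat_diff)
    then show ?thesis
      by (simp add: T_def pair_avg_const[OF prob_gibbs])
  qed
  have "expect law (\<lambda>w. replica_avg X (gibbs t w) n
        (\<lambda>z. f z * excess_overlap X (gibbs t w) n l (\<lambda>x y. \<Sum>j\<le>d. b j * K x y ^ j) z)) =
      (\<Sum>j\<le>d. b j * expect law (\<lambda>w. replica_avg X (gibbs t w) n
        (\<lambda>z. f z * excess_overlap X (gibbs t w) n l (\<lambda>x y. K x y ^ j) z)))"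
    unfolding excess_overlap_sum
    by (simp add: sum_distrib_left mult.left_commute replica_avg_sum replica_avg_cmult expect_sum finite_law)
  moreover have "expect law (\<lambda>w. pair_avg X (gibbs t w) (\<lambda>x y. \<Sum>j\<le>d. b j * K x y ^ j)) =
      (\<Sum>j\<le>d. b j * expect law (\<lambda>w. pair_avg X (gibbs t w) (\<lambda>x y. K x y ^ j)))"
    unfolding pair_avg_sum by (simp add: expect_sum finite_law)
  ultimately have "expect law (\<lambda>w. replica_avg X (gibbs t w) n
        (\<lambda>z. f z * excess_overlap X (gibbs t w) n l (\<lambda>x y. \<Sum>j\<le>d. b j * K x y ^ j) z))
      - expect law (\<lambda>w. replica_avg X (gibbs t w) n f)
        * expect law (\<lambda>w. pair_avg X (gibbs t w) (\<lambda>x y. \<Sum>j\<le>d. b j * K x y ^ j)) = (\<Sum>j\<le>d. b j * T j)"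
    by (simp add: T_def right_diff_distrib sum_subtractf sum_distrib_left mult_ac)
  also have "\<dots> = (\<Sum>j\<in>{1..d}. b j * T j)"
    using \<open>T 0 = 0\<close> by (intro sum.mono_neutral_right) (auto simp: not_less_eq_eq)
  also have "\<bar>\<dots>\<bar> \<le> (\<Sum>j\<in>{1..d}. \<bar>b j\<bar> * e j)"
    using gg by (intro order.trans[OF sum_abs] sum_mono) (auto simp: abs_mult T_def intro!: mult_left_mono)
  finally show ?thesis .
qed

text \<open>
  Here \<open>\<phi>\<close> is a cut-off that vanishes below \<open>-\<delta> n\<close> and is \<open>1\<close> above \<open>-\<delta> (n+1)\<close>, and \<open>q\<close> approximates it.
  If \<open>n\<close> replicas are mutually negative and \<open>n + 1\<close> are not, then \<open>\<phi>\<close> is \<open>1\<close> at the pair of the new replica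
  and some replica \<open>l\<close>.  For fixed \<open>l\<close> the identities bound the average of this event by
  \<open>P n (1 - \<pi>) / n\<close>, because \<open>\<phi>\<close> vanishes at the pairs already present, and a union bound over the \<open>n\<close>
  values of \<open>l\<close> loses exactly the factor \<open>n\<close>.  The errors come from \<open>\<tau>\<close> and \<open>e\<close>.
\<close>
lemma mutually_negative_step:
  fixes K :: "'a \<Rightarrow> 'a \<Rightarrow> real" and \<phi> q :: "real \<Rightarrow> real" and \<delta> P :: "nat \<Rightarrow> real" and \<pi> \<tau> e :: real and n :: nat
  assumes n: "n \<ge> 1" and sym: "\<And>x y. x \<in> X \<Longrightarrow> y \<in> X \<Longrightarrow> K x y = K y x"
    and K: "\<And>x y. x \<in> X \<Longrightarrow> y \<in> X \<Longrightarrow> \<bar>K x y\<bar> \<le> 1"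
    and \<delta>: "\<delta> (Suc n) \<le> \<delta> n" "\<delta> n \<le> \<delta> 0"
    and \<phi>0: "\<And>r. r \<le> - \<delta> n \<Longrightarrow> \<phi> r = 0" and \<phi>1: "\<And>r. r > - \<delta> (Suc n) \<Longrightarrow> \<phi> r = 1"
    and \<phi>: "\<And>r. 0 \<le> \<phi> r \<and> \<phi> r \<le> 1"
    and q: "\<And>r. \<bar>r\<bar> \<le> 1 \<Longrightarrow> \<bar>\<phi> r - q r\<bar> \<le> \<tau>"
    and gg: "\<And>l. l < n \<Longrightarrow>
      \<bar>expect law (\<lambda>w. replica_avg X (gibbs t w) n
        (\<lambda>z. of_bool (mutually_negative K \<delta> n z) * excess_overlap X (gibbs t w) n l (\<lambda>x y. q (K x y)) z))
      - expect law (\<lambda>w. replica_avg X (gibbs t w) n (\<lambda>z. of_bool (mutually_negative K \<delta> n z)))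
        * expect law (\<lambda>w. pair_avg X (gibbs t w) (\<lambda>x y. q (K x y)))\<bar> \<le> e"
  defines "P \<equiv> \<lambda>n. expect law (\<lambda>w. replica_avg X (gibbs t w) n (\<lambda>z. of_bool (mutually_negative K \<delta> n z)))"
    and "\<pi> \<equiv> expect law (\<lambda>w. pair_avg X (gibbs t w) (\<lambda>x y. of_bool (K x y \<le> - \<delta> 0)))"
  shows "P (Suc n) \<ge> \<pi> * P n - (3 * n * \<tau> + e)"
proof -
  define A where "A z = (of_bool (mutually_negative K \<delta> n z) :: real)" for z
  define p where "p = gibbs t"
  define E where "E g = expect law (\<lambda>w. replica_avg X (p w) n (g w))" for g
  have p: "prob_vector X (p w)" for w
    by (simp add: p_def prob_gibbs)
  have \<tau>: "0 \<le> \<tau>"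
    using q[of 0] by simp
  have E_mono: "E g \<le> E h" if "\<And>w z. z \<in> PiE {..<n} (\<lambda>_. X) \<Longrightarrow> g w z \<le> h w z" for g h
    unfolding E_def using that by (intro expect_mono finite_law replica_avg_mono p)
  have E_const: "E (\<lambda>_ _. c) = c" for c
    by (simp add: E_def replica_avg_const[OF p])
  have Pn: "P n = E (\<lambda>_ z. A z)"
    by (simp add: P_def E_def A_def[abs_def] p_def)
  have "E (\<lambda>_ z. 0) \<le> P n" "P n \<le> E (\<lambda>_ _. 1)"
    unfolding Pn by (intro E_mono; simp add: A_def)+
  then have P01: "0 \<le> P n" "P n \<le> 1"
    by (simp_all add: E_const)
  define J where "J l = E (\<lambda>w z. A z * (\<Sum>y\<in>X. p w y * \<phi> (K (z l) y)))" for l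
  have "P (Suc n) = E (\<lambda>w z. \<Sum>y\<in>X. p w y * of_bool (mutually_negative K \<delta> (Suc n) (z(n := y))))"
    by (simp add: P_def E_def replica_avg_Suc p_def)
  also have "\<dots> \<ge> E (\<lambda>w z. A z - (\<Sum>l<n. A z * (\<Sum>y\<in>X. p w y * \<phi> (K (z l) y))))"
  proof (intro E_mono)
    fix w z assume z: "z \<in> PiE {..<n} (\<lambda>_. X)"
    have zX: "z k \<in> X" if "k < n" for k
      using z that by auto
    have "A z - (\<Sum>l<n. A z * \<phi> (K (z l) y)) \<le> of_bool (mutually_negative K \<delta> (Suc n) (z(n := y)))"
      if y: "y \<in> X" for y
    proof (cases "mutually_negative K \<delta> n z \<and> (\<forall>l<n. K (z l) y \<le> - \<delta> (Suc n))")
      case True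
      have "K (z k) (z l) \<le> - \<delta> (Suc n)" if "k < n" "l < n" "k \<noteq> l" for k l
        using True that \<delta>(1) unfolding mutually_negative_def by force
      moreover have "K y (z l) \<le> - \<delta> (Suc n)" if "l < n" for l
        using True that sym[OF y zX[OF that]] by simp
      ultimately have "mutually_negative K \<delta> (Suc n) (z(n := y))"
        using True by (auto simp: mutually_negative_def less_Suc_eq)
      moreover have "0 \<le> (\<Sum>l<n. A z * \<phi> (K (z l) y))"
        using \<phi> by (intro sum_nonneg) (simp add: A_def)
      moreover have "A z \<le> 1"
        by (simp add: A_def)
      ultimately show ?thesis
        by simp
    next
      case False
      have "A z \<le> (\<Sum>l<n. A z * \<phi> (K (z l) y))"
      proof (cases "mutually_negative K \<delta> n z")
        case True
        then obtain l where l: "l < n" "K (z l) y > - \<delta> (Suc n)"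
          using False by (auto simp: not_le)
        have "A z * \<phi> (K (z l) y) \<le> (\<Sum>l<n. A z * \<phi> (K (z l) y))"
          using l \<phi> by (intro member_le_sum) (auto simp: A_def)
        then show ?thesis
          using \<phi>1[OF l(2)] by simp
      qed (simp add: A_def)
      then show ?thesis
        by simp
    qed
    then have "(\<Sum>y\<in>X. p w y * (A z - (\<Sum>l<n. A z * \<phi> (K (z l) y))))
        \<le> (\<Sum>y\<in>X. p w y * of_bool (mutually_negative K \<delta> (Suc n) (z(n := y))))"
      using prob_vectorD(2)[OF p] by (intro sum_mono mult_left_mono) auto
    moreover have "(\<Sum>y\<in>X. p w y * (A z - (\<Sum>l<n. A z * \<phi> (K (z l) y)))) =
        A z - (\<Sum>l<n. A z * (\<Sum>y\<in>X. p w y * \<phi> (K (z l) y)))"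
    proof -
      have "(\<Sum>y\<in>X. p w y * (\<Sum>l<n. A z * \<phi> (K (z l) y))) = (\<Sum>l<n. A z * (\<Sum>y\<in>X. p w y * \<phi> (K (z l) y)))"
        unfolding sum_distrib_left by (subst sum.swap) (simp add: mult_ac)
      moreover have "(\<Sum>y\<in>X. p w y * A z) = A z"
        using prob_vectorD(3)[OF p] by (simp flip: sum_distrib_right)
      ultimately show ?thesis
        by (simp add: right_diff_distrib sum_subtractf)
    qed
    ultimately show "A z - (\<Sum>l<n. A z * (\<Sum>y\<in>X. p w y * \<phi> (K (z l) y)))
        \<le> (\<Sum>y\<in>X. p w y * of_bool (mutually_negative K \<delta> (Suc n) (z(n := y))))"
      by simp
  qed
  also have "E (\<lambda>w z. A z - (\<Sum>l<n. A z * (\<Sum>y\<in>X. p w y * \<phi> (K (z l) y)))) = P n - (\<Sum>l<n. J l)"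
    by (simp add: Pn J_def E_def replica_avg_diff replica_avg_sum expect_diff expect_sum finite_law)
  finally have step: "P (Suc n) \<ge> P n - (\<Sum>l<n. J l)" .
  have pair: "expect law (\<lambda>w. pair_avg X (p w) (\<lambda>x y. q (K x y))) \<le> 1 - \<pi> + \<tau>"
  proof -
    have "expect law (\<lambda>w. pair_avg X (p w) (\<lambda>x y. q (K x y)))
        \<le> expect law (\<lambda>w. pair_avg X (p w) (\<lambda>x y. (1 - of_bool (K x y \<le> - \<delta> 0)) + \<tau>))"
    proof (intro expect_mono finite_law pair_avg_mono p)
      fix x y assume "x \<in> X" "y \<in> X"
      then have "q (K x y) \<le> \<phi> (K x y) + \<tau>"
        using q[OF K[of x y]] by (simp add: abs_le_iff)
      moreover have "\<phi> (K x y) \<le> 1 - of_bool (K x y \<le> - \<delta> 0)"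
        using \<phi>0[of "K x y"] \<phi>[of "K x y"] \<delta>(2) by simp
      ultimately show "q (K x y) \<le> (1 - of_bool (K x y \<le> - \<delta> 0)) + \<tau>"
        by simp
    qed
    then show ?thesis
      by (simp add: pair_avg_add pair_avg_diff pair_avg_const[OF p] expect_diff expect_add finite_law \<pi>_def flip: p_def)
  qed
  have J: "J l \<le> (P n * (1 - \<pi>) + e) / n + 3 * \<tau>" if l: "l < n" for l
  proof -
    have "n * J l = E (\<lambda>w z. A z * (n * (\<Sum>y\<in>X. p w y * \<phi> (K (z l) y))))"
      by (simp add: J_def E_def mult.left_commute[of _ "real n"] replica_avg_cmult)
    also have "\<dots> \<le> E (\<lambda>w z. A z * excess_overlap X (p w) n l (\<lambda>x y. q (K x y)) z + 2 * n * \<tau>)"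
    proof (intro E_mono)
      fix w z assume z: "z \<in> PiE {..<n} (\<lambda>_. X)"
      have zX: "z k \<in> X" if "k < n" for k
        using z that by auto
      show "A z * (n * (\<Sum>y\<in>X. p w y * \<phi> (K (z l) y)))
          \<le> A z * excess_overlap X (p w) n l (\<lambda>x y. q (K x y)) z + 2 * n * \<tau>"
      proof (cases "mutually_negative K \<delta> n z")
        case True
        have "(\<Sum>y\<in>X. p w y * \<phi> (K (z l) y)) \<le> (\<Sum>y\<in>X. p w y * (q (K (z l) y) + \<tau>))"
        proof (intro sum_mono mult_left_mono)
          fix y assume y: "y \<in> X"
          show "\<phi> (K (z l) y) \<le> q (K (z l) y) + \<tau>"
            using q[OF K[OF zX[OF l] y]] by (simp add: abs_le_iff)
        qed (use prob_vectorD(2)[OF p] in auto)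
        also have "\<dots> = (\<Sum>y\<in>X. p w y * q (K (z l) y)) + \<tau>"
          using prob_vectorD(3)[OF p] by (simp add: distrib_left sum.distrib flip: sum_distrib_right)
        finally have "n * (\<Sum>y\<in>X. p w y * \<phi> (K (z l) y)) \<le> n * (\<Sum>y\<in>X. p w y * q (K (z l) y)) + n * \<tau>"
          using mult_left_mono[of _ _ "real n"] by (simp add: distrib_left[symmetric])
        moreover have "(\<Sum>k\<in>{..<n} - {l}. q (K (z l) (z k))) \<le> (\<Sum>k\<in>{..<n} - {l}. \<tau>)"
        proof (intro sum_mono)
          fix k assume k: "k \<in> {..<n} - {l}"
          then have "\<phi> (K (z l) (z k)) = 0"
            using True l by (intro \<phi>0) (auto simp: mutually_negative_def)
          then show "q (K (z l) (z k)) \<le> \<tau>"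
            using q[OF K[OF zX[OF l] zX[of k]]] k by auto
        qed
        then have "(\<Sum>k\<in>{..<n} - {l}. q (K (z l) (z k))) \<le> n * \<tau>"
          using l \<tau> by (simp add: of_nat_diff algebra_simps)
        ultimately show ?thesis
          using True by (simp add: A_def excess_overlap_def)
      qed (use \<tau> in \<open>simp add: A_def\<close>)
    qed
    also have "\<dots> = E (\<lambda>w z. A z * excess_overlap X (p w) n l (\<lambda>x y. q (K x y)) z) + 2 * n * \<tau>"
      by (simp add: E_def replica_avg_add expect_add finite_law replica_avg_const[OF p])
    also have "\<dots> \<le> (P n * expect law (\<lambda>w. pair_avg X (p w) (\<lambda>x y. q (K x y))) + e) + 2 * n * \<tau>"
      using gg[OF l] by (simp add: Pn E_def A_def[abs_def] p_def abs_le_iff)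
    also have "\<dots> \<le> P n * (1 - \<pi> + \<tau>) + e + 2 * n * \<tau>"
      using mult_left_mono[OF pair P01(1)] by simp
    also have "P n * (1 - \<pi> + \<tau>) \<le> P n * (1 - \<pi>) + n * \<tau>"
    proof -
      have "P n * \<tau> \<le> n * \<tau>"
        using P01 n \<tau> by (intro mult_right_mono) auto
      then show ?thesis
        by (simp add: distrib_left)
    qed
    finally have "n * J l \<le> P n * (1 - \<pi>) + e + n * (3 * \<tau>)"
      by (simp add: mult_ac)
    then have "J l \<le> (P n * (1 - \<pi>) + e + n * (3 * \<tau>)) / n"
      using n by (simp add: pos_le_divide_eq mult.commute)
    then show ?thesis
      using n by (simp add: add_divide_distrib)
  qed
  have "(\<Sum>l<n. J l) \<le> (\<Sum>l<n. (P n * (1 - \<pi>) + e) / n + 3 * \<tau>)"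
    using J by (intro sum_mono) auto
  also have "\<dots> = P n * (1 - \<pi>) + e + 3 * n * \<tau>"
    using n by (simp add: field_simps)
  finally show ?thesis
    using step by (simp add: algebra_simps)
qed

text \<open>
  Iterating the step from a single replica to \<open>N\<close> replicas, a lower bound \<open>\<pi>\<^sup>N\<^sup>-\<^sup>1\<close> for the probability of
  \<open>N\<close> mutually negative replicas is obtained up to errors; that probability is zero.
\<close>
lemma negative_pairs_rare:
  fixes K :: "'a \<Rightarrow> 'a \<Rightarrow> real" and \<phi> q :: "nat \<Rightarrow> real \<Rightarrow> real" and \<delta> :: "nat \<Rightarrow> real" and \<tau> e :: real and N :: nat
  assumes D0: "sign_field X K D0"
    and N: "N \<ge> 1" "real (N - 1) * \<delta> N > 1"
    and \<delta>: "\<And>n. \<delta> (Suc n) \<le> \<delta> n"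
    and \<phi>0: "\<And>n r. r \<le> - \<delta> n \<Longrightarrow> \<phi> n r = 0" and \<phi>1: "\<And>n r. r > - \<delta> (Suc n) \<Longrightarrow> \<phi> n r = 1"
    and \<phi>: "\<And>n r. 0 \<le> \<phi> n r \<and> \<phi> n r \<le> 1"
    and q: "\<And>n r. n < N \<Longrightarrow> \<bar>r\<bar> \<le> 1 \<Longrightarrow> \<bar>\<phi> n r - q n r\<bar> \<le> \<tau>"
    and gg: "\<And>n l. n < N \<Longrightarrow> l < n \<Longrightarrow>
      \<bar>expect law (\<lambda>w. replica_avg X (gibbs t w) n
        (\<lambda>z. of_bool (mutually_negative K \<delta> n z) * excess_overlap X (gibbs t w) n l (\<lambda>x y. q n (K x y)) z))
      - expect law (\<lambda>w. replica_avg X (gibbs t w) n (\<lambda>z. of_bool (mutually_negative K \<delta> n z)))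
        * expect law (\<lambda>w. pair_avg X (gibbs t w) (\<lambda>x y. q n (K x y)))\<bar> \<le> e"
    and \<tau>: "0 \<le> \<tau>" and e: "0 \<le> e"
  shows "expect law (\<lambda>w. pair_avg X (gibbs t w) (\<lambda>x y. of_bool (K x y \<le> - \<delta> 0))) ^ (N - 1)
    \<le> N * (3 * N * \<tau> + e)"
proof -
  define P where "P n = expect law (\<lambda>w. replica_avg X (gibbs t w) n (\<lambda>z. of_bool (mutually_negative K \<delta> n z)))" for n
  define \<pi> where "\<pi> = expect law (\<lambda>w. pair_avg X (gibbs t w) (\<lambda>x y. of_bool (K x y \<le> - \<delta> 0)))"
  define \<xi> where "\<xi> = 3 * N * \<tau> + e"
  have \<xi>: "0 \<le> \<xi>"
    using \<tau> e by (simp add: \<xi>_def)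
  have \<delta>0: "\<delta> n \<le> \<delta> 0" for n
    using lift_Suc_antimono_le[of \<delta>, OF \<delta>, of 0 n] by simp
  have sym: "K x y = K y x" if "x \<in> X" "y \<in> X" for x y
    using sign_field_symmetric[OF D0 that] .
  have "expect law (\<lambda>w. pair_avg X (gibbs t w) (\<lambda>x y. 0)) \<le> \<pi>" "\<pi> \<le> expect law (\<lambda>w. pair_avg X (gibbs t w) (\<lambda>x y. 1))"
    unfolding \<pi>_def by (intro expect_mono finite_law pair_avg_mono prob_gibbs; simp)+
  then have \<pi>: "0 \<le> \<pi>" "\<pi> \<le> 1"
    by (simp_all add: pair_avg_const[OF prob_gibbs])
  have P: "\<pi> ^ k - k * \<xi> \<le> P (Suc k)" if "Suc k \<le> N" for k
    using that
  proof (induction k)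
    case 0
    have "mutually_negative K \<delta> (Suc 0) z" for z
      by (simp add: mutually_negative_def)
    then show ?case
      by (simp add: P_def replica_avg_const[OF prob_gibbs])
  next
    case (Suc k)
    have "\<pi> * P (Suc k) - (3 * Suc k * \<tau> + e) \<le> P (Suc (Suc k))"
      unfolding P_def \<pi>_def
    proof (rule mutually_negative_step)
      show "\<bar>\<phi> (Suc k) r - q (Suc k) r\<bar> \<le> \<tau>" if "\<bar>r\<bar> \<le> 1" for r
        using q[of "Suc k" r] Suc.prems that by simp
    qed (use Suc.prems \<delta> \<delta>0 \<phi>0 \<phi>1 \<phi> sym sign_field_kernel_bound[OF D0] gg in auto)
    moreover have "\<pi> * (\<pi> ^ k - k * \<xi>) \<le> \<pi> * P (Suc k)"
      using Suc \<pi> by (intro mult_left_mono) auto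
    moreover have "\<pi> * (k * \<xi>) \<le> 1 * (k * \<xi>)"
      using \<pi> \<xi> by (intro mult_right_mono) auto
    moreover have "3 * Suc k * \<tau> + e \<le> \<xi>"
      using Suc.prems \<tau> unfolding \<xi>_def by (intro add_mono mult_right_mono) auto
    ultimately show ?case
      by (simp add: algebra_simps)
  qed
  have "P N = 0"
  proof -
    have "replica_avg X (gibbs t w) N (\<lambda>z. of_bool (mutually_negative K \<delta> N z)) = replica_avg X (gibbs t w) N (\<lambda>_. 0)" for w
    proof (intro replica_avg_cong)
      fix z assume "z \<in> PiE {..<N} (\<lambda>_. X)"
      then have "\<not> mutually_negative K \<delta> N z"
        using N by (intro mutually_negative_impossible[OF D0]) auto
      then show "of_bool (mutually_negative K \<delta> N z) = (0 :: real)"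
        by simp
    qed
    then show ?thesis
      by (simp add: P_def replica_avg_const[OF prob_gibbs])
  qed
  then have "\<pi> ^ (N - 1) \<le> real (N - 1) * \<xi>"
    using P[of "N - 1"] N by simp
  also have "\<dots> \<le> N * \<xi>"
    using \<xi> by (intro mult_right_mono) auto
  finally show ?thesis
    by (simp add: \<pi>_def \<xi>_def)
qed

end

section \<open>Averaging over the coupling strengths\<close>

lemma sign_field_prod:
  assumes "sign_field X C D" "sign_field X C' D'"
  shows "sign_field X (\<lambda>x y. C x y * C' x y) (map_pmf (\<lambda>(a, b) x. a x = b x) (pair_pmf D D'))"
proof -
  have sgn: "bool_sign (a = b) = bool_sign a * bool_sign b" for a b
    by (simp add: bool_sign_def)
  have fin: "finite (set_pmf D)" "finite (set_pmf D')"
    using assms by (auto simp: sign_field_def)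
  have cov: "bool_sign (a x = b x) * bool_sign (a y = b y) =
      (bool_sign (a x) * bool_sign (a y)) * (bool_sign (b x) * bool_sign (b y))" for a b :: "'a \<Rightarrow> bool" and x y
    by (simp add: sgn)
  have "expect D (\<lambda>s. bool_sign (s x)) = 0" "expect D' (\<lambda>s. bool_sign (s x)) = 0" if "x \<in> X" for x
    using assms that by (auto simp: sign_field_def)
  moreover have "expect D (\<lambda>s. bool_sign (s x) * bool_sign (s y)) = C x y"
    "expect D' (\<lambda>s. bool_sign (s x) * bool_sign (s y)) = C' x y" if "x \<in> X" "y \<in> X" for x y
    using assms that by (auto simp: sign_field_def)
  ultimately show ?thesis
    unfolding sign_field_def
    by (simp add: fin case_prod_unfold expect_pair cov) (simp add: sgn)
qed

text \<open>
  The product of \<open>j + 1\<close> independent copies of a field, signs being multiplied by comparing booleans.  The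
  powers start at one because the constant field, of covariance \<open>1\<close>, does not have mean zero.
\<close>
primrec field_power :: "('a \<Rightarrow> bool) pmf \<Rightarrow> nat \<Rightarrow> ('a \<Rightarrow> bool) pmf" where
  "field_power D 0 = D"
| "field_power D (Suc j) = map_pmf (\<lambda>(a, b) x. a x = b x) (pair_pmf D (field_power D j))"

lemma sign_field_power:
  assumes "sign_field X C D"
  shows "sign_field X (\<lambda>x y. C x y ^ Suc j) (field_power D j)"
proof (induction j)
  case 0
  then show ?case
    using assms by simp
next
  case (Suc j)
  then show ?case
    using sign_field_prod[OF assms Suc] by simp
qed

lemma simultaneous_polynomial_approximation:
  fixes \<phi> :: "nat \<Rightarrow> real \<Rightarrow> real"
  assumes \<tau>: "0 < \<tau>" and \<phi>: "\<And>n. continuous_on {-1..1} (\<phi> n)"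
  shows "\<exists>d b. \<forall>n<N. \<forall>r. \<bar>r\<bar> \<le> 1 \<longrightarrow> \<bar>\<phi> n r - (\<Sum>j\<le>d. b n j * r ^ j)\<bar> \<le> \<tau>"
proof -
  have "\<exists>D a. \<forall>r\<in>{-1..1}. \<bar>\<phi> n r - (\<Sum>j\<le>D. a j * r ^ j)\<bar> < \<tau>" for n
  proof -
    obtain g where g: "real_polynomial_function g" "\<And>r. r \<in> {-1..1} \<Longrightarrow> \<bar>\<phi> n r - g r\<bar> < \<tau>"
      using Stone_Weierstrass_real_polynomial_function[OF _ \<phi> \<tau>] by (metis compact_Icc)
    then obtain a D where "g = (\<lambda>r. \<Sum>j\<le>D. a j * r ^ j)"
      unfolding real_polynomial_function_iff_sum by blast
    then show ?thesis
      using g(2) by (intro exI[of _ D] exI[of _ a]) auto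
  qed
  then obtain D a where Da: "\<And>n r. r \<in> {-1..1} \<Longrightarrow> \<bar>\<phi> n r - (\<Sum>j\<le>D n. a n j * r ^ j)\<bar> < \<tau>"
    by metis
  define d where "d = (\<Sum>n<N. D n)"
  define b where "b n j = (if j \<le> D n then a n j else 0)" for n j
  have "\<bar>\<phi> n r - (\<Sum>j\<le>d. b n j * r ^ j)\<bar> \<le> \<tau>" if "n < N" "\<bar>r\<bar> \<le> 1" for n r
  proof -
    have "D n \<le> d"
      unfolding d_def using that by (intro member_le_sum) auto
    then have "(\<Sum>j\<le>d. b n j * r ^ j) = (\<Sum>j\<le>D n. a n j * r ^ j)"
      by (intro sum.mono_neutral_cong_right) (auto simp: b_def)
    then show ?thesis
      using Da[of r n] that by (simp add: abs_le_iff less_imp_le)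
  qed
  then show ?thesis
    by blast
qed

text \<open>
  For each \<open>j\<close> from \<open>1\<close> to \<open>d\<close> there is a block of \<open>k\<close> independent fields of covariance \<open>K\<^sup>j\<close>; \<open>N\<close> bounds the
  number of replicas considered.
\<close>
locale power_fields =
  fixes X :: "'a set" and \<mu> :: "'a \<Rightarrow> real" and K :: "'a \<Rightarrow> 'a \<Rightarrow> real"
    and D0 :: "('a \<Rightarrow> bool) pmf" and d k :: nat and \<eta> :: real and m N :: nat
  assumes \<mu>: "prob_vector X \<mu>" and D0: "sign_field X K D0"
    and k: "k \<ge> 1" and m: "m \<ge> 1" and N: "N \<ge> 1"
    and \<eta>: "0 < \<eta>" "\<eta> * (3 * real m) \<le> 1/2" "2 * real N * (\<eta> * (2 * real m)) \<le> 1"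
begin

sublocale disorder X \<mu> "{1..d} \<times> {..<k}" "\<lambda>i. field_power D0 (fst i - 1)" "\<lambda>i x y. K x y ^ fst i"
proof
  fix i :: "nat \<times> nat"
  show "i \<in> {1..d} \<times> {..<k} \<Longrightarrow> sign_field X (\<lambda>x y. K x y ^ fst i) (field_power D0 (fst i - 1))"
  proof -
    assume i: "i \<in> {1..d} \<times> {..<k}"
    then have "Suc (fst i - 1) = fst i"
      by auto
    then show ?thesis
      using sign_field_power[OF D0, of "fst i - 1"] by simp
  qed
qed (use \<mu> in auto)

text \<open>
  The value outside of the index set is \<open>0\<close> so that changing the coefficient of one block is exactly an
  update of \<open>u\<close>.
\<close>
definition coupling :: "(nat \<Rightarrow> nat) \<Rightarrow> nat \<times> nat \<Rightarrow> real" where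
  "coupling u i = (if snd i < k then \<eta> * real (u (fst i)) else 0)"

definition slope :: "nat \<Rightarrow> (nat \<Rightarrow> nat) \<Rightarrow> real" where
  "slope j u = expect law (free_energy (coupling (u(j := Suc (u j))))) - expect law (free_energy (coupling u))"

definition deviation :: "nat \<Rightarrow> (nat \<Rightarrow> nat) \<Rightarrow> real" where
  "deviation j u = expect law (\<lambda>w. \<Sum>x\<in>X. gibbs (coupling u) w x * \<bar>block_energy ({j} \<times> {..<k}) \<eta> w x - slope j u\<bar>)"

definition params :: "(nat \<Rightarrow> nat) pmf" where
  "params = Pi_pmf {1..d} 0 (\<lambda>_. pmf_of_set {m..<2*m})"

lemma finite_params: "finite (set_pmf params)"
  unfolding params_def using m by (intro finite_set_Pi_pmf) auto

lemma params_range: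
  assumes "u \<in> set_pmf params" "j \<in> {1..d}"
  shows "m \<le> u j" "u j < 2 * m"
  using assms m by (auto simp: params_def set_Pi_pmf PiE_dflt_def)

lemma deviation_nonneg: "0 \<le> deviation j u"
  unfolding deviation_def using prob_vectorD(2)[OF prob_gibbs]
  by (intro Bochner_Integration.integral_nonneg sum_nonneg) auto

text \<open>
  Averaging over all of \<open>u\<close> can be done by first averaging over \<open>u j\<close> alone, which is the situation of a
  single block of varying strength.
\<close>
lemma deviation_average:
  assumes j: "j \<in> {1..d}"
  shows "expect params (deviation j) \<le> 2 + 2 * sqrt (16 * d * k * \<eta>\<^sup>2 * (real m)\<^sup>2) + 28 * (k * \<eta>\<^sup>2)"
    (is "_ \<le> ?c")
proof -
  let ?B = "{j} \<times> {..<k}"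
  have "(\<Sum>v\<in>{m..<2*m}. deviation j (u(j := v))) \<le> m * ?c" if u: "u \<in> set_pmf params" for u
  proof -
    have up: "(\<lambda>i. if i \<in> ?B then \<eta> * real v else coupling u i) = coupling (u(j := v))" for v
      by (auto simp: coupling_def)
    have "(\<Sum>v\<in>{m..<2*m}. expect law (\<lambda>w. \<Sum>x\<in>X. gibbs (\<lambda>i. if i \<in> ?B then \<eta> * real v else coupling u i) w x *
        \<bar>block_energy ?B \<eta> w x - (expect law (free_energy (\<lambda>i. if i \<in> ?B then \<eta> * real (Suc v) else coupling u i))
          - expect law (free_energy (\<lambda>i. if i \<in> ?B then \<eta> * real v else coupling u i)))\<bar>))
      \<le> m * (2 + 2 * sqrt (16 * d * k * \<eta>\<^sup>2 * (real m)\<^sup>2) + 28 * (card ?B * \<eta>\<^sup>2))"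
    proof (rule block_concentration)
      fix i assume "i \<in> {1..d} \<times> {..<k}"
      then have "\<eta> * real (u (fst i)) \<le> \<eta> * (3 * real m)"
        using params_range(2)[OF u, of "fst i"] \<eta> by (intro mult_left_mono) auto
      then have "\<eta> * real (u (fst i)) \<le> 1/2"
        using \<eta>(2) by linarith
      then show "0 \<le> coupling u i \<and> coupling u i \<le> 1/2"
        using \<eta>(1) by (auto simp: coupling_def)
    next
      fix v assume v: "v \<le> 2 * m"
      have "(\<Sum>i\<in>{1..d} \<times> {..<k}. (2 * (if i \<in> ?B then \<eta> * real v else coupling u i))\<^sup>2)
          \<le> (\<Sum>i\<in>{1..d} \<times> {..<k}. (4 * \<eta> * m)\<^sup>2)"
      proof (intro sum_mono power_mono)
        fix i assume "i \<in> {1..d} \<times> {..<k}"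
        then have "\<eta> * real ((u(j := v)) (fst i)) \<le> \<eta> * (2 * real m)"
          using params_range(2)[OF u, of "fst i"] \<eta> v by (intro mult_left_mono) auto
        then show "2 * (if i \<in> ?B then \<eta> * real v else coupling u i) \<le> 4 * \<eta> * m"
          unfolding up[THEN fun_cong] using \<eta> by (auto simp: coupling_def simp del: fun_upd_apply)
        show "0 \<le> 2 * (if i \<in> ?B then \<eta> * real v else coupling u i)"
          using \<eta> by (auto simp: coupling_def)
      qed
      then show "(\<Sum>i\<in>{1..d} \<times> {..<k}. (2 * (if i \<in> ?B then \<eta> * real v else coupling u i))\<^sup>2)
          \<le> 16 * d * k * \<eta>\<^sup>2 * (real m)\<^sup>2"
        by (simp add: power_mult_distrib mult_ac)
    qed (use j m \<eta> in auto)
    then show ?thesis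
      unfolding up by (simp add: deviation_def slope_def)
  qed
  then have avg: "expect (pmf_of_set {m..<2*m}) (\<lambda>v. deviation j (u(j := v))) \<le> ?c" if "u \<in> set_pmf params" for u
    using that m by (simp add: integral_pmf_of_set divide_le_eq mult.commute)
  have "expect params (deviation j) = expect params (\<lambda>u. expect (pmf_of_set {m..<2*m}) (\<lambda>v. deviation j (u(j := v))))"
    unfolding params_def using j m by (intro expect_Pi_resample) auto
  also have "\<dots> \<le> expect params (\<lambda>_. ?c)"
    using avg by (intro expect_mono finite_params)
  finally show ?thesis
    by simp
qed

definition gg_error :: "nat \<Rightarrow> (nat \<Rightarrow> nat) \<Rightarrow> real" where
  "gg_error j u = 2 * deviation j u / (k * \<eta>\<^sup>2 * m) + 72 * (real N)\<^sup>2 * (\<eta> * m)"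

lemma gg_error_nonneg: "0 \<le> gg_error j u"
  using \<eta> deviation_nonneg by (auto simp: gg_error_def intro!: add_nonneg_nonneg)

lemma power_ghirlanda_guerra:
  assumes u: "u \<in> set_pmf params" and j: "j \<in> {1..d}" and n: "n \<le> N" and l: "l < n"
    and f: "\<And>z. z \<in> PiE {..<n} (\<lambda>_. X) \<Longrightarrow> \<bar>f z\<bar> \<le> 1"
  shows "\<bar>expect law (\<lambda>w. replica_avg X (gibbs (coupling u) w) n
        (\<lambda>z. f z * excess_overlap X (gibbs (coupling u) w) n l (\<lambda>x y. K x y ^ j) z))
      - expect law (\<lambda>w. replica_avg X (gibbs (coupling u) w) n f)
        * expect law (\<lambda>w. pair_avg X (gibbs (coupling u) w) (\<lambda>x y. K x y ^ j))\<bar> \<le> gg_error j u"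
    (is "?L \<le> _")
proof -
  let ?B = "{j} \<times> {..<k}"
  have uj: "m \<le> u j" "u j \<le> 2 * m"
    using params_range[OF u j] by auto
  have S: "0 < k * \<eta>\<^sup>2"
    using k \<eta> by simp
  have "2 * real n * (\<eta> * u j) \<le> 2 * real N * (\<eta> * (2 * real m))"
    using n uj \<eta> by (intro mult_mono) auto
  then have small: "2 * real n * (\<eta> * u j) \<le> 1"
    using \<eta>(3) by linarith
  have "?L \<le> 2 * deviation j u / (card ?B * \<eta>\<^sup>2 * real (u j)) + 36 * (real n)\<^sup>2 * (\<eta> * real (u j))"
    unfolding deviation_def using j k m uj \<eta>(1) l
    by (intro ghirlanda_guerra small f) (auto simp: coupling_def lessThan_empty_iff)
  also have "\<dots> \<le> 2 * deviation j u / (k * \<eta>\<^sup>2 * m) + 36 * (real N)\<^sup>2 * (\<eta> * (2 * real m))"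
  proof (rule add_mono)
    have "0 < card ?B * \<eta>\<^sup>2 * real (u j) * (real k * \<eta>\<^sup>2 * real m)"
      using S uj m by simp
    moreover have "real k * \<eta>\<^sup>2 * real m \<le> card ?B * \<eta>\<^sup>2 * real (u j)"
      using uj S by (simp add: mult_left_mono)
    ultimately show "2 * deviation j u / (card ?B * \<eta>\<^sup>2 * real (u j)) \<le> 2 * deviation j u / (k * \<eta>\<^sup>2 * m)"
      using deviation_nonneg by (intro divide_left_mono) auto
    show "36 * (real n)\<^sup>2 * (\<eta> * real (u j)) \<le> 36 * (real N)\<^sup>2 * (\<eta> * (2 * real m))"
      using uj \<eta>(1) n by (intro mult_mono power_mono) auto
  qed
  finally show ?thesis
    by (simp add: gg_error_def)
qed

lemma negative_pairs_rare_at: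
  fixes \<delta> :: "nat \<Rightarrow> real" and b :: "nat \<Rightarrow> nat \<Rightarrow> real" and \<tau> \<beta> :: real
  assumes u: "u \<in> set_pmf params" and N\<delta>: "real (N - 1) * \<delta> N > 1"
    and \<delta>: "\<And>n. \<delta> (Suc n) \<le> \<delta> n"
    and \<phi>0: "\<And>n r. r \<le> - \<delta> n \<Longrightarrow> \<phi> n r = 0" and \<phi>1: "\<And>n r. r > - \<delta> (Suc n) \<Longrightarrow> \<phi> n r = 1"
    and \<phi>: "\<And>n r. 0 \<le> \<phi> n r \<and> \<phi> n r \<le> 1"
    and b: "\<And>n r. n < N \<Longrightarrow> \<bar>r\<bar> \<le> 1 \<Longrightarrow> \<bar>\<phi> n r - (\<Sum>j\<le>d. b n j * r ^ j)\<bar> \<le> \<tau>"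
    and \<beta>: "\<And>n j. n < N \<Longrightarrow> j \<in> {1..d} \<Longrightarrow> \<bar>b n j\<bar> \<le> \<beta>" "0 \<le> \<beta>" and \<tau>: "0 \<le> \<tau>"
  shows "expect law (\<lambda>w. pair_avg X (gibbs (coupling u) w) (\<lambda>x y. of_bool (K x y \<le> - \<delta> 0))) ^ (N - 1)
    \<le> N * (3 * N * \<tau> + \<beta> * (\<Sum>j\<in>{1..d}. gg_error j u))"
proof (rule negative_pairs_rare[OF D0 N N\<delta> \<delta> \<phi>0 \<phi>1 \<phi> b])
  fix n l assume n: "n < N" and l: "l < n"
  have "\<bar>expect law (\<lambda>w. replica_avg X (gibbs (coupling u) w) n
        (\<lambda>z. of_bool (mutually_negative K \<delta> n z) * excess_overlap X (gibbs (coupling u) w) n l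
          (\<lambda>x y. \<Sum>j\<le>d. b n j * K x y ^ j) z))
      - expect law (\<lambda>w. replica_avg X (gibbs (coupling u) w) n (\<lambda>z. of_bool (mutually_negative K \<delta> n z)))
        * expect law (\<lambda>w. pair_avg X (gibbs (coupling u) w) (\<lambda>x y. \<Sum>j\<le>d. b n j * K x y ^ j))\<bar>
    \<le> (\<Sum>j\<in>{1..d}. \<bar>b n j\<bar> * gg_error j u)"
    using n l by (intro polynomial_ghirlanda_guerra power_ghirlanda_guerra u) auto
  also have "\<dots> \<le> (\<Sum>j\<in>{1..d}. \<beta> * gg_error j u)"
    using \<beta>(1)[OF n] gg_error_nonneg by (intro sum_mono mult_right_mono) auto
  finally show "\<bar>expect law (\<lambda>w. replica_avg X (gibbs (coupling u) w) n
        (\<lambda>z. of_bool (mutually_negative K \<delta> n z) * excess_overlap X (gibbs (coupling u) w) n l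
          (\<lambda>x y. \<Sum>j\<le>d. b n j * K x y ^ j) z))
      - expect law (\<lambda>w. replica_avg X (gibbs (coupling u) w) n (\<lambda>z. of_bool (mutually_negative K \<delta> n z)))
        * expect law (\<lambda>w. pair_avg X (gibbs (coupling u) w) (\<lambda>x y. \<Sum>j\<le>d. b n j * K x y ^ j))\<bar>
    \<le> \<beta> * (\<Sum>j\<in>{1..d}. gg_error j u)"
    by (simp add: sum_distrib_left)
qed (use \<tau> \<beta>(2) gg_error_nonneg in \<open>auto intro!: mult_nonneg_nonneg sum_nonneg\<close>)

end

section \<open>Positivity for finitely many points\<close>

text \<open>
  The error terms are of order \<open>1/m\<close>, from concentration, and \<open>m\<^sup>2/\<kappa>\<close>, from the discreteness of the signs, so
  \<open>m\<close> is chosen first and \<open>\<kappa>\<close>, the square root of the size of the blocks, second.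
\<close>
lemma choose_scales:
  fixes W A \<epsilon> :: real and N :: nat
  assumes "0 \<le> W" "0 \<le> A" "0 < \<epsilon>"
  shows "\<exists>m \<kappa> :: nat. 1 \<le> m \<and> 1 \<le> \<kappa> \<and> (m / \<kappa>) * (3 * real m) \<le> 1/2 \<and> 2 * real N * ((m / \<kappa>) * (2 * real m)) \<le> 1
    \<and> W * (A / m + 72 * (real N)\<^sup>2 * ((m / \<kappa>) * m)) \<le> \<epsilon> / 4"
proof -
  obtain m0 :: nat where m0: "8 * W * A / \<epsilon> \<le> m0"
    using real_arch_simple by blast
  define m where "m = Suc m0"
  have m: "1 \<le> m" "8 * W * A / \<epsilon> \<le> m"
    using m0 by (auto simp: m_def)
  define Y where "Y = 8 * W * (72 * (real N)\<^sup>2 * (real m)\<^sup>2) / \<epsilon> + 6 * (real m)\<^sup>2 + 4 * real N * (real m)\<^sup>2"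
  obtain k0 :: nat where k0: "Y \<le> k0"
    using real_arch_simple by blast
  define \<kappa> where "\<kappa> = Suc k0"
  have \<kappa>: "1 \<le> \<kappa>" "Y \<le> \<kappa>"
    using k0 by (auto simp: \<kappa>_def)
  have parts: "0 \<le> 8 * W * (72 * (real N)\<^sup>2 * (real m)\<^sup>2) / \<epsilon>" "0 \<le> 6 * (real m)\<^sup>2" "0 \<le> 4 * real N * (real m)\<^sup>2"
    using assms by auto
  have \<kappa>1: "8 * W * (72 * (real N)\<^sup>2 * (real m)\<^sup>2) / \<epsilon> \<le> \<kappa>" and \<kappa>2: "6 * (real m)\<^sup>2 \<le> \<kappa>"
    and \<kappa>3: "4 * real N * (real m)\<^sup>2 \<le> \<kappa>"
    using \<kappa>(2) parts unfolding Y_def by linarith+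
  have pos: "0 < real \<kappa>" "0 < real m"
    using \<kappa>(1) m(1) by auto
  have "(m / \<kappa>) * (3 * real m) \<le> 1/2"
    using \<kappa>2 pos by (simp add: field_simps power2_eq_square)
  moreover have "2 * real N * ((m / \<kappa>) * (2 * real m)) \<le> 1"
    using \<kappa>3 pos by (simp add: field_simps power2_eq_square)
  moreover have "W * (A / m) \<le> \<epsilon> / 8"
    using m(2) pos assms by (simp add: field_simps)
  moreover have "W * (72 * (real N)\<^sup>2 * ((m / \<kappa>) * m)) \<le> \<epsilon> / 8"
    using \<kappa>1 pos assms by (simp add: field_simps power2_eq_square)
  ultimately have "W * (A / m + 72 * (real N)\<^sup>2 * ((m / \<kappa>) * m)) \<le> \<epsilon> / 4"
    unfolding distrib_left by linarith
  with \<open>(m / \<kappa>) * (3 * real m) \<le> 1/2\<close> \<open>2 * real N * ((m / \<kappa>) * (2 * real m)) \<le> 1\<close>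
  show ?thesis
    using m(1) \<kappa>(1) by blast
qed

text \<open>
  One law of \<open>G\<close>, bounded independently of \<open>X\<close> and \<open>K\<close>, serves all probability vectors \<open>\<mu>\<close>.  The
  parameters are chosen in the order \<open>N\<close>, accuracy \<open>\<tau>\<close> and degree \<open>d\<close> of the polynomials, \<open>m\<close>, and
  finally the number \<open>k = \<kappa>\<^sup>2\<close> of fields in a block, with \<open>\<eta> = m/\<kappa>\<close>; then \<open>k \<eta>\<^sup>2 = m\<^sup>2\<close>.
\<close>
theorem negative_pairs_rarely_survive:
  fixes \<epsilon> \<delta> :: real
  assumes \<epsilon>: "0 < \<epsilon>" and \<delta>: "0 < \<delta>"
  shows "\<exists>V\<ge>0. \<forall>(X :: 'a set) K D0. sign_field X K D0 \<longrightarrow>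
    (\<exists>R :: ('a \<Rightarrow> real) pmf. finite (set_pmf R) \<and> (\<forall>G\<in>set_pmf R. \<forall>x. \<bar>G x\<bar> \<le> V) \<and>
      (\<forall>\<mu>. prob_vector X \<mu> \<longrightarrow> expect R (\<lambda>G. pair_avg X (tilt X \<mu> G) (\<lambda>x y. of_bool (K x y \<le> - \<delta>))) \<le> \<epsilon>))"
proof -
  \<comment> \<open>Thresholds strictly decreasing from \<open>\<delta>\<close>, all above \<open>\<delta>/2\<close>.\<close>
  define th where "th n = \<delta> / 2 * (1 + 1 / real (Suc n))" for n
  have th0: "th 0 = \<delta>"
    by (simp add: th_def)
  have th_lower: "\<delta> / 2 \<le> th n" for n
    using \<delta> by (simp add: th_def)
  have th_Suc: "th (Suc n) < th n" for n
    using \<delta> by (simp add: th_def field_simps)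
  obtain N0 :: nat where N0: "2 / \<delta> < N0"
    using reals_Archimedean2 by blast
  define N where "N = Suc (Suc N0)"
  have N: "N \<ge> 1"
    by (simp add: N_def)
  have N\<delta>: "real (N - 1) * th N > 1"
  proof -
    have "1 < real N0 * (\<delta> / 2)"
      using N0 \<delta> by (simp add: field_simps)
    also have "\<dots> \<le> real (N - 1) * th N"
      using th_lower \<delta> by (intro mult_mono) (auto simp: N_def)
    finally show ?thesis .
  qed
  \<comment> \<open>By Markov's inequality for the power \<open>N - 1\<close>, a bound on the mean of \<open>\<pi> u ^ (N - 1)\<close> controls the mean of \<open>\<pi> u\<close>.\<close>
  define M where "M = (2 / \<epsilon>) ^ (N - 1) * N"
  have M: "0 < M"
    using \<epsilon> N by (simp add: M_def)
  define \<tau> where "\<tau> = \<epsilon> / (12 * M * N)"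
  have \<tau>: "0 < \<tau>"
    using \<epsilon> M N by (simp add: \<tau>_def)
  define \<phi> where "\<phi> n r = max 0 (min 1 ((r + th n) / (th n - th (Suc n))))" for n r
  have \<phi>01: "0 \<le> \<phi> n r \<and> \<phi> n r \<le> 1" for n r
    by (simp add: \<phi>_def)
  have \<phi>0: "\<phi> n r = 0" if "r \<le> - th n" for n r
  proof -
    have "(r + th n) / (th n - th (Suc n)) \<le> 0"
      using that th_Suc[of n] by (intro divide_nonpos_pos) auto
    then show ?thesis
      by (simp add: \<phi>_def)
  qed
  have \<phi>1: "\<phi> n r = 1" if "r > - th (Suc n)" for n r
  proof -
    have "1 \<le> (r + th n) / (th n - th (Suc n))"
      using that th_Suc[of n] by simp
    then show ?thesis
      by (simp add: \<phi>_def)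
  qed
  have "continuous_on {-1..1} (\<phi> n)" for n
    unfolding \<phi>_def using th_Suc[of n] by (intro continuous_intros) auto
  from simultaneous_polynomial_approximation[of \<tau> \<phi> N, OF \<tau> this]
  obtain d :: nat and b :: "nat \<Rightarrow> nat \<Rightarrow> real"
    where b_all: "\<forall>n<N. \<forall>r. \<bar>r\<bar> \<le> 1 \<longrightarrow> \<bar>\<phi> n r - (\<Sum>j\<le>d. b n j * r ^ j)\<bar> \<le> \<tau>"
    by blast
  then have b: "\<bar>\<phi> n r - (\<Sum>j\<le>d. b n j * r ^ j)\<bar> \<le> \<tau>" if "n < N" "\<bar>r\<bar> \<le> 1" for n r
    using that by blast
  define \<beta> where "\<beta> = (\<Sum>n<N. \<Sum>j\<in>{1..d}. \<bar>b n j\<bar>)"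
  have \<beta>: "\<bar>b n j\<bar> \<le> \<beta>" if "n < N" "j \<in> {1..d}" for n j
  proof -
    have "\<bar>b n j\<bar> \<le> (\<Sum>j\<in>{1..d}. \<bar>b n j\<bar>)"
      using that by (intro member_le_sum) auto
    also have "\<dots> \<le> \<beta>"
      unfolding \<beta>_def using that by (intro member_le_sum) (auto intro: sum_nonneg)
    finally show ?thesis .
  qed
  have \<beta>0: "0 \<le> \<beta>"
    by (auto simp: \<beta>_def intro!: sum_nonneg)
  obtain m \<kappa> :: nat where m: "1 \<le> m" and \<kappa>: "1 \<le> \<kappa>"
    and small: "(m / \<kappa>) * (3 * real m) \<le> 1/2" "2 * real N * ((m / \<kappa>) * (2 * real m)) \<le> 1"
    and final: "M * \<beta> * d * ((60 + 16 * sqrt d) / m + 72 * (real N)\<^sup>2 * ((m / \<kappa>) * m)) \<le> \<epsilon> / 4"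
    using choose_scales[of "M * \<beta> * d" "60 + 16 * sqrt d" \<epsilon> N] M \<beta>0 \<epsilon> by auto
  define k where "k = \<kappa>\<^sup>2"
  define \<eta> where "\<eta> = m / \<kappa>"
  have k: "k \<ge> 1" and \<eta>: "0 < \<eta>"
    using m \<kappa> by (auto simp: k_def \<eta>_def)
  have k\<eta>: "k * \<eta>\<^sup>2 = (real m)\<^sup>2"
    using \<kappa> by (simp add: k_def \<eta>_def power_divide)
  \<comment> \<open>There are \<open>d k\<close> signs, each with a coefficient below \<open>2 m \<eta>\<close>.\<close>
  define V where "V = d * k * (\<eta> * (2 * real m))"
  have V: "0 \<le> V"
    using \<eta> by (simp add: V_def)
  have "\<exists>R :: ('a \<Rightarrow> real) pmf. finite (set_pmf R) \<and> (\<forall>G\<in>set_pmf R. \<forall>x. \<bar>G x\<bar> \<le> V) \<and>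
      (\<forall>\<mu>. prob_vector X \<mu> \<longrightarrow> expect R (\<lambda>G. pair_avg X (tilt X \<mu> G) (\<lambda>x y. of_bool (K x y \<le> - \<delta>))) \<le> \<epsilon>)"
    if D0: "sign_field X K D0" for X :: "'a set" and K D0
  proof (cases "\<exists>\<mu>. prob_vector X \<mu>")
    case False
    then show ?thesis
      using V by (intro exI[of _ "return_pmf (\<lambda>_. 0)"]) auto
  next
    case True
    then obtain \<mu>0 where \<mu>0: "prob_vector X \<mu>0"
      by blast
    have pf: "power_fields X \<mu> K D0 k \<eta> m N" if "prob_vector X \<mu>" for \<mu>
      using that D0 k m N \<eta> small by unfold_locales (auto simp: \<eta>_def)
    interpret P0: power_fields X \<mu>0 K D0 d k \<eta> m N
      by (rule pf[OF \<mu>0])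
    note One_nat_def [simp del]
    define R where "R = map_pmf (\<lambda>(w, u). P0.energy (P0.coupling u) w) (pair_pmf P0.law P0.params)"
    have finR: "finite (set_pmf R)"
      unfolding R_def set_map_pmf set_pair_pmf
      by (intro finite_imageI finite_cartesian_product P0.finite_law P0.finite_params)
    moreover have "\<bar>G x\<bar> \<le> V" if GR: "G \<in> set_pmf R" for G x
    proof -
      obtain w u where G: "G = P0.energy (P0.coupling u) w" and u: "u \<in> set_pmf P0.params"
        using GR unfolding R_def by auto
      have "\<bar>G x\<bar> \<le> (\<Sum>i\<in>{1..d} \<times> {..<k}. \<eta> * (2 * real m))"
        unfolding G P0.energy_def
      proof (intro order.trans[OF sum_abs] sum_mono)
        fix i assume i: "i \<in> {1..d} \<times> {..<k}"
        then have "\<eta> * real (u (fst i)) \<le> \<eta> * (2 * real m)"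
          using P0.params_range(2)[OF u, of "fst i"] \<eta> by (intro mult_left_mono) auto
        then show "\<bar>P0.coupling u i * bool_sign (w i x)\<bar> \<le> \<eta> * (2 * real m)"
          using i \<eta> by (auto simp: P0.coupling_def abs_mult)
      qed
      then show ?thesis
        by (simp add: V_def)
    qed
    moreover have "expect R (\<lambda>G. pair_avg X (tilt X \<mu> G) (\<lambda>x y. of_bool (K x y \<le> - \<delta>))) \<le> \<epsilon>"
      if \<mu>: "prob_vector X \<mu>" for \<mu>
    proof -
      interpret P: power_fields X \<mu> K D0 d k \<eta> m N
        by (rule pf[OF \<mu>])
      define \<pi> where "\<pi> u = expect P.law (\<lambda>w. pair_avg X (P.gibbs (P.coupling u) w) (\<lambda>x y. of_bool (K x y \<le> - th 0)))" for u
      have \<pi>0: "0 \<le> \<pi> u" for u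
        unfolding \<pi>_def using prob_vectorD(2)[OF P.prob_gibbs]
        by (auto intro!: Bochner_Integration.integral_nonneg sum_nonneg mult_nonneg_nonneg simp: pair_avg_def)
      have \<pi>1: "\<pi> u \<le> 1" for u
      proof -
        have "\<pi> u \<le> expect P.law (\<lambda>w. pair_avg X (P.gibbs (P.coupling u) w) (\<lambda>x y. 1))"
          unfolding \<pi>_def by (intro expect_mono P.finite_law pair_avg_mono P.prob_gibbs) auto
        then show ?thesis
          by (simp add: pair_avg_const[OF P.prob_gibbs])
      qed
      have "expect R (\<lambda>G. pair_avg X (tilt X \<mu> G) (\<lambda>x y. of_bool (K x y \<le> - \<delta>))) = expect P.params \<pi>"
        unfolding R_def \<pi>_def[abs_def] P.gibbs_def th0
        by (simp add: case_prod_unfold expect_pair P.finite_law P.finite_params)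
      also have "\<dots> \<le> expect P.params (\<lambda>u. \<epsilon> / 2 + M * (3 * N * \<tau> + \<beta> * (\<Sum>j\<in>{1..d}. P.gg_error j u)))"
      proof (intro expect_mono P.finite_params)
        fix u assume u: "u \<in> set_pmf P.params"
        have "\<pi> u ^ (N - 1) \<le> N * (3 * N * \<tau> + \<beta> * (\<Sum>j\<in>{1..d}. P.gg_error j u))"
          unfolding \<pi>_def
          by (rule P.negative_pairs_rare_at[where \<delta> = th and \<phi> = \<phi> and b = b, OF u N\<delta>])
            (use \<tau> \<beta>0 less_imp_le[OF th_Suc] \<phi>0 \<phi>1 \<phi>01 b \<beta> in auto)
        then have "(2 / \<epsilon>) ^ (N - 1) * \<pi> u ^ (N - 1)
            \<le> (2 / \<epsilon>) ^ (N - 1) * (N * (3 * N * \<tau> + \<beta> * (\<Sum>j\<in>{1..d}. P.gg_error j u)))"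
          using \<epsilon> by (intro mult_left_mono) auto
        then have Mb: "(2 / \<epsilon> * \<pi> u) ^ (N - 1) \<le> M * (3 * N * \<tau> + \<beta> * (\<Sum>j\<in>{1..d}. P.gg_error j u))"
          by (simp only: M_def power_mult_distrib mult.assoc)
        have pw0: "0 \<le> (2 / \<epsilon> * \<pi> u) ^ (N - 1)"
          using \<epsilon> \<pi>0[of u] by simp
        show "\<pi> u \<le> \<epsilon> / 2 + M * (3 * N * \<tau> + \<beta> * (\<Sum>j\<in>{1..d}. P.gg_error j u))"
        proof (cases "\<pi> u \<le> \<epsilon> / 2")
          case True
          then show ?thesis
            using Mb pw0 by linarith
        next
          case False
          then have "1 \<le> (2 / \<epsilon> * \<pi> u) ^ (N - 1)"
            using \<epsilon> by (intro one_le_power) (simp add: field_simps)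
          then show ?thesis
            using Mb \<pi>1[of u] \<epsilon> by linarith
        qed
      qed
      also have "\<dots> = \<epsilon> / 2 + M * (3 * N * \<tau> + \<beta> * (\<Sum>j\<in>{1..d}. expect P.params (P.gg_error j)))"
        by (simp add: expect_add expect_sum P.finite_params)
      also have "\<dots> \<le> \<epsilon> / 2 + M * (3 * N * \<tau> + \<beta> * (\<Sum>j\<in>{1..d}. (60 + 16 * sqrt d) / m + 72 * (real N)\<^sup>2 * (\<eta> * m)))"
      proof (intro add_mono mult_left_mono sum_mono order.refl)
        fix j assume j: "j \<in> {1..d}"
        have "expect P.params (P.deviation j) \<le> 2 + 2 * sqrt (16 * d * k * \<eta>\<^sup>2 * (real m)\<^sup>2) + 28 * (k * \<eta>\<^sup>2)"
          by (rule P.deviation_average[OF j])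
        also have "16 * d * k * \<eta>\<^sup>2 * (real m)\<^sup>2 = real d * (4 * (real m)\<^sup>2)\<^sup>2"
          using k\<eta> by (simp add: mult_ac power2_eq_square)
        also have "sqrt (real d * (4 * (real m)\<^sup>2)\<^sup>2) = sqrt d * (4 * (real m)\<^sup>2)"
          by (simp only: real_sqrt_mult real_sqrt_abs) simp
        also have "2 + 2 * (sqrt d * (4 * (real m)\<^sup>2)) + 28 * (k * \<eta>\<^sup>2) \<le> (30 + 8 * sqrt d) * (real m)\<^sup>2"
          using m one_le_power[of "real m" 2] unfolding k\<eta> by (simp add: algebra_simps)
        finally have "2 * expect P.params (P.deviation j) / (k * \<eta>\<^sup>2 * m) \<le> 2 * ((30 + 8 * sqrt d) * (real m)\<^sup>2) / (k * \<eta>\<^sup>2 * m)"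
          using \<eta> by (intro divide_right_mono mult_left_mono) auto
        also have "\<dots> = (60 + 16 * sqrt d) / m"
          unfolding k\<eta> using m by (simp add: field_simps)
        finally show "expect P.params (P.gg_error j) \<le> (60 + 16 * sqrt d) / m + 72 * (real N)\<^sup>2 * (\<eta> * m)"
          by (simp add: P.gg_error_def[abs_def] expect_add P.finite_params)
      qed (use M \<beta>0 in auto)
      also have "\<dots> = \<epsilon> / 2 + M * (3 * N * \<tau>) +
          M * \<beta> * d * ((60 + 16 * sqrt d) / m + 72 * (real N)\<^sup>2 * ((m / \<kappa>) * m))"
        by (simp add: \<eta>_def distrib_left mult.assoc)
      also have "M * (3 * N * \<tau>) = \<epsilon> / 4"
        using M N by (simp add: \<tau>_def field_simps)
      finally show ?thesis
        using final by linarith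
    qed
    ultimately show ?thesis
      by blast
  qed
  then show ?thesis
    using V by blast
qed

section \<open>A sign field that detects negative scalar products\<close>

lemma expect_bind:
  fixes h :: "'v \<Rightarrow> 'b::{banach, second_countable_topology}"
  assumes "finite (set_pmf A)" "\<And>w. w \<in> set_pmf A \<Longrightarrow> finite (set_pmf (f w))"
  shows "expect (bind_pmf A f) h = expect A (\<lambda>w. expect (f w) h)"
proof -
  have "expect (bind_pmf A f) h = (\<Sum>w\<in>set_pmf A. pmf A w *\<^sub>R expect (f w) h)"
    using assms by (intro pmf_expectation_bind) auto
  also have "\<dots> = expect A (\<lambda>w. expect (f w) h)"
    using assms by (intro integral_measure_pmf[symmetric]) auto
  finally show ?thesis .
qed

text \<open>
  Given a bounded field \<open>s\<close>, the signs at different points are drawn independently with mean \<open>s\<close>.  This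
  preserves all covariances at distinct points and makes the variance equal to \<open>1\<close> everywhere, which
  the cancellation of the diagonal terms in the Ghirlanda-Guerra identities requires.
\<close>
lemma randomized_rounding:
  fixes s :: "'w \<Rightarrow> 'a \<Rightarrow> real"
  assumes X: "finite X" and \<Omega>: "finite (set_pmf \<Omega>)"
    and s: "\<And>w x. x \<in> X \<Longrightarrow> \<bar>s w x\<bar> \<le> 1"
    and mean: "\<And>x. x \<in> X \<Longrightarrow> expect \<Omega> (\<lambda>w. s w x) = 0"
  shows "\<exists>D. sign_field X (\<lambda>x y. if x = y then 1 else expect \<Omega> (\<lambda>w. s w x * s w y)) D"
proof -
  define B where "B w x = bernoulli_pmf ((1 + s w x) / 2)" for w x
  define P where "P w = Pi_pmf X False (B w)" for w
  define D where "D = bind_pmf \<Omega> P"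
  have finB: "finite (set_pmf (B w x))" for w x
    by (rule finite_subset[of _ UNIV]) auto
  have finP: "finite (set_pmf (P w))" for w
    unfolding P_def using X finB by (intro finite_set_Pi_pmf)
  have exD: "expect D h = expect \<Omega> (\<lambda>w. expect (P w) h)" for h :: "('a \<Rightarrow> bool) \<Rightarrow> real"
    unfolding D_def using \<Omega> finP by (rule expect_bind)
  have exB: "expect (B w x) bool_sign = s w x" if "x \<in> X" for w x
    using s[OF that, of w] by (simp add: B_def bool_sign_def abs_le_iff field_simps)
  have exP1: "expect (P w) (\<lambda>\<sigma>. bool_sign (\<sigma> x)) = s w x" if "x \<in> X" for w x
    unfolding P_def using X finB that by (subst expect_Pi_resample[of X x]) (simp_all add: exB)
  have exP2: "expect (P w) (\<lambda>\<sigma>. bool_sign (\<sigma> x) * bool_sign (\<sigma> y)) = s w x * s w y"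
    if "x \<in> X" "y \<in> X" "x \<noteq> y" for w x y
  proof -
    have "expect (P w) (\<lambda>\<sigma>. bool_sign (\<sigma> x) * bool_sign (\<sigma> y)) = expect (P w) (\<lambda>\<sigma>. s w x * bool_sign (\<sigma> y))"
      unfolding P_def using X finB that by (subst expect_Pi_resample[of X x]) (simp_all add: exB)
    then show ?thesis
      using that by (simp add: exP1)
  qed
  have "sign_field X (\<lambda>x y. if x = y then 1 else expect \<Omega> (\<lambda>w. s w x * s w y)) D"
    unfolding sign_field_def
  proof (intro conjI ballI)
    show "finite (set_pmf D)"
      using \<Omega> finP by (simp add: D_def)
    fix x assume x: "x \<in> X"
    show "expect D (\<lambda>\<sigma>. bool_sign (\<sigma> x)) = 0"
      using x by (simp add: exD exP1 mean)
    fix y assume y: "y \<in> X"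
    show "expect D (\<lambda>\<sigma>. bool_sign (\<sigma> x) * bool_sign (\<sigma> y)) = (if x = y then 1 else expect \<Omega> (\<lambda>w. s w x * s w y))"
      using x y by (simp add: exD exP2)
  qed
  then show ?thesis
    by blast
qed

text \<open>
  A Riesz product: with independent signs \<open>\<xi>\<^sub>i\<close> it is \<open>\<Prod>i<N. (1 + \<i> c \<xi>\<^sub>i x\<^sub>i)\<close>.  Its imaginary part
  is a substitute for \<open>c\<close> times the linear form \<open>\<Sum>i<N. \<xi>\<^sub>i x\<^sub>i\<close> that is bounded uniformly in \<open>N\<close>.
\<close>
definition riesz :: "nat \<Rightarrow> real \<Rightarrow> (nat \<Rightarrow> bool) \<Rightarrow> (nat \<Rightarrow> real) \<Rightarrow> complex" where
  "riesz N c w x = (\<Prod>i<N. Complex 1 (c * bool_sign (w i) * x i))"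

definition coin_flips :: "nat \<Rightarrow> (nat \<Rightarrow> bool) pmf" where
  "coin_flips N = Pi_pmf {..<N} False (\<lambda>_. bernoulli_pmf (1/2))"

lemma finite_coin_flips: "finite (set_pmf (coin_flips N))"
  unfolding coin_flips_def
  by (intro finite_set_Pi_pmf) (auto intro: finite_subset[of _ UNIV])

lemma expect_coin_prod:
  fixes f :: "nat \<Rightarrow> bool \<Rightarrow> complex"
  shows "expect (coin_flips N) (\<lambda>w. \<Prod>i<N. f i (w i)) = (\<Prod>i<N. (f i True + f i False) / 2)"
proof -
  have "expect (coin_flips N) (\<lambda>w. \<Prod>i<N. f i (w i)) = (\<Prod>i<N. expect (bernoulli_pmf (1/2)) (f i))"
    unfolding coin_flips_def by (intro expect_Pi_prod) (auto intro: finite_subset[of _ UNIV])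
  also have "\<dots> = (\<Prod>i<N. (f i True + f i False) / 2)"
  proof (intro prod.cong refl)
    fix i
    show "expect (bernoulli_pmf (1/2)) (f i) = (f i True + f i False) / 2"
      by (subst integral_measure_pmf[of UNIV]) (auto simp: UNIV_bool scaleR_conv_of_real field_simps)
  qed
  finally show ?thesis .
qed

lemma norm_riesz_le: "cmod (riesz N c w x) \<le> exp (c\<^sup>2 * (\<Sum>i<N. (x i)\<^sup>2) / 2)"
proof -
  have "cmod (riesz N c w x) = (\<Prod>i<N. sqrt (1 + (c * x i)\<^sup>2))"
    unfolding riesz_def prod_norm[symmetric]
    by (intro prod.cong refl) (auto simp: cmod_def bool_sign_def)
  also have "\<dots> \<le> (\<Prod>i<N. exp ((c * x i)\<^sup>2 / 2))"
  proof (intro prod_mono conjI)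
    fix i
    have "1 + (c * x i)\<^sup>2 \<le> exp ((c * x i)\<^sup>2)"
      by (rule exp_ge_add_one_self)
    also have "\<dots> = (exp ((c * x i)\<^sup>2 / 2))\<^sup>2"
      by (simp add: power2_eq_square flip: exp_add)
    finally show "sqrt (1 + (c * x i)\<^sup>2) \<le> exp ((c * x i)\<^sup>2 / 2)"
      by (intro real_le_lsqrt) auto
  qed simp
  also have "\<dots> = exp (c\<^sup>2 * (\<Sum>i<N. (x i)\<^sup>2) / 2)"
    by (simp add: exp_sum[symmetric] power_mult_distrib sum_distrib_left sum_divide_distrib)
  finally show ?thesis .
qed

lemma expect_Re:
  assumes "finite (set_pmf D)"
  shows "expect D (\<lambda>w. Re (f w)) = Re (expect D f)" "expect D (\<lambda>w. Im (f w)) = Im (expect D f)"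
  using assms by (auto intro!: integral_bounded_linear[OF bounded_linear_Re]
      integral_bounded_linear[OF bounded_linear_Im] integrable_measure_pmf_finite)

lemma riesz_mean: "expect (coin_flips N) (\<lambda>w. Im (riesz N c w x)) = 0"
proof -
  have "(Complex 1 (c * bool_sign True * x i) + Complex 1 (c * bool_sign False * x i)) / 2 = 1" for i
    by (simp add: bool_sign_def complex_eq_iff)
  then have "expect (coin_flips N) (\<lambda>w. riesz N c w x) = 1"
    unfolding riesz_def by (subst expect_coin_prod) simp
  then show ?thesis
    by (simp add: expect_Re finite_coin_flips)
qed

text \<open>
  The identity \<open>Im a * Im b = Re (a * cnj b - a * b) / 2\<close> reduces the covariance to two means of products
  over independent coordinates.
\<close>
lemma riesz_covariance:
  "expect (coin_flips N) (\<lambda>w. Im (riesz N c w x) * Im (riesz N c w y)) =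
    ((\<Prod>i<N. 1 + c\<^sup>2 * (x i * y i)) - (\<Prod>i<N. 1 - c\<^sup>2 * (x i * y i))) / 2"
proof -
  have "(Complex 1 (c * bool_sign True * x i) * cnj (Complex 1 (c * bool_sign True * y i)) +
      Complex 1 (c * bool_sign False * x i) * cnj (Complex 1 (c * bool_sign False * y i))) / 2
    = of_real (1 + c\<^sup>2 * (x i * y i))" for i
    by (simp add: bool_sign_def complex_eq_iff power2_eq_square)
  then have 1: "expect (coin_flips N) (\<lambda>w. riesz N c w x * cnj (riesz N c w y)) = of_real (\<Prod>i<N. 1 + c\<^sup>2 * (x i * y i))"
    unfolding riesz_def cnj_prod prod.distrib[symmetric] of_real_prod
    by (subst expect_coin_prod) (simp only:)
  have "(Complex 1 (c * bool_sign True * x i) * Complex 1 (c * bool_sign True * y i) +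
      Complex 1 (c * bool_sign False * x i) * Complex 1 (c * bool_sign False * y i)) / 2
    = of_real (1 - c\<^sup>2 * (x i * y i))" for i
    by (simp add: bool_sign_def complex_eq_iff power2_eq_square)
  then have 2: "expect (coin_flips N) (\<lambda>w. riesz N c w x * riesz N c w y) = of_real (\<Prod>i<N. 1 - c\<^sup>2 * (x i * y i))"
    unfolding riesz_def prod.distrib[symmetric] of_real_prod
    by (subst expect_coin_prod) (simp only:)
  have "Im a * Im b = Re ((a * cnj b - a * b) / 2)" for a b
    by simp
  then have "expect (coin_flips N) (\<lambda>w. Im (riesz N c w x) * Im (riesz N c w y)) =
      Re (expect (coin_flips N) (\<lambda>w. (riesz N c w x * cnj (riesz N c w y) - riesz N c w x * riesz N c w y) / 2))"
    by (simp only: expect_Re(1)[OF finite_coin_flips])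
  also have "\<dots> = ((\<Prod>i<N. 1 + c\<^sup>2 * (x i * y i)) - (\<Prod>i<N. 1 - c\<^sup>2 * (x i * y i))) / 2"
    by (simp add: expect_diff finite_coin_flips 1 2 del: of_real_prod)
  finally show ?thesis .
qed

text \<open>
  To first order in \<open>l\<close> the two products are the exponentials of \<open>l\<close> and \<open>-l\<close> times the scalar product; the
  second order error \<open>2 l\<^sup>2 (\<Sum>i<N. (a i)\<^sup>2) \<le> 32 l\<^sup>2\<close> is absorbed by \<open>l \<epsilon>\<close>.
\<close>
lemma riesz_products_separate:
  fixes a :: "nat \<Rightarrow> real"
  assumes l: "0 < l" "l \<le> 1/8" "32 * l \<le> \<epsilon>"
    and a: "(\<Sum>i<N. \<bar>a i\<bar>) \<le> 4" "(\<Sum>i<N. a i) \<le> - \<epsilon>"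
  shows "(\<Prod>i<N. 1 + l * a i) - (\<Prod>i<N. 1 - l * a i) \<le> exp (- (l * \<epsilon>)) - 1"
proof -
  have ai: "\<bar>a i\<bar> \<le> 4" if "i < N" for i
    using member_le_sum[of i "{..<N}" "\<lambda>i. \<bar>a i\<bar>"] a(1) that by auto
  have la: "\<bar>l * a i\<bar> \<le> 1/2" if "i < N" for i
  proof -
    have "l * \<bar>a i\<bar> \<le> 1/8 * 4"
      using l ai[OF that] by (intro mult_mono) auto
    then show ?thesis
      using l by (simp add: abs_mult)
  qed
  have "(\<Prod>i<N. 1 + l * a i) \<le> (\<Prod>i<N. exp (l * a i))"
    using la by (intro prod_mono conjI exp_ge_add_one_self) (fastforce simp: abs_le_iff)
  also have "\<dots> = exp (l * (\<Sum>i<N. a i))"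
    by (simp add: exp_sum sum_distrib_left)
  also have "\<dots> \<le> exp (- (l * \<epsilon>))"
    using mult_left_mono[OF a(2), of l] l by simp
  finally have up: "(\<Prod>i<N. 1 + l * a i) \<le> exp (- (l * \<epsilon>))" .
  have sq: "(\<Sum>i<N. (a i)\<^sup>2) \<le> 16"
  proof -
    have "(a i)\<^sup>2 \<le> 4 * \<bar>a i\<bar>" if "i < N" for i
      using mult_right_mono[OF ai[OF that], of "\<bar>a i\<bar>"] by (simp add: power2_eq_square)
    then have "(\<Sum>i<N. (a i)\<^sup>2) \<le> (\<Sum>i<N. 4 * \<bar>a i\<bar>)"
      by (intro sum_mono) auto
    then show ?thesis
      using a(1) by (simp flip: sum_distrib_left)
  qed
  have "l * (\<Sum>i<N. a i) \<le> l * (- \<epsilon>)" "l * (32 * l) \<le> l * \<epsilon>"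
    using l by (intro mult_left_mono a(2); simp)+
  moreover have "2 * l\<^sup>2 * (\<Sum>i<N. (a i)\<^sup>2) \<le> 2 * l\<^sup>2 * 16"
    using sq by (intro mult_left_mono) auto
  ultimately have "0 \<le> - l * (\<Sum>i<N. a i) - 2 * l\<^sup>2 * (\<Sum>i<N. (a i)\<^sup>2)"
    by (simp add: power2_eq_square)
  then have "1 \<le> exp (- l * (\<Sum>i<N. a i) - 2 * l\<^sup>2 * (\<Sum>i<N. (a i)\<^sup>2))"
    by simp
  also have "\<dots> = (\<Prod>i<N. exp (- (l * a i) - 2 * (l * a i)\<^sup>2))"
    by (simp add: exp_sum[symmetric] sum_subtractf sum_negf sum_distrib_left power_mult_distrib mult_ac)
  also have "\<dots> \<le> (\<Prod>i<N. 1 - l * a i)"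
  proof (intro prod_mono conjI)
    fix i assume "i \<in> {..<N}"
    then have "\<bar>- (l * a i)\<bar> \<le> 1/2"
      using la by simp
    then have "\<bar>ln (1 + - (l * a i)) - - (l * a i)\<bar> \<le> 2 * (- (l * a i))\<^sup>2"
      by (rule abs_ln_one_plus_x_minus_x_bound)
    then have "- (l * a i) - 2 * (l * a i)\<^sup>2 \<le> ln (1 - l * a i)"
      by (simp add: abs_le_iff)
    moreover have "0 < 1 - l * a i"
      using \<open>\<bar>- (l * a i)\<bar> \<le> 1/2\<close> by linarith
    ultimately have "- (l * a i) - 2 * (l * a i)\<^sup>2 \<le> ln (1 - l * a i)" "0 < 1 - l * a i"
      by auto
    then show "exp (- (l * a i) - 2 * (l * a i)\<^sup>2) \<le> 1 - l * a i"
      by (metis exp_le_cancel_iff exp_ln)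
  qed simp
  finally show ?thesis
    using up by linarith
qed

text \<open>
  The factor \<open>\<rho>\<close> normalises the imaginary part of the Riesz product to be bounded by \<open>1\<close>.  Points of norm up
  to \<open>2\<close> are admitted because rounding moves unit vectors off the sphere.
\<close>
lemma overlap_sign_field:
  fixes \<epsilon> :: real
  assumes \<epsilon>: "0 < \<epsilon>"
  shows "\<exists>\<delta>>0. \<forall>N (X :: (nat \<Rightarrow> real) set). finite X \<longrightarrow> (\<forall>x\<in>X. (\<Sum>i<N. (x i)\<^sup>2) \<le> 4) \<longrightarrow>
    (\<exists>K D. sign_field X K D \<and> (\<forall>x\<in>X. \<forall>y\<in>X. (\<Sum>i<N. x i * y i) \<le> - \<epsilon> \<longrightarrow> K x y \<le> - \<delta>))"
proof -
  define l where "l = min (1/8) (\<epsilon> / 32)"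
  have l: "0 < l" "l \<le> 1/8" "32 * l \<le> \<epsilon>"
    using \<epsilon> by (auto simp: l_def)
  define c where "c = sqrt l"
  have c: "c\<^sup>2 = l"
    using l by (simp add: c_def)
  define \<rho> where "\<rho> = exp (- (2 * l))"
  define \<delta> where "\<delta> = \<rho>\<^sup>2 * (1 - exp (- (l * \<epsilon>))) / 2"
  have \<delta>: "0 < \<delta>"
    using l \<epsilon> by (simp add: \<delta>_def \<rho>_def)
  have "\<exists>K D. sign_field X K D \<and> (\<forall>x\<in>X. \<forall>y\<in>X. (\<Sum>i<N. x i * y i) \<le> - \<epsilon> \<longrightarrow> K x y \<le> - \<delta>)"
    if X: "finite X" "\<forall>x\<in>X. (\<Sum>i<N. (x i)\<^sup>2) \<le> 4" for N and X :: "(nat \<Rightarrow> real) set"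
  proof -
    define s where "s w x = \<rho> * Im (riesz N c w x)" for w x
    have s1: "\<bar>s w x\<bar> \<le> 1" if "x \<in> X" for w x
    proof -
      have "\<bar>Im (riesz N c w x)\<bar> \<le> exp (c\<^sup>2 * (\<Sum>i<N. (x i)\<^sup>2) / 2)"
        using abs_Im_le_cmod norm_riesz_le by (rule order.trans)
      also have "\<dots> \<le> exp (2 * l)"
        using X(2) that mult_left_mono[of "\<Sum>i<N. (x i)\<^sup>2" 4 l] l unfolding c by auto
      finally have "\<rho> * \<bar>Im (riesz N c w x)\<bar> \<le> \<rho> * exp (2 * l)"
        by (simp add: \<rho>_def)
      then show ?thesis
        by (simp add: s_def abs_mult \<rho>_def flip: exp_add)
    qed
    have mean: "expect (coin_flips N) (\<lambda>w. s w x) = 0" for x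
      by (simp add: s_def riesz_mean)
    obtain D where D: "sign_field X (\<lambda>x y. if x = y then 1 else expect (coin_flips N) (\<lambda>w. s w x * s w y)) D"
      using randomized_rounding[OF X(1) finite_coin_flips, of s N] s1 mean by blast
    have "(if x = y then 1 else expect (coin_flips N) (\<lambda>w. s w x * s w y)) \<le> - \<delta>"
      if x: "x \<in> X" and y: "y \<in> X" and xy: "(\<Sum>i<N. x i * y i) \<le> - \<epsilon>" for x y
    proof -
      have "x \<noteq> y"
      proof
        assume "x = y"
        then have "0 \<le> (\<Sum>i<N. x i * y i)"
          by (auto intro: sum_nonneg)
        then show False
          using xy \<epsilon> by simp
      qed
      have "\<bar>x i * y i\<bar> \<le> ((x i)\<^sup>2 + (y i)\<^sup>2) / 2" for i
        using sum_squares_bound[of "\<bar>x i\<bar>" "\<bar>y i\<bar>"] by (simp add: abs_mult)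
      then have "(\<Sum>i<N. \<bar>x i * y i\<bar>) \<le> (\<Sum>i<N. ((x i)\<^sup>2 + (y i)\<^sup>2) / 2)"
        by (intro sum_mono)
      also have "\<dots> = ((\<Sum>i<N. (x i)\<^sup>2) + (\<Sum>i<N. (y i)\<^sup>2)) / 2"
        by (simp add: sum.distrib flip: sum_divide_distrib)
      also have "\<dots> \<le> (4 + 4) / 2"
        using X(2) x y by (intro divide_right_mono add_mono) auto
      finally have "(\<Sum>i<N. \<bar>x i * y i\<bar>) \<le> 4"
        by simp
      then have sep: "(\<Prod>i<N. 1 + l * (x i * y i)) - (\<Prod>i<N. 1 - l * (x i * y i)) \<le> exp (- (l * \<epsilon>)) - 1"
        by (intro riesz_products_separate l xy)
      have "expect (coin_flips N) (\<lambda>w. s w x * s w y) =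
          expect (coin_flips N) (\<lambda>w. \<rho>\<^sup>2 * (Im (riesz N c w x) * Im (riesz N c w y)))"
        by (simp add: s_def power2_eq_square mult_ac)
      also have "\<dots> = \<rho>\<^sup>2 / 2 * ((\<Prod>i<N. 1 + l * (x i * y i)) - (\<Prod>i<N. 1 - l * (x i * y i)))"
        by (simp add: riesz_covariance c)
      also have "\<dots> \<le> \<rho>\<^sup>2 / 2 * (exp (- (l * \<epsilon>)) - 1)"
        using sep by (intro mult_left_mono) auto
      also have "\<dots> = - \<delta>"
        by (simp add: \<delta>_def field_simps)
      finally show ?thesis
        using \<open>x \<noteq> y\<close> by simp
    qed
    then show ?thesis
      using D by blast
  qed
  then show ?thesis
    using \<delta> by blast
qed

section \<open>From finite sets to the sphere\<close>

text \<open>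
  The \<open>f w\<close> are arbitrary functions, for which \<open>nn_integral\<close> is a lower integral.  Lower integrals are
  superadditive, which is the direction required: simple functions below the \<open>f w\<close> take their place.
\<close>
lemma exists_below_average_nn_integral:
  fixes f :: "'w \<Rightarrow> 'b \<Rightarrow> ennreal"
  assumes Q: "prob_space Q" and R: "finite (set_pmf R)" and c: "c < \<infinity>"
    and avg: "\<And>x. x \<in> space Q \<Longrightarrow> (\<Sum>w\<in>set_pmf R. ennreal (pmf R w) * f w x) \<le> c"
  shows "\<exists>w\<in>set_pmf R. (\<integral>\<^sup>+x. f w x \<partial>Q) \<le> c"
proof (rule ccontr)
  assume "\<not> ?thesis"
  then have "\<forall>w\<in>set_pmf R. \<exists>s. simple_function Q s \<and> s \<le> f w \<and> c < integral\<^sup>S Q s"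
    by (auto simp: nn_integral_def not_le less_SUP_iff)
  then obtain s where s: "\<And>w. w \<in> set_pmf R \<Longrightarrow> simple_function Q (s w)"
      "\<And>w. w \<in> set_pmf R \<Longrightarrow> s w \<le> f w" "\<And>w. w \<in> set_pmf R \<Longrightarrow> c < integral\<^sup>S Q (s w)"
    by metis
  define c' where "c' = Min ((\<lambda>w. integral\<^sup>S Q (s w)) ` set_pmf R)"
  have c': "c < c'"
    unfolding c'_def using R s(3) set_pmf_not_empty by (subst Min_gr_iff) auto
  have "c' = (\<Sum>w\<in>set_pmf R. ennreal (pmf R w)) * c'"
    using sum_pmf_eq_1[OF R order.refl] by (simp add: sum_ennreal)
  also have "\<dots> \<le> (\<Sum>w\<in>set_pmf R. ennreal (pmf R w) * integral\<^sup>S Q (s w))"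
    unfolding sum_distrib_right c'_def using R by (intro sum_mono mult_left_mono Min_le) auto
  also have "\<dots> = (\<Sum>w\<in>set_pmf R. \<integral>\<^sup>+x. ennreal (pmf R w) * s w x \<partial>Q)"
    using s(1) by (intro sum.cong refl)
      (simp add: nn_integral_cmult borel_measurable_simple_function nn_integral_eq_simple_integral)
  also have "\<dots> = (\<integral>\<^sup>+x. (\<Sum>w\<in>set_pmf R. ennreal (pmf R w) * s w x) \<partial>Q)"
    using s(1) by (intro nn_integral_sum[symmetric]) (auto intro: borel_measurable_simple_function)
  also have "\<dots> \<le> (\<integral>\<^sup>+x. c \<partial>Q)"
  proof (intro nn_integral_mono)
    fix x assume "x \<in> space Q"
    have "(\<Sum>w\<in>set_pmf R. ennreal (pmf R w) * s w x) \<le> (\<Sum>w\<in>set_pmf R. ennreal (pmf R w) * f w x)"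
      using s(2) by (intro sum_mono mult_left_mono) (auto simp: le_fun_def)
    then show "(\<Sum>w\<in>set_pmf R. ennreal (pmf R w) * s w x) \<le> c"
      using avg[OF \<open>x \<in> space Q\<close>] by (rule order.trans)
  qed
  also have "\<dots> = c"
    using prob_space.emeasure_space_1[OF Q] by simp
  finally show False
    using c' by simp
qed

text \<open>
  If \<open>g\<close> factors through a map \<open>r\<close> of finite range, then tilting by \<open>g\<close> commutes with passing to the
  distribution of \<open>r\<close>.
\<close>
lemma tilted_finite_range:
  fixes \<nu> :: "'b measure" and r :: "'b \<Rightarrow> 'a" and G :: "'a \<Rightarrow> real"
  assumes \<nu>: "prob_space \<nu>" and X: "finite X" and r: "\<And>z. z \<in> space \<nu> \<Longrightarrow> r z \<in> X"
  defines "A \<equiv> \<lambda>x. {z \<in> space \<nu>. r z = x}"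
  assumes A: "\<And>x. x \<in> X \<Longrightarrow> A x \<in> sets \<nu>"
  defines "\<mu> \<equiv> \<lambda>x. measure \<nu> (A x)"
  shows "(\<lambda>z. G (r z)) \<in> borel_measurable \<nu>" "prob_vector X \<mu>"
    "\<And>x. x \<in> X \<Longrightarrow> emeasure (tilted (\<lambda>z. G (r z)) \<nu>) (A x) = ennreal (tilt X \<mu> G x)"
proof -
  interpret prob_space \<nu> by fact
  have rep: "h (r z) = (\<Sum>x\<in>X. h x * indicator (A x) z)" if z: "z \<in> space \<nu>" for h :: "'a \<Rightarrow> real" and z
  proof -
    have "(\<Sum>x\<in>X. h x * indicator (A x) z) = (\<Sum>x\<in>X. if x = r z then h x else 0)"
      using z by (intro sum.cong) (auto simp: A_def)
    then show ?thesis
      using X r[OF z] by (simp add: sum.delta)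
  qed
  have meas: "(\<lambda>z. h (r z)) \<in> borel_measurable \<nu>" for h :: "'a \<Rightarrow> real"
  proof -
    have "(\<lambda>z. \<Sum>x\<in>X. h x * indicator (A x) z) \<in> borel_measurable \<nu>"
      using A by (intro borel_measurable_sum borel_measurable_times borel_measurable_const borel_measurable_indicator)
    then show ?thesis
      by (subst measurable_cong[OF rep])
  qed
  then show g: "(\<lambda>z. G (r z)) \<in> borel_measurable \<nu>" .
  have int: "(\<integral>z. h (r z) \<partial>\<nu>) = (\<Sum>x\<in>X. \<mu> x * h x)" for h :: "'a \<Rightarrow> real"
  proof -
    have "(\<integral>z. h (r z) \<partial>\<nu>) = (\<integral>z. (\<Sum>x\<in>X. h x * indicator (A x) z) \<partial>\<nu>)"
      using rep by (intro Bochner_Integration.integral_cong) auto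
    also have "\<dots> = (\<Sum>x\<in>X. h x * measure \<nu> (A x))"
      using A by (subst Bochner_Integration.integral_sum) (auto simp: emeasure_eq_measure)
    finally show ?thesis
      by (simp add: \<mu>_def mult.commute)
  qed
  show \<mu>: "prob_vector X \<mu>"
    using int[of "\<lambda>_. 1"] X by (simp add: prob_vector_def \<mu>_def prob_space)
  fix x assume x: "x \<in> X"
  define Z where "Z = (\<Sum>y\<in>X. \<mu> y * exp (G y))"
  have Z: "0 < Z"
    unfolding Z_def by (rule partition_pos[OF \<mu>])
  have Zint: "(\<integral>z. exp (G (r z)) \<partial>\<nu>) = Z"
    using int[of "\<lambda>y. exp (G y)"] by (simp add: Z_def)
  have "emeasure (tilted (\<lambda>z. G (r z)) \<nu>) (A x) = (\<integral>\<^sup>+z. ennreal (exp (G (r z)) / Z) * indicator (A x) z \<partial>\<nu>)"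
    unfolding tilted_def Zint using A[OF x] meas[of "\<lambda>x. exp (G x) / Z"]
    by (intro emeasure_density) auto
  also have "\<dots> = (\<integral>\<^sup>+z. ennreal (exp (G x) / Z) * indicator (A x) z \<partial>\<nu>)"
    by (intro nn_integral_cong) (auto simp: A_def indicator_def)
  also have "\<dots> = ennreal (exp (G x) / Z) * emeasure \<nu> (A x)"
    using A[OF x] by (rule nn_integral_cmult_indicator)
  also have "\<dots> = ennreal (tilt X \<mu> G x)"
    using Z by (simp add: emeasure_eq_measure \<mu>_def tilt_def Z_def ennreal_mult[symmetric] mult.commute)
  finally show "emeasure (tilted (\<lambda>z. G (r z)) \<nu>) (A x) = ennreal (tilt X \<mu> G x)" .
qed

lemma tilted_pair_bound:
  fixes \<nu> :: "'b measure" and r :: "'b \<Rightarrow> 'a" and G :: "'a \<Rightarrow> real"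
  assumes \<nu>: "prob_space \<nu>" and X: "finite X" and r: "\<And>z. z \<in> space \<nu> \<Longrightarrow> r z \<in> X"
    and A: "\<And>x. x \<in> X \<Longrightarrow> {z \<in> space \<nu>. r z = x} \<in> sets \<nu>"
    and S: "S \<subseteq> space \<nu> \<times> space \<nu>" "\<And>z z'. (z, z') \<in> S \<Longrightarrow> W (r z) (r z')"
  shows "emeasure (tilted (\<lambda>z. G (r z)) \<nu> \<Otimes>\<^sub>M tilted (\<lambda>z. G (r z)) \<nu>) S
    \<le> ennreal (pair_avg X (tilt X (\<lambda>x. measure \<nu> {z \<in> space \<nu>. r z = x}) G) (\<lambda>x y. of_bool (W x y)))"
proof -
  define B where "B x = {z \<in> space \<nu>. r z = x}" for x
  define T where "T = tilted (\<lambda>z. G (r z)) \<nu>"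
  define p where "p = tilt X (\<lambda>x. measure \<nu> (B x)) G"
  have p: "prob_vector X p"
    unfolding p_def B_def by (intro prob_vector_tilt tilted_finite_range(2) \<nu> X r A)
  have emB: "emeasure T (B x) = ennreal (p x)" if "x \<in> X" for x
    unfolding T_def p_def B_def by (intro tilted_finite_range(3) \<nu> X r A that)
  have sT: "sets T = sets \<nu>" "space T = space \<nu>"
    by (simp_all add: T_def tilted_def)
  have B: "B x \<in> sets T" if "x \<in> X" for x
    using A[OF that] by (simp add: B_def sT)
  have "emeasure T (space T) \<le> (\<Sum>x\<in>X. emeasure T (B x))"
  proof -
    have "space T = (\<Union>x\<in>X. B x)"
      using r by (auto simp: sT B_def)
    then show ?thesis
      using B X by (metis emeasure_subadditive_finite image_subsetI)
  qed
  also have "\<dots> < \<infinity>"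
    using X emB by (simp add: sum_ennreal prob_vectorD(2)[OF p])
  finally interpret T: finite_measure T
    by (intro finite_measureI) auto
  define I where "I = {(x, y) \<in> X \<times> X. W x y}"
  have I: "finite I" "I \<subseteq> X \<times> X"
    using X by (auto simp: I_def intro: finite_subset[of _ "X \<times> X"])
  have rect: "B x \<times> B y \<in> sets (T \<Otimes>\<^sub>M T)" if "(x, y) \<in> I" for x y
    using that I(2) B by (intro pair_measureI) auto
  have "S \<subseteq> (\<Union>(x, y)\<in>I. B x \<times> B y)"
    using S r by (fastforce simp: I_def B_def)
  then have "emeasure (T \<Otimes>\<^sub>M T) S \<le> emeasure (T \<Otimes>\<^sub>M T) (\<Union>(x, y)\<in>I. B x \<times> B y)"
    using rect I(1) by (intro emeasure_mono sets.finite_UN) auto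
  also have "\<dots> \<le> (\<Sum>(x, y)\<in>I. emeasure (T \<Otimes>\<^sub>M T) (B x \<times> B y))"
  proof -
    have "(\<lambda>(x, y). B x \<times> B y) ` I \<subseteq> sets (T \<Otimes>\<^sub>M T)"
      using rect by auto
    from emeasure_subadditive_finite[OF I(1) this] show ?thesis
      by (simp add: case_prod_unfold)
  qed
  also have "\<dots> = (\<Sum>(x, y)\<in>I. ennreal (p x * p y))"
  proof (intro sum.cong refl)
    fix w assume "w \<in> I"
    then obtain x y where w: "w = (x, y)" "x \<in> X" "y \<in> X"
      using I(2) by auto
    then show "(case w of (x, y) \<Rightarrow> emeasure (T \<Otimes>\<^sub>M T) (B x \<times> B y)) = (case w of (x, y) \<Rightarrow> ennreal (p x * p y))"
      using B emB prob_vectorD(2)[OF p] by (simp add: T.emeasure_pair_measure_Times ennreal_mult)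
  qed
  also have "\<dots> = ennreal (\<Sum>(x, y)\<in>I. p x * p y)"
    using I(2) prob_vectorD(2)[OF p] by (subst sum_ennreal[symmetric]) (auto simp: case_prod_unfold intro!: mult_nonneg_nonneg)
  also have "(\<Sum>(x, y)\<in>I. p x * p y) = pair_avg X p (\<lambda>x y. of_bool (W x y))"
  proof -
    have "(\<Sum>(x, y)\<in>I. p x * p y) = (\<Sum>(x, y)\<in>X \<times> X. p x * (p y * of_bool (W x y)))"
      using X by (intro sum.mono_neutral_cong_left) (auto simp: I_def)
    then show ?thesis
      by (simp add: pair_avg_def sum_distrib_left sum.cartesian_product)
  qed
  finally show ?thesis
    by (simp add: T_def p_def B_def)
qed

definition grid_round :: "nat \<Rightarrow> real \<Rightarrow> (nat \<Rightarrow> real) \<Rightarrow> nat \<Rightarrow> real" where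
  "grid_round N M z i = (if i < N then real_of_int \<lfloor>M * z i\<rfloor> / M else 0)"

lemma grid_round_error:
  assumes "0 < M" "i < N"
  shows "\<bar>grid_round N M z i - z i\<bar> \<le> 1 / M"
proof -
  have "\<bar>real_of_int \<lfloor>M * z i\<rfloor> - M * z i\<bar> \<le> 1"
    by linarith
  then have "\<bar>real_of_int \<lfloor>M * z i\<rfloor> - M * z i\<bar> / M \<le> 1 / M"
    using assms by (intro divide_right_mono) auto
  moreover have "grid_round N M z i - z i = (real_of_int \<lfloor>M * z i\<rfloor> - M * z i) / M"
    using assms by (simp add: grid_round_def field_simps)
  ultimately show ?thesis
    using assms by (simp only: abs_divide abs_of_pos)
qed

lemma unit_vector_coordinate:
  assumes "scalar_prod N z z = 1" "i < N"
  shows "\<bar>z i\<bar> \<le> 1"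
proof -
  have "(z i)\<^sup>2 \<le> (\<Sum>i<N. (z i)\<^sup>2)"
    using assms by (intro member_le_sum) auto
  then have "(z i)\<^sup>2 \<le> 1"
    using assms(1) by (simp add: scalar_prod_def power2_eq_square)
  then show ?thesis
    by (simp add: abs_square_le_1)
qed

lemma grid_round_norm:
  assumes "0 < M" "real N \<le> M" "1 \<le> M" "scalar_prod N z z = 1"
  shows "(\<Sum>i<N. (grid_round N M z i)\<^sup>2) \<le> 4"
proof -
  have "(grid_round N M z i)\<^sup>2 \<le> 2 * (z i)\<^sup>2 + 2 * (1 / M)\<^sup>2" if "i < N" for i
  proof -
    define e where "e = grid_round N M z i - z i"
    have "e\<^sup>2 \<le> (1 / M)\<^sup>2"
      using power_mono[OF grid_round_error[OF assms(1) that, of z], of 2] by (simp add: e_def)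
    moreover have "(z i + e)\<^sup>2 \<le> 2 * (z i)\<^sup>2 + 2 * e\<^sup>2"
      using sum_squares_bound[of "z i" e] by (simp add: power2_sum)
    ultimately show ?thesis
      by (simp add: e_def)
  qed
  then have "(\<Sum>i<N. (grid_round N M z i)\<^sup>2) \<le> (\<Sum>i<N. 2 * (z i)\<^sup>2 + 2 * (1 / M)\<^sup>2)"
    by (intro sum_mono) auto
  also have "\<dots> = 2 * scalar_prod N z z + 2 * (N * (1 / M)\<^sup>2)"
    by (simp add: sum.distrib scalar_prod_def power2_eq_square sum_distrib_left)
  also have "real N * (1 / M)\<^sup>2 \<le> M * (1 / M)\<^sup>2"
    using assms by (intro mult_right_mono) auto
  also have "M * (1 / M)\<^sup>2 \<le> 1"
    using assms by (simp add: power2_eq_square)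
  finally show ?thesis
    using assms by simp
qed

lemma grid_round_scalar_prod:
  assumes "0 < M" "1 \<le> M" "scalar_prod N z z = 1" "scalar_prod N z' z' = 1"
  shows "(\<Sum>i<N. grid_round N M z i * grid_round N M z' i) \<le> scalar_prod N z z' + 3 * real N / M"
proof -
  have "grid_round N M z i * grid_round N M z' i \<le> z i * z' i + 3 / M" if i: "i < N" for i
  proof -
    define x y where "x = grid_round N M z i" and "y = grid_round N M z' i"
    have x: "\<bar>x - z i\<bar> \<le> 1 / M" and y: "\<bar>y - z' i\<bar> \<le> 1 / M"
      unfolding x_def y_def using assms(1) i by (intro grid_round_error; simp)+
    have z: "\<bar>z i\<bar> \<le> 1" "\<bar>z' i\<bar> \<le> 1"
      using unit_vector_coordinate assms i by auto
    have M: "1 / M \<le> 1"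
      using assms by simp
    have "\<bar>y\<bar> \<le> 2"
      using y z M by linarith
    then have "\<bar>(x - z i) * y\<bar> \<le> 1 / M * 2"
      unfolding abs_mult using x assms by (intro mult_mono) auto
    moreover have "\<bar>z i * (y - z' i)\<bar> \<le> 1 * (1 / M)"
      unfolding abs_mult using y z by (intro mult_mono) auto
    moreover have "x * y = z i * z' i + (x - z i) * y + z i * (y - z' i)"
      by (simp add: algebra_simps)
    ultimately show ?thesis
      by (simp add: x_def[symmetric] y_def[symmetric])
  qed
  then have "(\<Sum>i<N. grid_round N M z i * grid_round N M z' i) \<le> (\<Sum>i<N. z i * z' i + 3 / M)"
    by (intro sum_mono) auto
  then show ?thesis
    by (simp add: sum.distrib scalar_prod_def mult.commute)
qed

lemma finite_grid_round:
  assumes M: "0 \<le> M"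
  shows "finite (grid_round N M ` {z. scalar_prod N z z = 1})"
proof (rule finite_subset)
  let ?K = "PiE {..<N} (\<lambda>_. {- \<lceil>M\<rceil> - 1..\<lceil>M\<rceil>})"
  show "finite ((\<lambda>k i. if i < N then real_of_int (k i) / M else 0) ` ?K)"
    by (intro finite_imageI finite_PiE) auto
  show "grid_round N M ` {z. scalar_prod N z z = 1} \<subseteq> (\<lambda>k i. if i < N then real_of_int (k i) / M else 0) ` ?K"
  proof clarify
    fix z assume z: "scalar_prod N z z = 1"
    have "\<lfloor>M * z i\<rfloor> \<in> {- \<lceil>M\<rceil> - 1..\<lceil>M\<rceil>}" if "i < N" for i
    proof -
      have "\<bar>M * z i\<bar> \<le> M"
        using unit_vector_coordinate[OF z that] M by (simp add: abs_mult mult_left_le)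
      then show ?thesis
        by simp linarith
    qed
    then have "(\<lambda>i\<in>{..<N}. \<lfloor>M * z i\<rfloor>) \<in> ?K"
      by auto
    moreover have "grid_round N M z = (\<lambda>i. if i < N then real_of_int ((\<lambda>i\<in>{..<N}. \<lfloor>M * z i\<rfloor>) i) / M else 0)"
      by (auto simp: grid_round_def)
    ultimately show "grid_round N M z \<in> (\<lambda>k i. if i < N then real_of_int (k i) / M else 0) ` ?K"
      by blast
  qed
qed

lemma grid_cell_measurable:
  "{z \<in> space (borel_of (nsphere n)). grid_round N M z = grid_round N M y} \<in> sets (borel_of (nsphere n))"
proof -
  note [measurable] = coordinate_measurable_sphere
  have "{z \<in> space (borel_of (nsphere n)). \<forall>i\<in>{..<N}. grid_round N M z i = grid_round N M y i}
      \<in> sets (borel_of (nsphere n))"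
    unfolding grid_round_def by measurable
  moreover have "{z \<in> space (borel_of (nsphere n)). \<forall>i\<in>{..<N}. grid_round N M z i = grid_round N M y i} =
      {z \<in> space (borel_of (nsphere n)). grid_round N M z = grid_round N M y}"
    by (auto simp: fun_eq_iff grid_round_def)
  ultimately show ?thesis
    by simp
qed

theorem corollary1:
  shows "\<exists>L::real. \<forall>\<epsilon>::real. \<epsilon> > 0 \<longrightarrow> (\<exists>v::real. v > 0 \<and>
    (\<forall>N::nat. N \<ge> 1 \<longrightarrow>
      (\<forall>Q :: (nat \<Rightarrow> real) measure measure.
        prob_space Q \<and> sets Q = sets (borel_of (weak_topology (unit_sphere N))) \<longrightarrow>
        (\<exists>g \<in> borel_measurable (borel_of (unit_sphere N)).
          (\<forall>z \<in> topspace (unit_sphere N). \<bar>g z\<bar> \<le> L * v * sqrt (real N)) \<and>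
          (\<integral>\<^sup>+ \<nu>. emeasure (tilted g \<nu> \<Otimes>\<^sub>M tilted g \<nu>) (negative_overlap N \<epsilon>) \<partial>Q) \<le> ennreal \<epsilon>))))"
proof (rule exI[of _ 1], intro allI impI)
  fix \<epsilon> :: real assume \<epsilon>: "\<epsilon> > 0"
  obtain \<delta> where \<delta>: "0 < \<delta>" and kernel: "\<And>N (X :: (nat \<Rightarrow> real) set). finite X \<Longrightarrow>
      \<forall>x\<in>X. (\<Sum>i<N. (x i)\<^sup>2) \<le> 4 \<Longrightarrow>
      \<exists>K D. sign_field X K D \<and> (\<forall>x\<in>X. \<forall>y\<in>X. (\<Sum>i<N. x i * y i) \<le> - (\<epsilon> / 2) \<longrightarrow> K x y \<le> - \<delta>)"
    using overlap_sign_field[of "\<epsilon> / 2"] \<epsilon> by auto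
  obtain V where V: "V \<ge> 0" and finite_case: "\<And>(X :: (nat \<Rightarrow> real) set) K D. sign_field X K D \<Longrightarrow>
      \<exists>R :: ((nat \<Rightarrow> real) \<Rightarrow> real) pmf. finite (set_pmf R) \<and> (\<forall>G\<in>set_pmf R. \<forall>x. \<bar>G x\<bar> \<le> V) \<and>
      (\<forall>\<mu>. prob_vector X \<mu> \<longrightarrow> expect R (\<lambda>G. pair_avg X (tilt X \<mu> G) (\<lambda>x y. of_bool (K x y \<le> - \<delta>))) \<le> \<epsilon>)"
    using negative_pairs_rarely_survive[OF \<epsilon> \<delta>] by metis
  show "\<exists>v>0. \<forall>N\<ge>1. \<forall>Q :: (nat \<Rightarrow> real) measure measure.
        prob_space Q \<and> sets Q = sets (borel_of (weak_topology (unit_sphere N))) \<longrightarrow>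
        (\<exists>g \<in> borel_measurable (borel_of (unit_sphere N)).
          (\<forall>z \<in> topspace (unit_sphere N). \<bar>g z\<bar> \<le> 1 * v * sqrt (real N)) \<and>
          (\<integral>\<^sup>+ \<nu>. emeasure (tilted g \<nu> \<Otimes>\<^sub>M tilted g \<nu>) (negative_overlap N \<epsilon>) \<partial>Q) \<le> ennreal \<epsilon>)"
  proof (intro exI[of _ "V + 1"] conjI allI impI, goal_cases)
    case 1
    then show ?case using V by simp
  next
    case (2 N Q)
    then have N: "N \<ge> 1" and Q: "prob_space Q"
      and setsQ: "sets Q = sets (borel_of (weak_topology (unit_sphere N)))"
      by auto
    define S where "S = topspace (unit_sphere N)"
    have S: "S = {z. (\<forall>i\<ge>N. z i = 0) \<and> scalar_prod N z z = 1}"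
      unfolding S_def by (rule topspace_unit_sphere[OF N])
    \<comment> \<open>The mesh \<open>1/M\<close> changes scalar products by at most \<open>\<epsilon>/2\<close>; the choice of \<open>M\<close> does not affect the bound \<open>V\<close>.\<close>
    define M where "M = real N + 6 * real N / \<epsilon>"
    have M: "0 < M" "1 \<le> M" "real N \<le> M" "3 * real N / M \<le> \<epsilon> / 2"
    proof -
      have "0 \<le> 6 * real N / \<epsilon>" "1 \<le> real N"
        using \<epsilon> N by auto
      then show "0 < M" "1 \<le> M" "real N \<le> M"
        unfolding M_def by linarith+
      then show "3 * real N / M \<le> \<epsilon> / 2"
        using \<epsilon> unfolding M_def by (simp add: divide_le_eq field_simps)
    qed
    define r where "r = grid_round N M"
    define X where "X = r ` S"
    have X: "finite X"
      unfolding X_def r_def using M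
      by (intro finite_subset[OF image_mono finite_grid_round[of M N]]) (auto simp: S)
    have "\<forall>x\<in>X. (\<Sum>i<N. (x i)\<^sup>2) \<le> 4"
      unfolding X_def r_def S using M by (auto intro!: grid_round_norm)
    from kernel[OF X this] obtain K D where D: "sign_field X K D"
      and K: "\<And>x y. x \<in> X \<Longrightarrow> y \<in> X \<Longrightarrow> (\<Sum>i<N. x i * y i) \<le> - (\<epsilon> / 2) \<Longrightarrow> K x y \<le> - \<delta>"
      by blast
    from finite_case[OF D] obtain R :: "((nat \<Rightarrow> real) \<Rightarrow> real) pmf" where finR: "finite (set_pmf R)"
      and GV: "\<And>G x. G \<in> set_pmf R \<Longrightarrow> \<bar>G x\<bar> \<le> V"
      and R: "\<And>\<mu>. prob_vector X \<mu> \<Longrightarrow> expect R (\<lambda>G. pair_avg X (tilt X \<mu> G) (\<lambda>x y. of_bool (K x y \<le> - \<delta>))) \<le> \<epsilon>"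
      by blast
    define \<Phi> where "\<Phi> G \<nu> = emeasure (tilted (\<lambda>z. G (r z)) \<nu> \<Otimes>\<^sub>M tilted (\<lambda>z. G (r z)) \<nu>) (negative_overlap N \<epsilon>)"
      for G \<nu>
    let ?B = "borel_of (unit_sphere N)"
    have spaceB: "space ?B = S"
      by (simp add: space_borel_of S_def)
    have cells: "{z \<in> space ?B. r z = x} \<in> sets ?B" if "x \<in> X" for x
      using that grid_cell_measurable[of "N - 1" N M] by (auto simp: X_def r_def)
    have "(\<Sum>G\<in>set_pmf R. ennreal (pmf R G) * \<Phi> G \<nu>) \<le> ennreal \<epsilon>" if "\<nu> \<in> space Q" for \<nu>
    proof -
      have "space Q = borel_prob_measures (unit_sphere N)"
        using sets_eq_imp_space_eq[OF setsQ] by (simp add: space_borel_of topspace_weak_topology)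
      then have \<nu>: "prob_space \<nu>" and sets\<nu>: "sets \<nu> = sets ?B"
        using that by (auto simp: borel_prob_measures_def)
      have space\<nu>: "space \<nu> = S"
        using sets_eq_imp_space_eq[OF sets\<nu>] spaceB by simp
      have rX: "r z \<in> X" if "z \<in> space \<nu>" for z
        using that by (simp add: X_def space\<nu>)
      have cells\<nu>: "{z \<in> space \<nu>. r z = x} \<in> sets \<nu>" if "x \<in> X" for x
        using cells[OF that] by (simp only: sets\<nu> space\<nu> spaceB)
      define \<mu> where "\<mu> x = measure \<nu> {z \<in> space \<nu>. r z = x}" for x
      have \<mu>: "prob_vector X \<mu>"
        using tilted_finite_range(2)[OF \<nu> X rX cells\<nu>] by (simp add: \<mu>_def[abs_def])
      define b where "b G = pair_avg X (tilt X \<mu> G) (\<lambda>x y. of_bool (K x y \<le> - \<delta>))" for G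
      have b0: "0 \<le> b G" for G
        unfolding b_def pair_avg_def using prob_vectorD(2)[OF prob_vector_tilt[OF \<mu>]]
        by (intro sum_nonneg mult_nonneg_nonneg) auto
      have \<Phi>b: "\<Phi> G \<nu> \<le> ennreal (b G)" for G
        unfolding \<Phi>_def b_def \<mu>_def[abs_def]
      proof (intro tilted_pair_bound \<nu> X rX cells\<nu>)
        show "negative_overlap N \<epsilon> \<subseteq> space \<nu> \<times> space \<nu>"
          by (auto simp: negative_overlap_def space\<nu> S_def)
        fix z z' assume "(z, z') \<in> negative_overlap N \<epsilon>"
        then have z: "z \<in> S" "z' \<in> S" and zz: "scalar_prod N z z' \<le> - \<epsilon>"
          by (auto simp: negative_overlap_def S_def)
        have "(\<Sum>i<N. r z i * r z' i) \<le> scalar_prod N z z' + 3 * real N / M"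
          unfolding r_def using M z by (intro grid_round_scalar_prod) (auto simp: S)
        then show "K (r z) (r z') \<le> - \<delta>"
          using z zz M(4) by (intro K) (auto simp: X_def)
      qed
      have "(\<Sum>G\<in>set_pmf R. ennreal (pmf R G) * \<Phi> G \<nu>) \<le> (\<Sum>G\<in>set_pmf R. ennreal (pmf R G * b G))"
        using \<Phi>b b0 by (intro sum_mono) (simp add: ennreal_mult mult_left_mono)
      also have "\<dots> = ennreal (\<Sum>G\<in>set_pmf R. pmf R G * b G)"
        using b0 by (intro sum_ennreal) auto
      also have "(\<Sum>G\<in>set_pmf R. pmf R G * b G) = expect R b"
        using finR by (subst integral_measure_pmf[of "set_pmf R"]) auto
      also have "expect R b \<le> \<epsilon>"
        using R[OF \<mu>] by (simp add: b_def[abs_def])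
      finally show ?thesis
        by (simp add: ennreal_leI)
    qed
    then obtain G where G: "G \<in> set_pmf R" and int: "(\<integral>\<^sup>+\<nu>. \<Phi> G \<nu> \<partial>Q) \<le> ennreal \<epsilon>"
      using exists_below_average_nn_integral[OF Q finR, of "ennreal \<epsilon>" \<Phi>] by auto
    show ?case
    proof (intro bexI[of _ "\<lambda>z. G (r z)"] conjI ballI)
      show "(\<integral>\<^sup>+\<nu>. emeasure (tilted (\<lambda>z. G (r z)) \<nu> \<Otimes>\<^sub>M tilted (\<lambda>z. G (r z)) \<nu>) (negative_overlap N \<epsilon>) \<partial>Q) \<le> ennreal \<epsilon>"
        using int by (simp add: \<Phi>_def)
      show "\<bar>G (r z)\<bar> \<le> 1 * (V + 1) * sqrt (real N)" for z
      proof -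
        have "(V + 1) * 1 \<le> (V + 1) * sqrt (real N)"
          using V N by (intro mult_left_mono) auto
        then show ?thesis
          using GV[OF G, of "r z"] by simp
      qed
      show "(\<lambda>z. G (r z)) \<in> borel_measurable ?B"
      proof -
        have "(\<lambda>z. G (r z)) -` U \<inter> space ?B = (\<Union>x\<in>{x \<in> X. G x \<in> U}. {z \<in> space ?B. r z = x})" for U
          unfolding spaceB X_def by auto
        moreover have "(\<Union>x\<in>{x \<in> X. G x \<in> U}. {z \<in> space ?B. r z = x}) \<in> sets ?B" for U
          using X cells by (intro sets.finite_UN) auto
        ultimately show ?thesis
          by (intro measurableI) auto
      qed
    qed
  qed
qed

end
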